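(* Let $\{\mathcal{M}^n_t\}_{t\in[t_0,T)}$ be a smooth family of boundaries $\mathcal{M}^n_t=\partial\Omega_t$ of bounded convex bodies $\Omega_t\subset\mathbb{R}^{n+1}$ evolving by mean curvature. Suppose that the boundaries $\mathcal{M}^n_t$ contract to a point at time $T$. Then the square root $w:=(2(u-t_0))^{1/2}$ of the arrival time $u:\Omega_{t_0}\to\mathbb{R}$ is concave. Equivalently, $$\partial_tH+2\nabla_VH+A(V,V)+\frac{H}{2(t-t_0)}\ge0\quad\text{for all }V\in T\mathcal{M}_t,\ t\in(t_0,T).$$ If the solution is ancient (that is, $t_0=-\infty$ and the family is defined for $t\in(-\infty,T)$), then the arrival time $u$ is concave. Equivalently, $$\partial_tH+2\nabla_VH+A(V,V)\ge0\quad\text{for all }V\in T\mathcal{M}_t,\ t\in(-\infty,T).$$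
   Context: The family evolves by mean curvature if it moves with normal velocity $-H\nu$, where $\nu(x,t)$ is the outward unit normal to $\mathcal{M}^n_t$ at $x$ and $H=\mathrm{div}\,\nu$ is the mean curvature (the trace of the second fundamental form $A$, with the sign convention that $A\ge0$ for boundaries of convex bodies). $\nabla$ denotes the gradient/derivative along $\mathcal{M}_t$, and $\partial_tH$ is the time derivative of $H$ along a family of parametrizations $X(\cdot,t)$ of $\mathcal{M}^n_t$ satisfying $\partial_tX=-H\nu$. The arrival time $u$ is the function determined by $u(p)=t\iff p\in\mathcal{M}^n_t$; it is well defined since the hypersurfaces move monotonically inwards, and at the point to which the hypersurfaces contract it takes the value $T$. For an ancient solution, the domain $\Omega_{t_0}$ of $u$ is understood as $\bigcup_{t<T}\Omega_t$. *)

theory Defs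
  imports "HOL-Analysis.Analysis"
begin

subsection \<open>Smooth maps\<close>

primrec Ck_on :: "nat \<Rightarrow> 'a::euclidean_space set \<Rightarrow> ('a \<Rightarrow> 'b::euclidean_space) \<Rightarrow> bool" where
  "Ck_on 0 U f \<longleftrightarrow> continuous_on U f"
| "Ck_on (Suc k) U f \<longleftrightarrow>
     (\<forall>x\<in>U. f differentiable (at x)) \<and> (\<forall>v. Ck_on k U (\<lambda>x. frechet_derivative f (at x) v))"

text \<open>\<^const>\<open>Ck_on\<close> is meaningful on open sets only. On an arbitrary set (such as a sphere times
  a half-open time interval) a map is smooth if it extends smoothly to an open neighbourhood.\<close>

definition smooth_on :: "'a::euclidean_space set \<Rightarrow> ('a \<Rightarrow> 'b::euclidean_space) \<Rightarrow> bool" where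
  "smooth_on S f \<longleftrightarrow>
     (\<exists>U g. open U \<and> S \<subseteq> U \<and> (\<forall>k. Ck_on k U g) \<and> (\<forall>x\<in>S. g x = f x))"

subsection \<open>Extrinsic geometry of a smooth boundary\<close>

definition tangent_space :: "'a::euclidean_space set \<Rightarrow> 'a \<Rightarrow> 'a set" where
  "tangent_space M x =
     {V. \<exists>\<gamma>::real \<Rightarrow> 'a. \<gamma> 0 = x \<and> (\<forall>s. \<gamma> s \<in> M) \<and> (\<gamma> has_vector_derivative V) (at 0)}"

text \<open>The derivative along \<open>M\<close> at \<open>x\<close> in the direction \<open>V\<close>. A derivative at \<open>x\<close> within a hypersurface
  \<open>M\<close> is not unique as a linear map on the ambient space, but any two of them agree on
  \<open>tangent_space M x\<close>, and only such \<open>V\<close> are used below.\<close>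

definition deriv_along ::
    "'a::euclidean_space set \<Rightarrow> ('a \<Rightarrow> 'b::euclidean_space) \<Rightarrow> 'a \<Rightarrow> 'a \<Rightarrow> 'b" where
  "deriv_along M f x V = frechet_derivative f (at x within M) V"

definition outward_normal :: "'a::euclidean_space set \<Rightarrow> 'a \<Rightarrow> 'a" where
  "outward_normal \<Omega> x =
     (THE N. norm N = 1 \<and> (\<forall>V\<in>tangent_space (frontier \<Omega>) x. N \<bullet> V = 0) \<and>
             (\<forall>\<^sub>F s in at_right 0. x + s *\<^sub>R N \<notin> \<Omega>))"

definition second_fundamental_form :: "'a::euclidean_space set \<Rightarrow> 'a \<Rightarrow> 'a \<Rightarrow> 'a \<Rightarrow> real" where
  "second_fundamental_form \<Omega> x V W = deriv_along (frontier \<Omega>) (outward_normal \<Omega>) x V \<bullet> W"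

definition orthonormal_basis_of :: "'a::euclidean_space set \<Rightarrow> 'a set \<Rightarrow> bool" where
  "orthonormal_basis_of T B \<longleftrightarrow> pairwise orthogonal B \<and> (\<forall>e\<in>B. norm e = 1) \<and> span B = T"

definition mean_curvature :: "'a::euclidean_space set \<Rightarrow> 'a \<Rightarrow> real" where
  "mean_curvature \<Omega> x =
     (\<Sum>e\<in>(SOME B. orthonormal_basis_of (tangent_space (frontier \<Omega>) x) B).
        second_fundamental_form \<Omega> x e e)"

subsection \<open>Mean curvature flow of boundaries of convex bodies\<close>

definition convex_body :: "'a::euclidean_space set \<Rightarrow> bool" where
  "convex_body K \<longleftrightarrow> compact K \<and> convex K \<and> interior K \<noteq> {}"

text \<open>\<open>X\<close> is a smooth family of embeddings with images \<open>\<partial>\<Omega>\<^sub>t\<close>. The parameter manifold is the unit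
  sphere, because every smooth boundary of a bounded convex body is diffeomorphic to it.\<close>

definition smooth_parametrization ::
    "real set \<Rightarrow> (real \<Rightarrow> 'a::euclidean_space set) \<Rightarrow> ('a \<Rightarrow> real \<Rightarrow> 'a) \<Rightarrow> bool" where
  "smooth_parametrization I \<Omega> X \<longleftrightarrow>
     smooth_on (sphere 0 1 \<times> I) (\<lambda>(z, t). X z t) \<and>
     (\<forall>t\<in>I. bij_betw (\<lambda>z. X z t) (sphere 0 1) (frontier (\<Omega> t)) \<and>
        (\<forall>z\<in>sphere 0 1. \<forall>V\<in>tangent_space (sphere 0 1) z.
           deriv_along (sphere 0 1) (\<lambda>z. X z t) z V = 0 \<longrightarrow> V = 0))"

definition convex_mean_curvature_flow ::
    "real set \<Rightarrow> (real \<Rightarrow> 'a::euclidean_space set) \<Rightarrow> ('a \<Rightarrow> real \<Rightarrow> 'a) \<Rightarrow> bool" where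
  "convex_mean_curvature_flow I \<Omega> X \<longleftrightarrow>
     (\<forall>t\<in>I. convex_body (\<Omega> t)) \<and>
     smooth_parametrization I \<Omega> X \<and>
     (\<forall>t\<in>I. \<forall>z\<in>sphere 0 1.
        ((\<lambda>s. X z s) has_vector_derivative
           - mean_curvature (\<Omega> t) (X z t) *\<^sub>R outward_normal (\<Omega> t) (X z t)) (at t within I))"

definition contracts_to_point :: "(real \<Rightarrow> 'a::euclidean_space set) \<Rightarrow> real \<Rightarrow> 'a \<Rightarrow> bool" where
  "contracts_to_point \<Omega> T q \<longleftrightarrow>
     (\<forall>\<epsilon>>0. \<forall>\<^sub>F t in at_left T. frontier (\<Omega> t) \<subseteq> ball q \<epsilon>)"

definition arrival_time ::
    "real set \<Rightarrow> (real \<Rightarrow> 'a::euclidean_space set) \<Rightarrow> real \<Rightarrow> 'a \<Rightarrow> 'a \<Rightarrow> real" where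
  "arrival_time I \<Omega> T q p = (if p = q then T else (THE t. t \<in> I \<and> p \<in> frontier (\<Omega> t)))"

text \<open>\<open>\<partial>\<^sub>tH + 2 \<nabla>\<^sub>VH + A(V, V)\<close> at the point \<open>X z t\<close>; the time derivative is taken along \<open>X z\<close>.\<close>

definition harnack_quantity ::
    "(real \<Rightarrow> 'a::euclidean_space set) \<Rightarrow> ('a \<Rightarrow> real \<Rightarrow> 'a) \<Rightarrow> 'a \<Rightarrow> real \<Rightarrow> 'a \<Rightarrow> real" where
  "harnack_quantity \<Omega> X z t V =
     deriv (\<lambda>s. mean_curvature (\<Omega> s) (X z s)) t
     + 2 * deriv_along (frontier (\<Omega> t)) (mean_curvature (\<Omega> t)) (X z t) V
     + second_fundamental_form (\<Omega> t) (X z t) V V"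

end

theory Submission
  imports Defs
begin

text \<open>
  Write \<open>\<tau> = sqrt (2 (t - t0))\<close>. Concavity of the square root of the arrival time means
  \<open>r \<Omega>(\<tau>1) + (1 - r) \<Omega>(\<tau>2) \<subseteq> \<Omega>(r \<tau>1 + (1 - r) \<tau>2)\<close>. If this fails, take the parameters for which the violation,
  measured in \<open>\<tau>\<close>, is largest. There the three boundaries touch at points with a common normal, the three
  speeds \<open>\<tau>i Hi\<close> agree, and comparing second fundamental forms along velocities proportional to \<open>\<tau>i\<close> gives
  \<open>\<tau>0 \<ge> r \<tau>1 + (1 - r) \<tau>2\<close>, a contradiction. (A small dilation of \<open>\<Omega>(\<tau>0)\<close> allows for vanishing speeds.)
  Midpoints of \<open>X\<close> along curves through \<open>(z, \<tau>)\<close> then yield the Harnack inequality to second order, and its integrated form gives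
  \<open>H > 0\<close> for \<open>t > t0\<close>, so that the boundaries at different times are disjoint and the arrival
  time is well defined. Ancient solutions are treated by letting \<open>t0 \<rightarrow> -\<infinity>\<close>.
\<close>

subsection \<open>Derivatives along curves\<close>

text \<open>Since dt = \<tau> d\<tau>, speeds with respect to \<tau> are \<tau> H. With velocities
  proportional to \<tau>i the second-order terms \<tau>i^2 Hi become \<tau>i times such a speed. For
  a common speed D and q = r \<tau>1 + (1 - r) \<tau>2 the curvature comparison reads q^2 D /
  \<tau>0 \<le> q D, that is, q \<le> \<tau>0 if D > 0. This is why the square root is the right
  parameter; the dilation restores the strictness that is lost when D = 0. A second obstacle is
  regularity: \<open>outward_normal\<close> is a description and \<open>mean_curvature\<close> a
  trace over chosen bases, so neither is visibly regular in space and time. Convexity makes the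
  normal the unique unit support direction, so its graph is closed and it is continuous; being
  perpendicular to a differentiable spanning frame, it is differentiable. The flow equation then
  reads H = - n . (time derivative of X), so H inherits this regularity. Everything is computed for
  an extension of X to a neighbourhood, whose derivatives are two-sided even at t0.\<close>

lemma deriv_along_eq:
  assumes "(f has_derivative D) (at x within M)" and "V \<in> tangent_space M x"
  shows "deriv_along M f x V = D V"
proof -
  obtain \<gamma> :: "real \<Rightarrow> 'a" where \<gamma>: "\<gamma> 0 = x" "\<And>s. \<gamma> s \<in> M" "(\<gamma> has_vector_derivative V) (at 0)"
    using assms(2) by (auto simp: tangent_space_def)
  \<comment> \<open>\<open>frechet_derivative\<close> within \<open>M\<close> is one chosen
    derivative among possibly many; the curve \<gamma> shows that all of them agree at
    \<open>V\<close>.\<close>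
  have *: "((f \<circ> \<gamma>) has_vector_derivative D' V) (at 0)"
    if "(f has_derivative D') (at x within M)" for D'
  proof -
    have "(f has_derivative D') (at (\<gamma> 0) within range \<gamma>)"
      using that \<gamma> by (auto intro: has_derivative_subset)
    with \<gamma>(3) have "((f \<circ> \<gamma>) has_derivative D' \<circ> (\<lambda>s. s *\<^sub>R V)) (at 0)"
      unfolding has_vector_derivative_def by (rule diff_chain_within)
    moreover have "D' \<circ> (\<lambda>s. s *\<^sub>R V) = (\<lambda>s. s *\<^sub>R D' V)"
      using has_derivative_linear[OF that] by (auto simp: linear_cmul)
    ultimately show ?thesis by (simp add: has_vector_derivative_def)
  qed
  have "(f has_derivative frechet_derivative f (at x within M)) (at x within M)"
    using assms(1) by (meson differentiableI frechet_derivative_works)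
  from *[OF this] *[OF assms(1)] show ?thesis
    unfolding deriv_along_def by (rule vector_derivative_unique_at)
qed

text \<open>An inverse function rule for sets without interior: \<open>S\<close> will be the sphere
  and \<open>T\<close> the boundary of a body. Applying the left inverse \<open>g'\<close> to the
  linearisation of \<open>f\<close> bounds the error by a small multiple of
  \<open>norm (g z - g y)\<close>, which in turn is at most a constant times
  \<open>norm (z - y)\<close>.\<close>

lemma has_derivative_inverse_within:
  fixes f :: "'a::real_normed_vector \<Rightarrow> 'b::real_normed_vector"
  assumes f: "(f has_derivative f') (at (g y) within S)"
    and g': "bounded_linear g'" and inv: "g' \<circ> f' = id"
    and contg: "continuous (at y within T) g" and gT: "g ` T \<subseteq> S" and "y \<in> T"
    and fg: "\<And>z. z \<in> T \<Longrightarrow> f (g z) = z"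
  shows "(g has_derivative g') (at y within T)"
proof -
  interpret g': bounded_linear g' by (fact g')
  obtain C where C: "0 < C" "\<And>x. norm (g' x) \<le> norm x * C"
    using g'.pos_bounded by blast
  have lem: "\<exists>d>0. \<forall>z\<in>T. norm (z - y) < d \<longrightarrow> norm (g z - g y - g' (z - y)) \<le> e * norm (g z - g y)"
    if "e > 0" for e
  proof -
    obtain d0 where d0: "d0 > 0" "\<And>u. u \<in> S \<Longrightarrow> norm (u - g y) < d0 \<Longrightarrow>
        norm (f u - f (g y) - f' (u - g y)) \<le> e / C * norm (u - g y)"
      using f \<open>e > 0\<close> C(1) unfolding has_derivative_within_alt by (meson divide_pos_pos)
    obtain d where d: "d > 0" "\<And>z. z \<in> T \<Longrightarrow> dist z y < d \<Longrightarrow> dist (g z) (g y) < d0"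
      using contg d0(1) unfolding continuous_within_eps_delta by blast
    have "norm (g z - g y - g' (z - y)) \<le> e * norm (g z - g y)"
      if "z \<in> T" "norm (z - y) < d" for z
    proof -
      have "g' (f' (g z - g y)) = g z - g y" using inv by (metis comp_apply id_apply)
      then have "g z - g y - g' (z - y) = - g' (f (g z) - f (g y) - f' (g z - g y))"
        using fg that \<open>y \<in> T\<close> by (simp add: g'.diff)
      moreover have "norm (f (g z) - f (g y) - f' (g z - g y)) \<le> e / C * norm (g z - g y)"
        using d0(2)[of "g z"] d(2)[of z] that gT by (auto simp: dist_norm)
      then have "norm (f (g z) - f (g y) - f' (g z - g y)) * C \<le> e * norm (g z - g y)"
        using C(1) by (simp add: field_simps)
      ultimately show ?thesis
        using C(2)[of "f (g z) - f (g y) - f' (g z - g y)"] by simp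
    qed
    with d(1) show ?thesis by blast
  qed
  \<comment> \<open>An error factor 1/2 can be absorbed on the left, which makes \<open>g\<close>
    Lipschitz at \<open>y\<close>.\<close>
  obtain d1 where d1: "d1 > 0" "\<And>z. z \<in> T \<Longrightarrow> norm (z - y) < d1 \<Longrightarrow>
      norm (g z - g y - g' (z - y)) \<le> 1 / 2 * norm (g z - g y)"
    using lem[of "1/2"] by auto
  have lip: "norm (g z - g y) \<le> 2 * C * norm (z - y)" if "z \<in> T" "norm (z - y) < d1" for z
  proof -
    have "norm (g z - g y) \<le> norm (g z - g y - g' (z - y)) + norm (g' (z - y))"
      by (metis add.commute norm_triangle_sub)
    then show ?thesis using d1(2)[OF that] C(2)[of "z - y"] by (simp add: mult_ac)
  qed
  show ?thesis
    unfolding has_derivative_within_alt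
  proof (intro conjI allI impI)
    fix e :: real assume "e > 0"
    obtain d where d: "d > 0" "\<And>z. z \<in> T \<Longrightarrow> norm (z - y) < d \<Longrightarrow>
        norm (g z - g y - g' (z - y)) \<le> e / (2 * C) * norm (g z - g y)"
      using lem[of "e / (2 * C)"] \<open>e > 0\<close> C(1) by auto
    have "norm (g z - g y - g' (z - y)) \<le> e * norm (z - y)"
      if "z \<in> T" "norm (z - y) < min d d1" for z
    proof -
      have "e / (2 * C) * norm (g z - g y) \<le> e / (2 * C) * (2 * C * norm (z - y))"
        using lip[of z] that \<open>e > 0\<close> C(1) by (intro mult_left_mono) auto
      also have "\<dots> = e * norm (z - y)" using C(1) by simp
      finally show ?thesis using d(2)[of z] that by simp
    qed
    then show "\<exists>d>0. \<forall>z\<in>T. norm (z - y) < d \<longrightarrow> norm (g z - g y - g' (z - y)) \<le> e * norm (z - y)"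
      using d(1) d1(1) by (intro exI[of _ "min d d1"]) auto
  qed (fact g')
qed

text \<open>A factor that vanishes at \<open>a\<close> lets the product rule do with mere continuity
  of the other one. This differentiates products with the normal before the normal is known to be
  differentiable.\<close>

lemma has_derivative_inner_vanishing:
  fixes f g :: "'p::real_normed_vector \<Rightarrow> 'a::real_inner"
  assumes f: "continuous (at a within S) f" and g: "(g has_derivative g') (at a within S)"
    and "g a = 0"
  shows "((\<lambda>p. f p \<bullet> g p) has_derivative (\<lambda>h. f a \<bullet> g' h)) (at a within S)"
proof -
  have lin: "bounded_linear g'" using g by (rule has_derivative_bounded_linear)
  obtain K :: real where K: "\<And>x. norm (g' x) \<le> norm x * K" "K > 0"
    using bounded_linear.pos_bounded[OF lin] by blast
  have ft: "(f \<longlongrightarrow> f a) (at a within S)" using f by (simp add: continuous_within)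
  have "((\<lambda>p. (g p - g a - g' (p - a)) /\<^sub>R norm (p - a)) \<longlongrightarrow> 0) (at a within S)"
    using g unfolding has_derivative_within by (simp add: divide_inverse diff_diff_eq)
  from tendsto_inner[OF ft this]
  have 1: "((\<lambda>p. f p \<bullet> ((g p - g' (p - a)) /\<^sub>R norm (p - a))) \<longlongrightarrow> 0) (at a within S)"
    using \<open>g a = 0\<close> by simp
  have "((\<lambda>p. norm (f p - f a) * K) \<longlongrightarrow> 0) (at a within S)"
    using tendsto_mult_right[OF tendsto_norm[OF tendsto_diff[OF ft tendsto_const[of "f a"]]], of K] by simp
  then have 2: "((\<lambda>p. ((f p - f a) \<bullet> g' (p - a)) / norm (p - a)) \<longlongrightarrow> 0) (at a within S)"
  proof (rule Lim_null_comparison[rotated])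
    have "\<bar>(f p - f a) \<bullet> g' (p - a)\<bar> \<le> norm (f p - f a) * (norm (p - a) * K)" for p
      by (rule order_trans[OF Cauchy_Schwarz_ineq2]) (intro mult_left_mono K norm_ge_zero)
    then have "\<bar>(f p - f a) \<bullet> g' (p - a)\<bar> / norm (p - a) \<le> norm (f p - f a) * K" for p
      using K(2) by (cases "p = a") (auto simp: field_simps)
    then show "\<forall>\<^sub>F p in at a within S. norm ((f p - f a) \<bullet> g' (p - a) / norm (p - a)) \<le> norm (f p - f a) * K"
      by simp
  qed
  have "((\<lambda>p. (f p \<bullet> g p - f a \<bullet> g' (p - a)) / norm (p - a)) \<longlongrightarrow> 0) (at a within S)"
    using tendsto_add[OF 1 2] by (simp add: inner_diff divide_inverse ring_distribs mult.commute)
  moreover have "bounded_linear (\<lambda>h. f a \<bullet> g' h)"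
    using lin by (rule bounded_linear_compose[OF bounded_linear_inner_right])
  ultimately show ?thesis
    using \<open>g a = 0\<close> unfolding has_derivative_within by (simp add: divide_inverse diff_diff_eq mult.commute)
qed

text \<open>For \<open>w\<close> perpendicular to \<open>n a\<close>, write \<open>w\<close> as a
  combination of the \<open>q b a\<close>; then \<open>n p \<bullet> w\<close> is the same
  combination of the \<open>n p \<bullet> (q b a - q b p)\<close>, to which the previous rule
  applies. The component along \<open>n a\<close> has derivative 0 by normalisation. The
  \<open>q b\<close> only have to span, so a redundant frame is allowed.\<close>

lemma unit_normal_differentiable:
  fixes n :: "'p::real_normed_vector \<Rightarrow> 'a::euclidean_space" and q :: "'b \<Rightarrow> 'p \<Rightarrow> 'a"
  assumes cont: "continuous (at a within S) n" and "a \<in> S"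
    and unit: "\<And>p. p \<in> S \<Longrightarrow> norm (n p) = 1" and "finite I"
    and q: "\<And>b. b \<in> I \<Longrightarrow> q b differentiable (at a within S)"
    and perp: "\<And>p b. p \<in> S \<Longrightarrow> b \<in> I \<Longrightarrow> n p \<bullet> q b p = 0"
    and span: "\<And>w. n a \<bullet> w = 0 \<Longrightarrow> \<exists>c. w = (\<Sum>b\<in>I. c b *\<^sub>R q b a)"
  obtains n' where "(n has_derivative n') (at a within S)" and "\<And>h. n a \<bullet> n' h = 0"
proof -
  have tang: "(\<lambda>p. n p \<bullet> w) differentiable (at a within S)" if w: "n a \<bullet> w = 0" for w
  proof -
    obtain c where c: "w = (\<Sum>b\<in>I. c b *\<^sub>R q b a)" using span[OF w] by blast
    have "(\<lambda>p. n p \<bullet> (q b a - q b p)) differentiable (at a within S)" if "b \<in> I" for b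
    proof -
      obtain D where D: "(q b has_derivative D) (at a within S)"
        using q[OF \<open>b \<in> I\<close>] unfolding differentiable_def by blast
      have "((\<lambda>p. q b a - q b p) has_derivative (\<lambda>h. 0 - D h)) (at a within S)"
        by (intro has_derivative_diff has_derivative_const D)
      from has_derivative_inner_vanishing[OF cont this] show ?thesis
        by (auto simp: differentiable_def)
    qed
    then have "(\<lambda>p. \<Sum>b\<in>I. c b * (n p \<bullet> (q b a - q b p))) differentiable (at a within S)"
      using \<open>finite I\<close> by (intro differentiable_sum ballI differentiable_mult differentiable_const) auto
    moreover have "(\<Sum>b\<in>I. c b * (n p \<bullet> (q b a - q b p))) = n p \<bullet> w" if "p \<in> S" for p
      using perp[OF that] by (simp add: c inner_sum_right inner_diff_right)
    ultimately show ?thesis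
      using \<open>a \<in> S\<close> unfolding differentiable_def by (metis (no_types, lifting) has_derivative_transform)
  qed
  define r where "r p = n p \<bullet> n a" for p
  define u where "u p = n p - r p *\<^sub>R n a" for p
  have nn: "n a \<bullet> n a = 1" using unit[OF \<open>a \<in> S\<close>] by (simp add: norm_eq_1)
  have ua: "u a = 0" "r a = 1" by (simp_all add: u_def r_def nn)
  have u_diff: "u differentiable (at a within S)"
  proof -
    have "(\<lambda>p. u p \<bullet> b) differentiable (at a within S)" for b
    proof -
      have "u p \<bullet> b = n p \<bullet> (b - (n a \<bullet> b) *\<^sub>R n a)" for p
        by (simp add: u_def r_def inner_diff_left inner_diff_right mult.commute)
      moreover have "n a \<bullet> (b - (n a \<bullet> b) *\<^sub>R n a) = 0" by (simp add: inner_diff_right nn)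
      ultimately show ?thesis using tang[of "b - (n a \<bullet> b) *\<^sub>R n a"] by simp
    qed
    then show ?thesis using differentiable_componentwise_within by blast
  qed
  then obtain u0 where u0: "(u has_derivative u0) (at a within S)" by (auto simp: differentiable_def)
  \<comment> \<open>A derivative within \<open>S\<close> may fail to be unique, so \<open>u0\<close>
    may leave the hyperplane; the projection \<open>u'\<close> is again a derivative of
    \<open>u\<close> and has values perpendicular to \<open>n a\<close>.\<close>
  define u' where "u' h = u0 h - (n a \<bullet> u0 h) *\<^sub>R n a" for h
  have "((\<lambda>p. u p - (n a \<bullet> u p) *\<^sub>R n a) has_derivative u') (at a within S)"
    unfolding u'_def[abs_def]
    by (intro has_derivative_diff has_derivative_scaleR_left has_derivative_inner_right u0)
  moreover have "n a \<bullet> u p = 0" for p by (simp add: u_def r_def inner_diff nn inner_commute)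
  ultimately have u': "(u has_derivative u') (at a within S)" by simp
  have r_cont: "continuous (at a within S) r"
    unfolding r_def by (intro continuous_intros cont)
  have u_cont: "continuous (at a within S) u"
    unfolding u_def by (intro continuous_intros cont r_cont)
  have pos: "\<forall>\<^sub>F p in at a within S. r p > 0"
    using r_cont ua by (auto simp: continuous_within intro: order_tendstoD)
  \<comment> \<open>Normalisation gives \<open>u p \<bullet> u p = (1 - r p) * (1 + r p)\<close>, so
    \<open>r p - 1\<close> is a product of two factors that both vanish at \<open>a\<close>.\<close>
  have "continuous (at a within S) (\<lambda>p. - (1 / (1 + r p)) *\<^sub>R u p)"
    by (intro continuous_intros u_cont r_cont) (simp add: ua)
  from has_derivative_inner_vanishing[OF this u' ua(1)]
  have "((\<lambda>p. (- (1 / (1 + r p)) *\<^sub>R u p) \<bullet> u p) has_derivative (\<lambda>h. 0)) (at a within S)"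
    by (simp add: ua)
  then have "((\<lambda>p. r p - 1) has_derivative (\<lambda>h. 0)) (at a within S)"
  proof (rule has_derivative_transform_eventually)
    show "\<forall>\<^sub>F p in at a within S. (- (1 / (1 + r p)) *\<^sub>R u p) \<bullet> u p = r p - 1"
    proof -
      have "\<forall>\<^sub>F p in at a within S. p \<in> S" by (simp add: eventually_at_filter)
      with pos show ?thesis
      proof eventually_elim
        case (elim p)
        have "n p \<bullet> n p = 1" using unit[OF elim(2)] by (simp add: norm_eq_1)
        moreover have "u p \<bullet> u p = n p \<bullet> n p - 2 * (r p * r p) + r p * r p * (n a \<bullet> n a)"
          by (simp add: u_def inner_diff_left inner_diff_right inner_commute[of "n a" "n p"] algebra_simps
              flip: r_def)
        ultimately have "u p \<bullet> u p = (1 - r p) * (1 + r p)" by (simp add: nn algebra_simps)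
        then show ?case using elim(1) by simp
      qed
    qed
  qed (auto simp: ua \<open>a \<in> S\<close>)
  then have "(r has_derivative (\<lambda>h. 0)) (at a within S)"
    using has_derivative_add[OF _ has_derivative_const[of 1]] by fastforce
  then have "((\<lambda>p. u p + r p *\<^sub>R n a) has_derivative (\<lambda>h. u' h + 0 *\<^sub>R n a)) (at a within S)"
    by (intro has_derivative_add u' has_derivative_scaleR_left)
  then have n': "(n has_derivative u') (at a within S)" by (simp add: u_def)
  moreover have "n a \<bullet> u' h = 0" for h by (simp add: u'_def inner_diff nn)
  ultimately show ?thesis by (rule that)
qed

section \<open>Second-order expansions at a contact point\<close>

lemma second_order_expansion:
  fixes E :: "real \<Rightarrow> 'a::real_normed_vector"
  assumes E: "\<And>s. (E has_vector_derivative E' s) (at s)" and 0: "E 0 = 0" "E' 0 = 0"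
    and E2: "(E' has_vector_derivative e) (at 0)"
  shows "((\<lambda>s. E s /\<^sub>R s\<^sup>2) \<longlongrightarrow> e /\<^sub>R 2) (at 0)"
proof (rule LIM_I)
  fix r :: real assume "r > 0"
  then obtain d where d: "d > 0" "\<And>s. \<bar>s\<bar> < d \<Longrightarrow> norm (E' s - s *\<^sub>R e) \<le> r / 2 * \<bar>s\<bar>"
    using E2 0 unfolding has_vector_derivative_def has_derivative_at_alt
    by (metis diff_zero half_gt_zero real_norm_def)
  have "norm (E s /\<^sub>R s\<^sup>2 - e /\<^sub>R 2) < r" if s: "s \<noteq> 0" "norm s < d" for s
  proof -
    \<comment> \<open>Removing the quadratic term leaves a derivative of size o(s), which the mean
      value bound on the segment turns into o(s^2); \<open>E'\<close> is differentiated at 0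
      only.\<close>
    define F where "F s = E s - (s\<^sup>2 / 2) *\<^sub>R e" for s
    have F: "(F has_vector_derivative (E' s - s *\<^sub>R e)) (at s within A)" for s A
      unfolding F_def
      by (rule has_vector_derivative_at_within) (auto intro!: derivative_eq_intros E)
    have "norm (F s - F 0 - (s - 0) *\<^sub>R (E' 0 - 0 *\<^sub>R e)) \<le> norm (s - 0) * (r / 2 * \<bar>s\<bar>)"
    proof (rule vector_differentiable_bound_linearization[where S = "closed_segment 0 s"])
      fix x assume "x \<in> closed_segment 0 s"
      then have x: "\<bar>x\<bar> \<le> \<bar>s\<bar>" by (auto simp: closed_segment_eq_real_ivl split: if_splits)
      have "norm (E' x - x *\<^sub>R e) \<le> r / 2 * \<bar>s\<bar>"
        using d(2)[of x] x s(2) \<open>r > 0\<close> by (auto intro: order_trans mult_left_mono)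
      then show "norm (E' x - x *\<^sub>R e - (E' 0 - 0 *\<^sub>R e)) \<le> r / 2 * \<bar>s\<bar>" by (simp add: 0)
    qed (auto simp: F)
    moreover have "norm (s - 0) * (r / 2 * \<bar>s\<bar>) = r / 2 * s\<^sup>2"
      by (simp add: power2_eq_square)
    moreover have "F s - F 0 - (s - 0) *\<^sub>R (E' 0 - 0 *\<^sub>R e) = F s" by (simp add: F_def 0)
    ultimately have "norm (F s) \<le> r / 2 * s\<^sup>2" by metis
    then have "norm (F s) / s\<^sup>2 \<le> r / 2" using s(1) by (simp add: field_simps)
    moreover have eq: "E s /\<^sub>R s\<^sup>2 - e /\<^sub>R 2 = F s /\<^sub>R s\<^sup>2"
      using s(1) by (simp add: F_def scaleR_diff_right)
    moreover have "norm (F s /\<^sub>R s\<^sup>2) = norm (F s) / s\<^sup>2" by (simp add: divide_inverse mult.commute)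
    ultimately show ?thesis using \<open>r > 0\<close> unfolding eq by linarith
  qed
  with d(1) show "\<exists>d>0. \<forall>s. s \<noteq> 0 \<and> norm (s - 0) < d \<longrightarrow> norm (E s /\<^sub>R s\<^sup>2 - e /\<^sub>R 2) < r"
    by auto
qed

text \<open>The direction \<open>N s\<close> may turn with \<open>s\<close>: since
  \<open>E s\<close> is of second order, only the limit of \<open>N\<close> enters the
  coefficient.\<close>

lemma second_order_nonneg:
  fixes E :: "real \<Rightarrow> 'a::real_inner"
  assumes "\<And>s. (E has_vector_derivative E' s) (at s)" and "E 0 = 0" "E' 0 = 0"
    and "(E' has_vector_derivative e) (at 0)"
    and N: "(N \<longlongrightarrow> \<nu>) (at 0)" and pos: "\<And>s. 0 \<le> N s \<bullet> E s"
  shows "0 \<le> \<nu> \<bullet> e"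
proof -
  have "((\<lambda>s. N s \<bullet> (E s /\<^sub>R s\<^sup>2)) \<longlongrightarrow> \<nu> \<bullet> (e /\<^sub>R 2)) (at 0)"
    by (intro tendsto_inner N second_order_expansion[OF assms(1-4)])
  then have "0 \<le> \<nu> \<bullet> (e /\<^sub>R 2)"
    by (rule tendsto_lowerbound) (use pos in \<open>auto intro: mult_nonneg_nonneg\<close>)
  then show ?thesis by simp
qed

text \<open>Splits \<open>j s s\<close> into \<open>j s 0\<close> and an increment in the second
  argument. The linearisation at the origin of the partial derivative \<eta> in that argument gives
  the mixed and the pure second-order term of the increment; \<open>j s 0\<close> is expanded
  separately.\<close>

lemma diagonal_expansion:
  fixes j :: "real \<Rightarrow> real \<Rightarrow> real"
  assumes "d > 0"
    and j: "\<And>s \<theta>. \<bar>s\<bar> < d \<Longrightarrow> \<bar>\<theta>\<bar> < d \<Longrightarrow> (j s has_vector_derivative \<eta> (s, \<theta>)) (at \<theta>)"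
    and \<eta>: "(\<eta> has_derivative \<eta>') (at (0, 0))"
  shows "((\<lambda>s. (j s s - j s 0 - s * \<eta> (0, 0)) / s\<^sup>2) \<longlongrightarrow> \<eta>' (1, 0) + \<eta>' (0, 1) / 2) (at 0)"
proof (rule LIM_I)
  fix r :: real assume "r > 0"
  define a b where "a = \<eta>' (1, 0)" and "b = \<eta>' (0, 1)"
  have lin: "linear \<eta>'" using \<eta> by (rule has_derivative_linear)
  have \<eta>'_eq: "\<eta>' (s, \<theta>) = s * a + \<theta> * b" for s \<theta>
  proof -
    have "\<eta>' (s *\<^sub>R (1, 0) + \<theta> *\<^sub>R (0, 1)) = s * a + \<theta> * b"
      unfolding linear_add[OF lin] linear_cmul[OF lin] by (simp add: a_def b_def)
    then show ?thesis by simp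
  qed
  obtain d' where d': "d' > 0" "\<And>p. norm p < d' \<Longrightarrow> norm (\<eta> p - \<eta> (0, 0) - \<eta>' p) \<le> r / 4 * norm p"
  proof -
    have "r / 4 > 0" using \<open>r > 0\<close> by simp
    with \<eta> obtain d' where "d' > 0" "\<And>p. norm (p - (0, 0)) < d' \<Longrightarrow>
        norm (\<eta> p - \<eta> (0, 0) - \<eta>' (p - (0, 0))) \<le> r / 4 * norm (p - (0, 0))"
      unfolding has_derivative_at_alt by meson
    then show thesis by (intro that[of d']) (auto simp flip: zero_prod_def)
  qed
  have "\<bar>(j s s - j s 0 - s * \<eta> (0, 0)) / s\<^sup>2 - (a + b / 2)\<bar> < r"
    if s: "s \<noteq> 0" "\<bar>s\<bar> < min d (d' / 2)" for s
  proof -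
    \<comment> \<open>\<open>G\<close> subtracts the integral in \<theta> of the linearisation of
      \<eta>, so its derivative is the linearisation error.\<close>
    define G where "G \<theta> = j s \<theta> - \<theta> * \<eta> (0, 0) - s * \<theta> * a - \<theta>\<^sup>2 / 2 * b" for \<theta>
    have cs: "x \<in> closed_segment 0 s \<Longrightarrow> \<bar>x\<bar> \<le> \<bar>s\<bar>" for x
      by (auto simp: closed_segment_eq_real_ivl split: if_splits)
    have "(j s has_real_derivative \<eta> (s, x)) (at x)" if "x \<in> closed_segment 0 s" for x
      using j[of s x] cs[OF that] s by (simp add: has_real_derivative_iff_has_vector_derivative)
    then have G: "(G has_real_derivative (\<eta> (s, x) - \<eta> (0, 0) - \<eta>' (s, x))) (at x)"
      if "x \<in> closed_segment 0 s" for x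
      unfolding G_def using that by (auto intro!: derivative_eq_intros simp: \<eta>'_eq)
    have bd: "norm (\<eta> (s, x) - \<eta> (0, 0) - \<eta>' (s, x)) \<le> r / 2 * \<bar>s\<bar>" if "x \<in> closed_segment 0 s" for x
    proof -
      have n: "norm (s, x) \<le> 2 * \<bar>s\<bar>" using norm_Pair_le[of s x] cs[OF that] by simp
      then have "norm (\<eta> (s, x) - \<eta> (0, 0) - \<eta>' (s, x)) \<le> r / 4 * norm (s, x)"
        using s by (intro d'(2)) auto
      also have "\<dots> \<le> r / 4 * (2 * \<bar>s\<bar>)" using n \<open>r > 0\<close> by (intro mult_left_mono) auto
      finally show ?thesis by simp
    qed
    have "norm (G s - G 0) \<le> r / 2 * \<bar>s\<bar> * norm (s - 0)"
    proof (rule field_differentiable_bound[where S = "closed_segment 0 s"])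
      show "(G has_real_derivative (\<eta> (s, x) - \<eta> (0, 0) - \<eta>' (s, x))) (at x within closed_segment 0 s)"
        if "x \<in> closed_segment 0 s" for x
        using G[OF that] by (rule has_field_derivative_at_within)
    qed (use bd in auto)
    then have "\<bar>G s - G 0\<bar> \<le> r / 2 * s\<^sup>2" by (simp add: power2_eq_square mult.assoc)
    moreover have "(j s s - j s 0 - s * \<eta> (0, 0)) / s\<^sup>2 - (a + b / 2) = (G s - G 0) / s\<^sup>2"
      using s(1) by (simp add: G_def field_simps power2_eq_square)
    moreover have "\<bar>(G s - G 0) / s\<^sup>2\<bar> = \<bar>G s - G 0\<bar> / s\<^sup>2" by simp
    ultimately have "\<bar>(j s s - j s 0 - s * \<eta> (0, 0)) / s\<^sup>2 - (a + b / 2)\<bar> \<le> r / 2"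
      using s(1) by (simp only: pos_divide_le_eq zero_less_power2 if_True not_False_eq_True)
    then show ?thesis by (rule le_less_trans) (use \<open>r > 0\<close> in simp)
  qed
  then show "\<exists>d>0. \<forall>s. s \<noteq> 0 \<and> norm (s - 0) < d \<longrightarrow>
      norm ((j s s - j s 0 - s * \<eta> (0, 0)) / s\<^sup>2 - (\<eta>' (1, 0) + \<eta>' (0, 1) / 2)) < r"
    using \<open>d > 0\<close> d'(1) by (intro exI[of _ "min d (d' / 2)"]) (auto simp: a_def b_def)
qed

section \<open>Great circles: the exponential map of the unit sphere\<close>

definition great_circle :: "'a::euclidean_space \<Rightarrow> 'a \<Rightarrow> real \<Rightarrow> 'a" where
  "great_circle z v s = cos (s * norm v) *\<^sub>R z + sin (s * norm v) *\<^sub>R sgn v"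

definition great_circle_velocity :: "'a::euclidean_space \<Rightarrow> 'a \<Rightarrow> real \<Rightarrow> 'a" where
  "great_circle_velocity z v s = cos (s * norm v) *\<^sub>R v - (norm v * sin (s * norm v)) *\<^sub>R z"

lemma great_circle_0 [simp]: "great_circle z v 0 = z" "great_circle_velocity z v 0 = v"
  by (simp_all add: great_circle_def great_circle_velocity_def)

lemma norm_scaleR_sgn: "norm v *\<^sub>R sgn v = (v::'a::real_normed_vector)"
  by (cases "v = 0") (simp_all add: sgn_div_norm)

lemma has_vector_derivative_great_circle [derivative_intros]:
  "(great_circle z v has_vector_derivative great_circle_velocity z v s) (at s within A)"
proof -
  have "((\<lambda>s. cos (s * norm v) *\<^sub>R z + sin (s * norm v) *\<^sub>R sgn v) has_vector_derivative
      (- sin (s * norm v) * norm v) *\<^sub>R z + (cos (s * norm v) * norm v) *\<^sub>R sgn v) (at s within A)"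
    by (auto intro!: derivative_eq_intros)
  moreover have "(cos (s * norm v) * norm v) *\<^sub>R sgn v = cos (s * norm v) *\<^sub>R v"
    by (metis norm_scaleR_sgn scaleR_scaleR)
  ultimately show ?thesis
    unfolding great_circle_def[abs_def] great_circle_velocity_def by (simp add: mult.commute)
qed

lemma differentiable_great_circle_velocity:
  "great_circle_velocity z v differentiable (at s within A)"
  unfolding great_circle_velocity_def[abs_def] differentiable_def
  by (rule exI) (auto intro!: derivative_eq_intros)

lemma great_circle_in_sphere:
  assumes "z \<in> sphere 0 1" "z \<bullet> v = 0"
  shows "great_circle z v s \<in> sphere 0 1"
proof (cases "v = 0")
  case False
  have z: "z \<bullet> z = 1" using assms(1) by (simp add: norm_eq_1)
  have w: "sgn v \<bullet> sgn v = 1" using False by (metis norm_eq_1 norm_sgn)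
  have zw: "z \<bullet> sgn v = 0" "sgn v \<bullet> z = 0" using assms(2) by (simp_all add: sgn_div_norm inner_commute)
  have "great_circle z v s \<bullet> great_circle z v s = (cos (s * norm v))\<^sup>2 + (sin (s * norm v))\<^sup>2"
    by (simp add: great_circle_def inner_add_left inner_add_right z w zw power2_eq_square)
  then show ?thesis by (simp add: norm_eq_1)
qed (use assms in \<open>simp add: great_circle_def\<close>)

lemma great_circle_velocity_perp:
  assumes "z \<in> sphere 0 1" "z \<bullet> v = 0"
  shows "great_circle z v s \<bullet> great_circle_velocity z v s = 0"
proof -
  have z: "z \<bullet> z = 1" using assms(1) by (simp add: norm_eq_1)
  have w: "sgn v \<bullet> v = norm v"
    by (cases "v = 0") (simp_all add: sgn_div_norm power2_norm_eq_inner[symmetric] power2_eq_square field_simps)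
  have zw: "sgn v \<bullet> z = 0" "z \<bullet> v = 0" using assms(2) by (simp_all add: sgn_div_norm inner_commute)
  show ?thesis
    by (simp add: great_circle_def great_circle_velocity_def inner_add_left inner_diff_right z w zw)
qed

text \<open>The angle between \<open>z\<close> and \<open>z'\<close> and the unit vector
  \<open>e\<close> perpendicular to \<open>z\<close> in their plane give \<open>v\<close>. If
  \<open>z' = z\<close> or \<open>z' = - z\<close>, any unit vector perpendicular to
  \<open>z\<close> serves as \<open>e\<close>; here the dimension enters.\<close>

lemma great_circle_reaches:
  fixes z z' :: "'a::euclidean_space"
  assumes "2 \<le> DIM('a)" "z \<in> sphere 0 1" "z' \<in> sphere 0 1"
  obtains v where "z \<bullet> v = 0" "great_circle z v 1 = z'"
proof -
  define p where "p = z' - (z \<bullet> z') *\<^sub>R z"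
  have z: "z \<bullet> z = 1" "z' \<bullet> z' = 1" using assms by (simp_all add: norm_eq_1)
  have zp: "z \<bullet> p = 0" by (simp add: p_def inner_diff z)
  have "\<exists>e. norm e = 1 \<and> z \<bullet> e = 0 \<and> p = norm p *\<^sub>R e"
  proof (cases "p = 0")
    case True
    obtain e where "e \<noteq> 0" "orthogonal z e" using assms(1) orthogonal_to_vector_exists by blast
    then show ?thesis using True
      by (intro exI[of _ "sgn e"]) (auto simp: norm_sgn orthogonal_def sgn_div_norm)
  next
    case False
    then show ?thesis using zp
      by (intro exI[of _ "sgn p"]) (auto simp: norm_sgn norm_scaleR_sgn sgn_div_norm)
  qed
  then obtain e where e: "norm e = 1" "z \<bullet> e = 0" "p = norm p *\<^sub>R e" by blast
  have "(norm p)\<^sup>2 = 1 - (z \<bullet> z')\<^sup>2"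
    unfolding p_def power2_norm_eq_inner
    by (simp add: inner_diff z inner_commute power2_eq_square)
  then have "(z \<bullet> z')\<^sup>2 + (norm p)\<^sup>2 = 1" by simp
  then obtain \<theta> where "0 \<le> \<theta>" "z \<bullet> z' = cos \<theta>" "norm p = sin \<theta>"
    using sincos_total_2pi by metis
  then have "great_circle z (\<theta> *\<^sub>R e) 1 = (z \<bullet> z') *\<^sub>R z + norm p *\<^sub>R e"
    using e(1) by (cases "\<theta> = 0") (auto simp: great_circle_def sgn_div_norm)
  also have "\<dots> = z'" using e(3) by (simp add: p_def)
  finally show thesis using e(2) by (intro that[of "\<theta> *\<^sub>R e"]) auto
qed

lemma tangent_space_sphere:
  assumes "z \<in> sphere 0 1" "z \<bullet> v = 0"
  shows "v \<in> tangent_space (sphere 0 1) z"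
  using great_circle_in_sphere[OF assms] has_vector_derivative_great_circle[of z v 0]
  by (auto simp: tangent_space_def intro!: exI[of _ "great_circle z v"])

lemma has_vector_derivative_right_quotient:
  assumes "(f has_vector_derivative D) (at 0)"
  shows "((\<lambda>h. (f h - f 0) /\<^sub>R h) \<longlongrightarrow> D) (at_right 0)"
proof -
  have "(f has_derivative (\<lambda>h. h *\<^sub>R D)) (at 0 within {0<..})"
    using has_vector_derivative_at_within[OF assms] by (simp add: has_vector_derivative_def)
  then have "((\<lambda>h. (1 / norm (h - 0)) *\<^sub>R (f h - (f 0 + (h - 0) *\<^sub>R D))) \<longlongrightarrow> 0) (at_right 0)"
    unfolding has_derivative_within by blast
  then have "((\<lambda>h. (f h - f 0) /\<^sub>R h - D) \<longlongrightarrow> 0) (at_right 0)"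
  proof (rule Lim_transform_eventually)
    show "\<forall>\<^sub>F h in at_right 0. (1 / norm (h - 0)) *\<^sub>R (f h - (f 0 + (h - 0) *\<^sub>R D)) = (f h - f 0) /\<^sub>R h - D"
      using eventually_at_right_less[of "0::real"]
      by eventually_elim (simp add: scaleR_diff_right scaleR_add_right divide_inverse)
  qed
  then show ?thesis by (simp add: LIM_zero_iff)
qed

lemma differentiable_transform:
  assumes "f differentiable (at x within S)" "x \<in> S" "\<And>y. y \<in> S \<Longrightarrow> f y = h y"
  shows "h differentiable (at x within S)"
  using assms unfolding differentiable_def by (blast intro: has_derivative_transform[rotated 2] sym)

lemma differentiable_Pair1: "(\<lambda>z. (z, t)) differentiable (at z)"
  unfolding differentiable_def
  by (rule exI[of _ "\<lambda>h. (h, 0)"]) (auto intro!: derivative_eq_intros)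

subsection \<open>Smooth convex bodies\<close>

lemma perp_of_perp:
  fixes \<nu> N :: "'a::euclidean_space"
  assumes "norm \<nu> = 1" "\<And>V. \<nu> \<bullet> V = 0 \<Longrightarrow> N \<bullet> V = 0"
  shows "N = (N \<bullet> \<nu>) *\<^sub>R \<nu>"
proof -
  define V where "V = N - (N \<bullet> \<nu>) *\<^sub>R \<nu>"
  have "\<nu> \<bullet> \<nu> = 1" using assms(1) by (simp add: norm_eq_1)
  then have 1: "\<nu> \<bullet> V = 0" by (simp add: V_def inner_diff_right inner_commute)
  then have "V \<bullet> V = 0" using assms(2)[OF 1] by (simp add: V_def inner_diff_left)
  then show ?thesis by (simp add: V_def)
qed

lemma inner_sgn: "v \<bullet> sgn v = norm (v::'a::real_inner)"
  by (cases "v = 0") (simp_all add: sgn_div_norm power2_norm_eq_inner[symmetric] power2_eq_square)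

text \<open>The choice made in \<open>mean_curvature\<close>, but indexed by the normal: boundary
  points of different bodies with equal normals get the same basis, so that their traces can be
  compared term by term.\<close>

definition tangent_basis :: "'a::euclidean_space \<Rightarrow> 'a set" where
  "tangent_basis \<nu> = (SOME B. orthonormal_basis_of {V. \<nu> \<bullet> V = 0} B)"

lemma tangent_basis:
  fixes \<nu> :: "'a::euclidean_space"
  shows "pairwise orthogonal (tangent_basis \<nu>)" and "\<And>e. e \<in> tangent_basis \<nu> \<Longrightarrow> norm e = 1"
    and "span (tangent_basis \<nu>) = {V. \<nu> \<bullet> V = 0}" and "finite (tangent_basis \<nu>)"
    and "card (tangent_basis \<nu>) \<le> DIM('a)" and "\<And>e. e \<in> tangent_basis \<nu> \<Longrightarrow> \<nu> \<bullet> e = 0"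
proof -
  have "\<exists>B. orthonormal_basis_of {V. \<nu> \<bullet> V = 0} B"
    unfolding orthonormal_basis_of_def
    by (rule orthonormal_basis_subspace[OF subspace_hyperplane, of \<nu>]) blast
  then have *: "orthonormal_basis_of {V. \<nu> \<bullet> V = 0} (tangent_basis \<nu>)"
    unfolding tangent_basis_def by (rule someI_ex)
  then show o: "pairwise orthogonal (tangent_basis \<nu>)" and n: "\<And>e. e \<in> tangent_basis \<nu> \<Longrightarrow> norm e = 1"
    and s: "span (tangent_basis \<nu>) = {V. \<nu> \<bullet> V = 0}"
    by (auto simp: orthonormal_basis_of_def)
  have "0 \<notin> tangent_basis \<nu>" using n by force
  from pairwise_orthogonal_independent[OF o this] have "independent (tangent_basis \<nu>)" .
  from independent_bound[OF this] show "finite (tangent_basis \<nu>)" "card (tangent_basis \<nu>) \<le> DIM('a)" by auto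
  show "\<nu> \<bullet> e = 0" if "e \<in> tangent_basis \<nu>" for e
    using span_base[OF that] s by auto
qed

lemma tangent_basis_nonempty:
  fixes \<nu> :: "'a::euclidean_space"
  assumes "2 \<le> DIM('a)"
  shows "tangent_basis \<nu> \<noteq> {}"
proof
  assume "tangent_basis \<nu> = {}"
  then have "{V. \<nu> \<bullet> V = 0} = {0}" using tangent_basis(3)[of \<nu>] by simp
  moreover obtain e where "e \<noteq> 0" "orthogonal \<nu> e" using assms orthogonal_to_vector_exists by blast
  ultimately show False by (auto simp: orthogonal_def)
qed

text \<open>A single time slice. \<open>F\<close> extends the parametrization beyond the sphere and
  \<open>F'\<close> is its ambient derivative; the radial values of \<open>F'\<close> carry no
  geometric information, so immersion concerns \<open>v\<close> perpendicular to \<open>z\<close>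
  only.\<close>

locale parametrized_body =
  fixes K :: "'a::euclidean_space set" and F :: "'a \<Rightarrow> 'a" and F' :: "'a \<Rightarrow> 'a \<Rightarrow> 'a"
  assumes dim: "2 \<le> DIM('a)"
    and body: "convex_body K"
    and bij: "bij_betw F (sphere 0 1) (frontier K)"
    and deriv: "\<And>z. z \<in> sphere 0 1 \<Longrightarrow> (F has_derivative F' z) (at z)"
    and deriv2: "\<And>z v. z \<in> sphere 0 1 \<Longrightarrow> (\<lambda>z. F' z v) differentiable (at z)"
    and immersion: "\<And>z v. z \<in> sphere 0 1 \<Longrightarrow> z \<bullet> v = 0 \<Longrightarrow> F' z v = 0 \<Longrightarrow> v = 0"
begin

lemma compact_K: "compact K" and convex_K: "convex K" and interior_K: "interior K \<noteq> {}"
  using body by (auto simp: convex_body_def)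

lemma F_frontier: "z \<in> sphere 0 1 \<Longrightarrow> F z \<in> frontier K"
  using bij by (auto simp: bij_betw_def)

lemma frontier_subset: "frontier K \<subseteq> K"
  using compact_K by (simp add: compact_imp_closed frontier_subset_closed)

lemma frontierE: assumes "x \<in> frontier K" obtains z where "z \<in> sphere 0 1" "x = F z"
  using assms bij_betw_imp_surj_on[OF bij] by blast

lemma linear_F': "z \<in> sphere 0 1 \<Longrightarrow> linear (F' z)"
  using deriv has_derivative_linear by blast

lemma F'_expand:
  assumes "z \<in> sphere 0 1"
  shows "F' z v = (\<Sum>b\<in>Basis. (v \<bullet> b) *\<^sub>R F' z b)"
proof -
  have "F' z v = F' z (\<Sum>b\<in>Basis. (v \<bullet> b) *\<^sub>R b)" by (simp add: euclidean_representation)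
  also have "\<dots> = (\<Sum>b\<in>Basis. (v \<bullet> b) *\<^sub>R F' z b)"
    by (simp add: linear_sum[OF linear_F'[OF assms]] linear_cmul[OF linear_F'[OF assms]])
  finally show ?thesis .
qed

definition curve :: "'a \<Rightarrow> 'a \<Rightarrow> real \<Rightarrow> 'a" where
  "curve z v s = F (great_circle z v s)"

definition curve_velocity :: "'a \<Rightarrow> 'a \<Rightarrow> real \<Rightarrow> 'a" where
  "curve_velocity z v s = F' (great_circle z v s) (great_circle_velocity z v s)"

lemma curve_0 [simp]: "curve z v 0 = F z" "curve_velocity z v 0 = F' z v"
  by (simp_all add: curve_def curve_velocity_def)

context
  fixes z v :: 'a assumes zv: "z \<in> sphere 0 1" "z \<bullet> v = 0"
begin

lemma curve_frontier: "curve z v s \<in> frontier K"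
  unfolding curve_def by (intro F_frontier great_circle_in_sphere zv)

lemma curve_derivative: "(curve z v has_vector_derivative curve_velocity z v s) (at s)"
proof -
  have "(F has_derivative F' (great_circle z v s)) (at (great_circle z v s))"
    by (intro deriv great_circle_in_sphere zv)
  from has_derivative_compose[OF has_vector_derivative_great_circle[unfolded has_vector_derivative_def] this]
  show ?thesis
    unfolding has_vector_derivative_def curve_def[abs_def] curve_velocity_def
    by (simp add: linear_cmul[OF linear_F'[OF great_circle_in_sphere[OF zv]]])
qed

lemma curve_velocity_differentiable: "curve_velocity z v differentiable (at s)"
proof -
  let ?c = "great_circle z v"
  have c: "?c differentiable (at s)"
    using has_vector_derivative_great_circle[of z v s] differentiableI_vector by blast
  have "(\<lambda>s. F' (?c s) b) differentiable (at s)" for b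
    using differentiable_chain_at[OF c deriv2[OF great_circle_in_sphere[OF zv]]]
    by (simp add: o_def)
  moreover have "(\<lambda>s. great_circle_velocity z v s \<bullet> b) differentiable (at s)" for b
    by (intro differentiable_inner differentiable_great_circle_velocity differentiable_const)
  ultimately have "(\<lambda>s. \<Sum>b\<in>Basis. (great_circle_velocity z v s \<bullet> b) *\<^sub>R F' (?c s) b) differentiable (at s)"
    by (intro differentiable_sum differentiable_scaleR) auto
  then show ?thesis
    unfolding curve_velocity_def[abs_def]
    by (subst F'_expand) (use great_circle_in_sphere[OF zv] in auto)
qed

lemma support_perp:
  assumes "\<forall>y\<in>K. \<nu> \<bullet> y \<le> \<nu> \<bullet> F z"
  shows "\<nu> \<bullet> F' z v = 0"
proof -
  have "((\<lambda>s. \<nu> \<bullet> curve z v s) has_real_derivative (\<nu> \<bullet> F' z v)) (at 0)"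
    using has_derivative_inner_right[OF curve_derivative[unfolded has_vector_derivative_def], of \<nu> 0]
    by (simp add: has_field_derivative_def mult_commute_abs)
  then show ?thesis
    by (rule DERIV_local_max[of _ _ _ 1]) (use assms curve_frontier frontier_subset in auto)
qed

end

section \<open>Support directions, tangent spaces and the outward normal\<close>

lemma support_exists:
  assumes "x \<in> frontier K"
  obtains \<nu> where "norm \<nu> = 1" "\<forall>y\<in>K. \<nu> \<bullet> y \<le> \<nu> \<bullet> x"
proof -
  have "x \<in> closure K" "x \<notin> rel_interior K"
    using assms interior_K by (auto simp: frontier_def rel_interior_nonempty_interior)
  then obtain a where a: "a \<noteq> 0" "\<And>y. y \<in> closure K \<Longrightarrow> a \<bullet> x \<le> a \<bullet> y"
    using supporting_hyperplane_relative_frontier[OF convex_K] by metis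
  show thesis
  proof (rule that[of "- sgn a"])
    have "(a \<bullet> x) / norm a \<le> (a \<bullet> y) / norm a" if "y \<in> K" for y
      using a(2)[of y] closure_subset that by (intro divide_right_mono) auto
    then show "\<forall>y\<in>K. - sgn a \<bullet> y \<le> - sgn a \<bullet> x"
      by (auto simp: sgn_div_norm divide_inverse mult.commute)
  qed (use a in \<open>simp add: norm_sgn\<close>)
qed

text \<open>A dimension count: \<open>F' z\<close> is injective on the tangent hyperplane of the
  sphere and maps it into the hyperplane of \<nu>, which has the same dimension.\<close>

lemma tangent_image:
  assumes z: "z \<in> sphere 0 1" and \<nu>: "norm \<nu> = 1" "\<forall>y\<in>K. \<nu> \<bullet> y \<le> \<nu> \<bullet> F z"
  shows "F' z ` {v. z \<bullet> v = 0} = {V. \<nu> \<bullet> V = 0}"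
proof (rule subspace_dim_equal)
  note lin = linear_F'[OF z]
  have sub: "subspace {v. z \<bullet> v = 0}" by (rule subspace_hyperplane)
  show "subspace (F' z ` {v. z \<bullet> v = 0})" by (rule linear_subspace_image[OF lin sub])
  show "subspace {V. \<nu> \<bullet> V = 0}" by (rule subspace_hyperplane)
  show "F' z ` {v. z \<bullet> v = 0} \<subseteq> {V. \<nu> \<bullet> V = 0}" using support_perp[OF z _ \<nu>(2)] by auto
  have "inj_on (F' z) (span {v. z \<bullet> v = 0})"
    unfolding span_eq_iff[THEN iffD2, OF sub]
  proof (rule inj_onI)
    fix v w assume vw: "v \<in> {v. z \<bullet> v = 0}" "w \<in> {v. z \<bullet> v = 0}" "F' z v = F' z w"
    then have "F' z (v - w) = 0" "z \<bullet> (v - w) = 0" by (simp_all add: linear_diff[OF lin] inner_diff_right)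
    then show "v = w" using immersion[OF z, of "v - w"] by simp
  qed
  then have "dim (F' z ` {v. z \<bullet> v = 0}) = dim {v. z \<bullet> v = 0}" by (rule dim_image_eq[OF lin])
  also have "\<dots> = dim {V. \<nu> \<bullet> V = 0}" using z \<nu>(1) by (subst (1 2) dim_hyperplane) auto
  finally show "dim {V. \<nu> \<bullet> V = 0} \<le> dim (F' z ` {v. z \<bullet> v = 0})" by simp
qed

text \<open>The tangent plane determines a support direction up to a scalar, and an interior ball
  fixes its sign. On this uniqueness of normals rest the continuity and the contact
  arguments.\<close>

lemma support_parallel:
  assumes z: "z \<in> sphere 0 1" and \<nu>: "norm \<nu> = 1" "\<forall>y\<in>K. \<nu> \<bullet> y \<le> \<nu> \<bullet> F z"
    and a: "\<forall>y\<in>K. a \<bullet> y \<le> a \<bullet> F z"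
  shows "a = (a \<bullet> \<nu>) *\<^sub>R \<nu>" and "a \<bullet> \<nu> \<ge> 0"
proof -
  have "a \<bullet> V = 0" if "\<nu> \<bullet> V = 0" for V
  proof -
    have "V \<in> F' z ` {v. z \<bullet> v = 0}" using that tangent_image[OF z \<nu>] by simp
    then show ?thesis using support_perp[OF z _ a] by auto
  qed
  then show eq: "a = (a \<bullet> \<nu>) *\<^sub>R \<nu>" by (rule perp_of_perp[OF \<nu>(1)])
  obtain y where y: "y \<in> interior K" using interior_K by blast
  then obtain e where e: "e > 0" "cball y e \<subseteq> K" using mem_interior_cball by blast
  have nn: "\<nu> \<bullet> \<nu> = 1" using \<nu>(1) by (simp add: norm_eq_1)
  have "y + e *\<^sub>R \<nu> \<in> K" using e \<nu>(1) by (auto simp: dist_norm)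
  then have "\<nu> \<bullet> (y + e *\<^sub>R \<nu>) \<le> \<nu> \<bullet> F z" using \<nu>(2) by blast
  then have 1: "\<nu> \<bullet> (F z - y) > 0" using e(1) nn by (simp add: inner_add_right inner_diff_right)
  have "y \<in> K" using y interior_subset by blast
  then have "0 \<le> a \<bullet> (F z - y)" using a by (simp add: inner_diff_right)
  then have "0 \<le> (a \<bullet> \<nu>) * (\<nu> \<bullet> (F z - y))" by (subst (asm) eq) simp
  then show "a \<bullet> \<nu> \<ge> 0" using 1 by (simp add: zero_le_mult_iff)
qed

lemma tangent_space_eq:
  assumes z: "z \<in> sphere 0 1" and \<nu>: "norm \<nu> = 1" "\<forall>y\<in>K. \<nu> \<bullet> y \<le> \<nu> \<bullet> F z"
  shows "tangent_space (frontier K) (F z) = {V. \<nu> \<bullet> V = 0}"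
proof safe
  fix V assume "V \<in> tangent_space (frontier K) (F z)"
  then obtain \<gamma> :: "real \<Rightarrow> 'a" where \<gamma>: "\<gamma> 0 = F z" "\<And>s. \<gamma> s \<in> frontier K" "(\<gamma> has_vector_derivative V) (at 0)"
    by (auto simp: tangent_space_def)
  have "((\<lambda>s. \<nu> \<bullet> \<gamma> s) has_real_derivative (\<nu> \<bullet> V)) (at 0)"
    using has_derivative_inner_right[OF \<gamma>(3)[unfolded has_vector_derivative_def], of \<nu>]
    by (simp add: has_field_derivative_def mult_commute_abs)
  then show "\<nu> \<bullet> V = 0"
    by (rule DERIV_local_max[of _ _ _ 1]) (use \<nu>(2) \<gamma> frontier_subset in auto)
next
  fix V assume "\<nu> \<bullet> V = 0"
  then obtain v where v: "z \<bullet> v = 0" "V = F' z v" using tangent_image[OF z \<nu>] by blast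
  then show "V \<in> tangent_space (frontier K) (F z)"
    unfolding tangent_space_def using curve_frontier[OF z v(1)] curve_derivative[OF z v(1), of 0]
    by (auto intro!: exI[of _ "curve z v"])
qed

text \<open>Uniqueness has to exclude \<open>- \<nu>\<close>. If a short segment from
  \<open>F z\<close> along \<open>- \<nu>\<close> missed \<open>K\<close>, a hyperplane would
  separate it from \<open>K\<close>. That hyperplane passes through \<open>F z\<close>, so its
  normal is a nonnegative multiple of \<nu>, but for a positive multiple the segment lies on the
  wrong side.\<close>

lemma outward_normal_eq:
  assumes z: "z \<in> sphere 0 1" and \<nu>: "norm \<nu> = 1" "\<forall>y\<in>K. \<nu> \<bullet> y \<le> \<nu> \<bullet> F z"
  shows "outward_normal K (F z) = \<nu>"
  unfolding outward_normal_def
proof (rule the_equality, intro conjI ballI)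
  have nn: "\<nu> \<bullet> \<nu> = 1" using \<nu>(1) by (simp add: norm_eq_1)
  show "norm \<nu> = 1" by fact
  show "\<nu> \<bullet> V = 0" if "V \<in> tangent_space (frontier K) (F z)" for V
    using that tangent_space_eq[OF assms] by auto
  have "F z + s *\<^sub>R \<nu> \<notin> K" if "s > 0" for s
    using \<nu>(2) that nn by (force simp: inner_add_right)
  then show "\<forall>\<^sub>F s in at_right 0. F z + s *\<^sub>R \<nu> \<notin> K"
    by (simp add: eventually_at_right_less eventually_at_filter)
  fix N assume N: "norm N = 1 \<and> (\<forall>V\<in>tangent_space (frontier K) (F z). N \<bullet> V = 0) \<and>
    (\<forall>\<^sub>F s in at_right 0. F z + s *\<^sub>R N \<notin> K)"
  then have par: "N = (N \<bullet> \<nu>) *\<^sub>R \<nu>"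
    using tangent_space_eq[OF assms] by (intro perp_of_perp \<nu>(1)) auto
  then have "\<bar>N \<bullet> \<nu>\<bar> = 1" using N \<nu>(1) by (metis mult.right_neutral norm_scaleR)
  moreover have "N \<bullet> \<nu> \<noteq> - 1"
  proof
    assume "N \<bullet> \<nu> = - 1"
    with par have "N = - \<nu>" by simp
    with N obtain d where d: "d > 0" "\<And>s. 0 < s \<Longrightarrow> s < d \<Longrightarrow> F z - s *\<^sub>R \<nu> \<notin> K"
      by (auto simp: eventually_at_right_field)
    define R where "R = (\<lambda>s. F z - s *\<^sub>R \<nu>) ` {0<..<d}"
    have "convex R" unfolding R_def
      using convex_affinity[of "(\<lambda>s. s *\<^sub>R \<nu>) ` {0<..<d}" "F z" "-1"]
        convex_linear_image[of "\<lambda>s. s *\<^sub>R \<nu>" "{0<..<d}"]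
      by (simp add: image_image linear_scaleR_left)
    moreover have "K \<inter> R = {}" using d by (auto simp: R_def)
    moreover have "R \<noteq> {}" using d(1) by (auto simp: R_def)
    moreover have "K \<noteq> {}" using interior_K by auto
    ultimately obtain a b where ab: "a \<noteq> 0" "\<forall>x\<in>K. a \<bullet> x \<le> b" "\<forall>x\<in>R. b \<le> a \<bullet> x"
      using separating_hyperplane_sets[OF convex_K] by metis
    have ge: "b \<le> a \<bullet> F z - s * (a \<bullet> \<nu>)" if "0 < s" "s < d" for s
      using ab(3) that by (force simp: R_def inner_diff_right)
    have "((\<lambda>s. a \<bullet> F z - s * (a \<bullet> \<nu>)) \<longlongrightarrow> a \<bullet> F z - 0 * (a \<bullet> \<nu>)) (at_right 0)"
      by (intro tendsto_intros)
    then have "b \<le> a \<bullet> F z - 0 * (a \<bullet> \<nu>)"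
    proof (rule tendsto_lowerbound)
      show "\<forall>\<^sub>F s in at_right 0. b \<le> a \<bullet> F z - s * (a \<bullet> \<nu>)"
        using ge d(1) by (auto simp: eventually_at_right_field)
    qed simp
    then have b: "b = a \<bullet> F z"
      using ab(2) F_frontier[OF z] frontier_subset by fastforce
    have par': "a = (a \<bullet> \<nu>) *\<^sub>R \<nu>" "a \<bullet> \<nu> \<ge> 0"
      using support_parallel[OF assms, of a] ab(2) b by auto
    have "a \<bullet> F z \<le> a \<bullet> F z - d / 2 * (a \<bullet> \<nu>)" using ge[of "d/2"] d(1) b by auto
    then have "a \<bullet> \<nu> \<le> 0" using d(1) by (simp add: mult_le_0_iff)
    with par' ab(1) show False by simp
  qed
  ultimately have "N \<bullet> \<nu> = 1" by linarith
  with par show "N = \<nu>" by simp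
qed

definition normal :: "'a \<Rightarrow> 'a" where "normal z = outward_normal K (F z)"

lemma normal:
  assumes "z \<in> sphere 0 1"
  shows "norm (normal z) = 1" and "\<forall>y\<in>K. normal z \<bullet> y \<le> normal z \<bullet> F z"
    and "outward_normal K (F z) = normal z"
proof -
  obtain \<nu> where "norm \<nu> = 1" "\<forall>y\<in>K. \<nu> \<bullet> y \<le> \<nu> \<bullet> F z"
    using support_exists[OF F_frontier[OF assms]] by blast
  with outward_normal_eq[OF assms this] show "norm (normal z) = 1" "\<forall>y\<in>K. normal z \<bullet> y \<le> normal z \<bullet> F z"
    by (auto simp: normal_def)
qed (simp add: normal_def)

lemma normal_unique:
  assumes "z \<in> sphere 0 1" "norm \<nu> = 1" "\<forall>y\<in>K. \<nu> \<bullet> y \<le> \<nu> \<bullet> F z"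
  shows "normal z = \<nu>"
  using outward_normal_eq[OF assms] by (simp add: normal_def)

lemma tangent_space_normal:
  assumes "z \<in> sphere 0 1"
  shows "tangent_space (frontier K) (F z) = {V. normal z \<bullet> V = 0}"
  using tangent_space_eq[OF assms normal(1,2)[OF assms]] .

lemma tangentE:
  assumes "z \<in> sphere 0 1" "normal z \<bullet> V = 0"
  obtains v where "z \<bullet> v = 0" "V = F' z v"
  using tangent_image[OF assms(1) normal(1,2)[OF assms(1)]] assms(2) by blast

lemma normal_perp:
  assumes "z \<in> sphere 0 1" "z \<bullet> v = 0"
  shows "normal z \<bullet> F' z v = 0"
  using support_perp[OF assms normal(2)[OF assms(1)]] .

text \<open>A point outside \<open>K\<close> violates the inequality at its closest point in
  \<open>K\<close>, where the direction towards it is a support direction and hence a positive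
  multiple of the normal. Membership thus becomes a family of conditions that will be continuous in
  time.\<close>

lemma mem_K_iff: "x \<in> K \<longleftrightarrow> (\<forall>z\<in>sphere 0 1. normal z \<bullet> x \<le> normal z \<bullet> F z)"
proof (intro iffI ballI)
  fix z :: 'a assume "x \<in> K" "z \<in> sphere 0 1"
  then show "normal z \<bullet> x \<le> normal z \<bullet> F z" using normal(2) by blast
next
  assume H: "\<forall>z\<in>sphere 0 1. normal z \<bullet> x \<le> normal z \<bullet> F z"
  show "x \<in> K"
  proof (rule ccontr)
    assume "x \<notin> K"
    have cl: "closed K" "K \<noteq> {}" using compact_K interior_K by (auto simp: compact_imp_closed)
    define y where "y = closest_point K x"
    have yK: "y \<in> K" unfolding y_def by (rule closest_point_in_set[OF cl])
    have sup: "(x - y) \<bullet> (w - y) \<le> 0" if "w \<in> K" for w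
      unfolding y_def using closest_point_dot[OF convex_K cl(1) that] .
    have "x \<noteq> y" using yK \<open>x \<notin> K\<close> by auto
    have "y \<in> frontier K"
    proof -
      have "y \<notin> interior K"
      proof
        assume "y \<in> interior K"
        then obtain e where e: "e > 0" "cball y e \<subseteq> K" using mem_interior_cball by blast
        have "y + e *\<^sub>R sgn (x - y) \<in> K" using e by (auto simp: dist_norm norm_sgn)
        from sup[OF this] have "e * norm (x - y) \<le> 0" by (simp add: inner_sgn)
        then show False using e(1) \<open>x \<noteq> y\<close> by (simp add: mult_le_0_iff)
      qed
      then show ?thesis using yK closure_subset by (auto simp: frontier_def)
    qed
    then obtain z where z: "z \<in> sphere 0 1" "y = F z" by (rule frontierE)
    have "\<forall>w\<in>K. (x - y) \<bullet> w \<le> (x - y) \<bullet> F z" using sup z(2) by (simp add: inner_diff_right)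
    from support_parallel[OF z(1) normal(1,2)[OF z(1)] this]
    have par: "x - y = ((x - y) \<bullet> normal z) *\<^sub>R normal z" "(x - y) \<bullet> normal z \<ge> 0" by auto
    then have "(x - y) \<bullet> normal z > 0" using \<open>x \<noteq> y\<close> by (metis antisym_conv2 eq_iff_diff_eq_0 scale_zero_left)
    moreover have "normal z \<bullet> x \<le> normal z \<bullet> F z" using H z(1) by blast
    then have "(x - y) \<bullet> normal z \<le> 0" unfolding z(2) by (simp add: inner_diff_left inner_commute)
    ultimately show False by simp
  qed
qed

lemma frontier_iff:
  assumes "x \<in> K" "norm \<nu> = 1" "\<forall>y\<in>K. \<nu> \<bullet> y \<le> \<nu> \<bullet> x"
  shows "x \<in> frontier K"
proof -
  have "x \<notin> interior K"
  proof
    assume "x \<in> interior K"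
    then obtain e where e: "e > 0" "cball x e \<subseteq> K" using mem_interior_cball by blast
    have "x + e *\<^sub>R \<nu> \<in> K" using e assms(2) by (auto simp: dist_norm)
    then have "\<nu> \<bullet> (x + e *\<^sub>R \<nu>) \<le> \<nu> \<bullet> x" using assms(3) by blast
    then show False using e(1) assms(2) by (simp add: inner_add_right norm_eq_1)
  qed
  then show ?thesis using assms(1) closure_subset by (auto simp: frontier_def)
qed

lemma support_point:
  obtains z where "z \<in> sphere 0 1" "\<forall>y\<in>K. \<nu> \<bullet> y \<le> \<nu> \<bullet> F z"
proof (cases "\<nu> = 0")
  case True
  obtain z :: 'a where "norm z = 1" using vector_choose_size[of 1] by auto
  with True show thesis by (intro that[of z]) auto
next
  case False
  have "K \<noteq> {}" using interior_K by auto
  then obtain x where x: "x \<in> K" "\<forall>y\<in>K. \<nu> \<bullet> y \<le> \<nu> \<bullet> x"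
    using continuous_attains_sup[OF compact_K, of "\<lambda>y. \<nu> \<bullet> y"] by (force intro: continuous_intros)
  have s: "\<forall>y\<in>K. sgn \<nu> \<bullet> y \<le> sgn \<nu> \<bullet> x" "norm (sgn \<nu>) = 1"
    using x(2) False by (auto simp: sgn_div_norm norm_sgn)
  obtain z where "z \<in> sphere 0 1" "x = F z" using frontierE[OF frontier_iff[OF x(1) s(2,1)]] .
  with x(2) show thesis by (intro that[of z]) auto
qed

lemma inverse_differentiable:
  assumes z: "z \<in> sphere 0 1"
  shows "inv_into (sphere 0 1) F differentiable (at (F z) within frontier K)"
proof -
  let ?\<psi> = "inv_into (sphere 0 1) F" and ?S = "sphere 0 1 :: 'a set"
  \<comment> \<open>On the sphere \<open>z \<bullet> y - 1 + (y - z) \<bullet> (y - z) / 2\<close>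
    is identically 0, so adding a multiple of it changes neither \<open>F\<close> there nor the
    tangential derivative, but replaces the uncontrolled radial derivative \<open>F' z z\<close> by
    \<open>normal z\<close>. The resulting \<open>L\<close> is injective on the whole space.\<close>
  define L where "L h = F' z h + (z \<bullet> h) *\<^sub>R (normal z - F' z z)" for h
  note lin = linear_F'[OF z]
  have z1: "z \<bullet> z = 1" using z by (simp add: norm_eq_1)
  have \<psi>: "?\<psi> (F y) = y" if "y \<in> ?S" for y
    using bij that by (simp add: bij_betw_def)
  have L: "(F has_derivative L) (at z within ?S)"
  proof (rule has_derivative_transform)
    show "((\<lambda>y. F y + (z \<bullet> y - 1 + (y - z) \<bullet> (y - z) / 2) *\<^sub>R (normal z - F' z z)) has_derivative L) (at z within ?S)"
      unfolding L_def
      by (auto intro!: derivative_eq_intros has_derivative_at_withinI[OF deriv[OF z]])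
    fix y assume "y \<in> ?S"
    then have "y \<bullet> y = 1" by (simp add: norm_eq_1)
    then show "F y = F y + (z \<bullet> y - 1 + (y - z) \<bullet> (y - z) / 2) *\<^sub>R (normal z - F' z z)"
      using z1 by (simp add: inner_diff_left inner_diff_right inner_commute diff_divide_distrib)
  qed (fact z)
  have linL: "linear L" using L by (rule has_derivative_linear)
  have "v = 0" if "L v = 0" for v
  proof -
    have p: "z \<bullet> (v - (z \<bullet> v) *\<^sub>R z) = 0" by (simp add: inner_diff_right z1)
    have eq: "L v = F' z (v - (z \<bullet> v) *\<^sub>R z) + (z \<bullet> v) *\<^sub>R normal z"
      by (simp add: L_def linear_diff[OF lin] linear_cmul[OF lin] scaleR_diff_right)
    have "normal z \<bullet> L v = z \<bullet> v"
      using normal_perp[OF z p] normal(1)[OF z] unfolding eq by (simp add: inner_add_right norm_eq_1)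
    then have "z \<bullet> v = 0" using that by simp
    then show "v = 0" using eq that immersion[OF z, of v] by simp
  qed
  then have "inj L" using linear_injective_0[OF linL] by blast
  then obtain g where g: "linear g" "g \<circ> L = id" using linear_injective_left_inverse[OF linL] by blast
  have contF: "continuous_on ?S F"
    using deriv by (meson continuous_at_imp_continuous_on has_derivative_continuous)
  have "continuous_on (F ` ?S) ?\<psi>"
    by (rule continuous_on_inv[OF contF compact_sphere]) (use \<psi> in auto)
  then have "continuous_on (frontier K) ?\<psi>" using bij by (simp add: bij_betw_def)
  then have cont: "continuous (at (F z) within frontier K) ?\<psi>"
    using F_frontier[OF z] by (simp add: continuous_on_eq_continuous_within)
  have "(?\<psi> has_derivative g) (at (F z) within frontier K)"
  proof (rule has_derivative_inverse_within[OF _ _ g(2) cont])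
    show "(F has_derivative L) (at (?\<psi> (F z)) within ?S)" using L by (simp only: \<psi>[OF z])
    show "bounded_linear g" using g(1) by (rule linear_conv_bounded_linear[THEN iffD1])
    show "?\<psi> ` frontier K \<subseteq> ?S" using bij_betw_inv_into[OF bij] by (auto simp: bij_betw_def)
    show "F (?\<psi> x) = x" if "x \<in> frontier K" for x
      using bij that by (simp add: bij_betw_inv_into_right)
  qed (rule F_frontier[OF z])
  then show ?thesis by (auto simp: differentiable_def)
qed

section \<open>Derivatives along the boundary and curvature\<close>

lemma differentiable_along_frontier:
  fixes f :: "'a \<Rightarrow> 'b::real_normed_vector"
  assumes z: "z \<in> sphere 0 1" and f: "(\<lambda>z. f (F z)) differentiable (at z within sphere 0 1)"
  shows "f differentiable (at (F z) within frontier K)"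
proof -
  let ?\<psi> = "inv_into (sphere 0 1) F"
  have \<psi>z: "?\<psi> (F z) = z" using bij z by (simp add: bij_betw_def)
  have "?\<psi> ` frontier K = sphere 0 1" using bij_betw_inv_into[OF bij] by (simp add: bij_betw_def)
  then have "((\<lambda>z. f (F z)) \<circ> ?\<psi>) differentiable (at (F z) within frontier K)"
    using f \<psi>z by (intro differentiable_chain_within inverse_differentiable[OF z]) simp
  then obtain D where "(((\<lambda>z. f (F z)) \<circ> ?\<psi>) has_derivative D) (at (F z) within frontier K)"
    unfolding differentiable_def by blast
  then have "(f has_derivative D) (at (F z) within frontier K)"
    by (rule has_derivative_transform[rotated 2]) (use F_frontier[OF z] bij in \<open>auto simp: bij_betw_inv_into_right\<close>)
  then show ?thesis by (auto simp: differentiable_def)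
qed

lemma deriv_along_curve:
  fixes f :: "'a \<Rightarrow> 'b::euclidean_space"
  assumes z: "z \<in> sphere 0 1" "z \<bullet> v = 0" and f: "f differentiable (at (F z) within frontier K)"
  shows "((\<lambda>s. f (curve z v s)) has_vector_derivative deriv_along (frontier K) f (F z) (F' z v)) (at 0)"
proof -
  let ?D = "deriv_along (frontier K) f (F z)"
  have D: "(f has_derivative ?D) (at (F z) within frontier K)"
    using f unfolding deriv_along_def by (simp add: frechet_derivative_works)
  then have "(f has_derivative ?D) (at (curve z v 0) within range (curve z v))"
    using curve_frontier[OF z] by (auto intro: has_derivative_subset)
  from diff_chain_within[OF curve_derivative[OF z, of 0, unfolded has_vector_derivative_def] this]
  show ?thesis
    using has_derivative_linear[OF D] by (simp add: has_vector_derivative_def o_def linear_cmul)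
qed

lemma mean_curvature_eq:
  assumes "z \<in> sphere 0 1"
  shows "mean_curvature K (F z) = (\<Sum>e\<in>tangent_basis (normal z). second_fundamental_form K (F z) e e)"
  by (simp add: mean_curvature_def tangent_basis_def tangent_space_normal[OF assms])

context
  fixes z :: 'a
  assumes z: "z \<in> sphere 0 1" and nd: "normal differentiable (at z within sphere 0 1)"
begin

lemma outward_normal_differentiable: "outward_normal K differentiable (at (F z) within frontier K)"
  by (rule differentiable_along_frontier[OF z]) (use nd in \<open>simp add: normal_def[abs_def]\<close>)

lemma linear_shape_operator: "linear (deriv_along (frontier K) (outward_normal K) (F z))"
  using outward_normal_differentiable unfolding deriv_along_def
  by (simp add: linear_frechet_derivative)

text \<open>Velocity and normal stay perpendicular along the curve; differentiating this relation
  trades the acceleration for the derivative of the normal.\<close>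

lemma curve_acceleration:
  assumes v: "z \<bullet> v = 0"
  obtains a where "(curve_velocity z v has_vector_derivative a) (at 0)"
    and "normal z \<bullet> a = - second_fundamental_form K (F z) (F' z v) (F' z v)"
proof -
  obtain a where a: "(curve_velocity z v has_vector_derivative a) (at 0)"
    using curve_velocity_differentiable[OF z v] vector_derivative_works by blast
  let ?D = "deriv_along (frontier K) (outward_normal K) (F z) (F' z v)"
  have n: "((\<lambda>s. outward_normal K (curve z v s)) has_vector_derivative ?D) (at 0)"
    by (rule deriv_along_curve[OF z v outward_normal_differentiable])
  have perp: "outward_normal K (curve z v s) \<bullet> curve_velocity z v s = 0" for s
    unfolding curve_def curve_velocity_def normal_def[symmetric]
    by (intro normal_perp great_circle_in_sphere great_circle_velocity_perp z v)
  have "((\<lambda>s. outward_normal K (curve z v s) \<bullet> curve_velocity z v s) has_vector_derivative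
      outward_normal K (curve z v 0) \<bullet> a + ?D \<bullet> curve_velocity z v 0) (at 0)"
    using has_derivative_inner[OF n[unfolded has_vector_derivative_def] a[unfolded has_vector_derivative_def]]
    by (simp add: has_vector_derivative_def algebra_simps)
  then have "((\<lambda>s. 0::real) has_vector_derivative (normal z \<bullet> a + ?D \<bullet> F' z v)) (at 0)"
    by (simp add: perp normal_def)
  then have "normal z \<bullet> a + ?D \<bullet> F' z v = 0"
    by (rule vector_derivative_unique_at) simp
  with a show thesis by (intro that[of a]) (auto simp: second_fundamental_form_def)
qed

text \<open>The curve stays on the inner side of the tangent plane at its starting point, so its
  depth below that plane is minimal there.\<close>

lemma sff_nonneg:
  assumes "normal z \<bullet> V = 0"
  shows "second_fundamental_form K (F z) V V \<ge> 0"
proof -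
  obtain v where v: "z \<bullet> v = 0" "V = F' z v" using tangentE[OF z assms] .
  obtain a where a: "(curve_velocity z v has_vector_derivative a) (at 0)"
    "normal z \<bullet> a = - second_fundamental_form K (F z) V V"
    using curve_acceleration[OF v(1)] v(2) by blast
  have c: "(curve z v has_derivative (\<lambda>h. h *\<^sub>R curve_velocity z v s)) (at s)" for s
    using curve_derivative[OF z v(1), of s] by (simp add: has_vector_derivative_def)
  have c': "(curve_velocity z v has_derivative (\<lambda>h. h *\<^sub>R a)) (at 0)" using a(1) by (simp add: has_vector_derivative_def)
  have "0 \<le> (1::real) \<bullet> - (normal z \<bullet> a)"
  proof (rule second_order_nonneg)
    show "((\<lambda>s. normal z \<bullet> F z - normal z \<bullet> curve z v s) has_vector_derivative
        - (normal z \<bullet> curve_velocity z v s)) (at s)" for s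
      unfolding has_vector_derivative_def by (auto intro!: derivative_eq_intros c)
    show "((\<lambda>s. - (normal z \<bullet> curve_velocity z v s)) has_vector_derivative - (normal z \<bullet> a)) (at 0)"
      unfolding has_vector_derivative_def by (auto intro!: derivative_eq_intros c')
    show "((\<lambda>s. 1::real) \<longlongrightarrow> 1) (at 0)" by simp
    show "0 \<le> 1 \<bullet> (normal z \<bullet> F z - normal z \<bullet> curve z v s)" for s
      using normal(2)[OF z] curve_frontier[OF z v(1), of s] frontier_subset by auto
  qed (simp_all add: normal_perp[OF z v(1)])
  then show ?thesis using a(2) by simp
qed

lemma sff_scale:
  "second_fundamental_form K (F z) (c *\<^sub>R V) (c *\<^sub>R V) = c\<^sup>2 * second_fundamental_form K (F z) V V"
  by (simp add: second_fundamental_form_def linear_cmul[OF linear_shape_operator] power2_eq_square)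

lemma mean_curvature_nonneg: "mean_curvature K (F z) \<ge> 0"
  unfolding mean_curvature_eq[OF z] by (intro sum_nonneg sff_nonneg tangent_basis(6))

text \<open>Lets the Harnack inequality close up as a linear differential inequality for the mean
  curvature. By the parallelogram identity and nonnegativity at \<open>V - W\<close>, the form at
  \<open>V + W\<close> is at most twice the sum of its values at \<open>V\<close> and
  \<open>W\<close>; expanding in the chosen basis costs one factor 2 per basis vector.\<close>

lemma sff_le_mean_curvature:
  assumes V: "normal z \<bullet> V = 0"
  shows "second_fundamental_form K (F z) V V \<le> 2 ^ DIM('a) * (norm V)\<^sup>2 * mean_curvature K (F z)"
proof -
  let ?q = "\<lambda>V. second_fundamental_form K (F z) V V" and ?B = "tangent_basis (normal z)"
  have dbl: "?q (V + W) \<le> 2 * ?q V + 2 * ?q W" if "normal z \<bullet> V = 0" "normal z \<bullet> W = 0" for V W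
  proof -
    have "0 \<le> ?q (V - W)" using that by (intro sff_nonneg) (simp add: inner_diff_right)
    then show ?thesis
      by (simp add: second_fundamental_form_def linear_add[OF linear_shape_operator]
          linear_diff[OF linear_shape_operator] inner_add_right inner_diff_right inner_add_left inner_diff_left)
  qed
  have main: "?q (\<Sum>e\<in>A. c e *\<^sub>R e) \<le> 2 ^ card A * (\<Sum>e\<in>A. (c e)\<^sup>2 * ?q e)"
    if "finite A" "A \<subseteq> ?B" for A and c :: "'a \<Rightarrow> real"
    using that
  proof (induction A)
    case empty
    then show ?case by (simp add: second_fundamental_form_def)
  next
    case (insert e A)
    let ?s = "\<Sum>e\<in>A. (c e)\<^sup>2 * ?q e"
    have perp: "normal z \<bullet> (c e *\<^sub>R e) = 0" "normal z \<bullet> (\<Sum>e\<in>A. c e *\<^sub>R e) = 0"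
      using insert.prems tangent_basis(6)[of _ "normal z"]
      by (auto simp: inner_sum_right intro!: sum.neutral)
    have q0: "?q e \<ge> 0" using insert.prems tangent_basis(6)[of e "normal z"] by (intro sff_nonneg) auto
    have "?q (\<Sum>e\<in>insert e A. c e *\<^sub>R e) \<le> 2 * ?q (c e *\<^sub>R e) + 2 * ?q (\<Sum>e\<in>A. c e *\<^sub>R e)"
      using dbl[OF perp] insert.hyps by simp
    also have "\<dots> \<le> 2 * ((c e)\<^sup>2 * ?q e) + 2 * (2 ^ card A * ?s)"
      using insert.IH insert.prems by (simp add: sff_scale)
    also have "\<dots> \<le> 2 ^ card (insert e A) * ((c e)\<^sup>2 * ?q e) + 2 ^ card (insert e A) * ?s"
    proof -
      have "2 * ((c e)\<^sup>2 * ?q e) \<le> 2 * 2 ^ card A * ((c e)\<^sup>2 * ?q e)"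
        by (rule mult_right_mono) (use q0 in auto)
      then show ?thesis using insert.hyps by (simp add: mult.assoc)
    qed
    finally show ?case using insert.hyps by (simp add: distrib_left)
  qed
  have exp: "(\<Sum>e\<in>?B. (V \<bullet> e) *\<^sub>R e) = V"
    using tangent_basis(1,3,4)[of "normal z"] V
    by (intro orthonormal_basis_expand) (auto intro: tangent_basis(2))
  have "?q V \<le> 2 ^ card ?B * (\<Sum>e\<in>?B. (V \<bullet> e)\<^sup>2 * ?q e)"
    using main[OF tangent_basis(4) order_refl, of "\<lambda>e. V \<bullet> e"] by (simp add: exp)
  also have "\<dots> \<le> 2 ^ DIM('a) * (\<Sum>e\<in>?B. (norm V)\<^sup>2 * ?q e)"
  proof (intro mult_mono sum_mono)
    fix e assume e: "e \<in> ?B"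
    have "\<bar>V \<bullet> e\<bar> \<le> norm V" using Cauchy_Schwarz_ineq2[of V e] tangent_basis(2)[OF e] by simp
    then show "(V \<bullet> e)\<^sup>2 \<le> (norm V)\<^sup>2" by (metis abs_le_square_iff abs_norm_cancel)
    show "0 \<le> ?q e" by (rule sff_nonneg[OF tangent_basis(6)[OF e]])
  qed (use tangent_basis(5)[of "normal z"] in \<open>auto intro!: sum_nonneg mult_nonneg_nonneg sff_nonneg tangent_basis(6)\<close>)
  also have "\<dots> = 2 ^ DIM('a) * (norm V)\<^sup>2 * mean_curvature K (F z)"
    by (simp add: mean_curvature_eq[OF z] sum_distrib_left mult.assoc)
  finally show ?thesis .
qed

end

text \<open>At a point of \<open>K\<close> farthest from an interior point the sphere of radius
  \<open>R\<close> encloses \<open>K\<close> and touches it, so the second fundamental form is at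
  least that of the sphere, \<open>1 / R\<close> on unit vectors.\<close>

lemma exists_positive_mean_curvature:
  assumes nd: "\<And>z. z \<in> sphere 0 1 \<Longrightarrow> normal differentiable (at z within sphere 0 1)"
  obtains z where "z \<in> sphere 0 1" "mean_curvature K (F z) > 0"
proof -
  obtain y0 where "y0 \<in> interior K" using interior_K by blast
  then obtain e where e: "e > 0" "cball y0 e \<subseteq> K" using mem_interior_cball by blast
  then have "K \<noteq> {}" by auto
  obtain x where x: "x \<in> K" "\<And>y. y \<in> K \<Longrightarrow> norm (y - y0) \<le> norm (x - y0)"
    using continuous_attains_sup[OF compact_K \<open>K \<noteq> {}\<close>, of "\<lambda>y. norm (y - y0)"]
    by (force intro: continuous_intros)
  obtain b :: 'a where b: "norm b = 1" using vector_choose_size[of 1] by auto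
  have "y0 + e *\<^sub>R b \<in> K" using e b by (auto simp: dist_norm)
  from x(2)[OF this] have "x \<noteq> y0" using e(1) b by auto
  define R where "R = norm (x - y0)"
  have R: "R > 0" using \<open>x \<noteq> y0\<close> by (simp add: R_def)
  define \<nu> where "\<nu> = sgn (x - y0)"
  have \<nu>: "norm \<nu> = 1" "x - y0 = R *\<^sub>R \<nu>"
    using \<open>x \<noteq> y0\<close> by (simp_all add: \<nu>_def R_def norm_sgn norm_scaleR_sgn)
  have sup: "\<forall>y\<in>K. \<nu> \<bullet> y \<le> \<nu> \<bullet> x"
  proof
    fix y assume "y \<in> K"
    have "\<nu> \<bullet> (y - y0) \<le> norm (y - y0)" using norm_cauchy_schwarz[of \<nu> "y - y0"] \<nu>(1) by simp
    also have "\<dots> \<le> R" unfolding R_def by (rule x(2)[OF \<open>y \<in> K\<close>])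
    also have "R = \<nu> \<bullet> (x - y0)" using \<nu> by (simp add: norm_eq_1)
    finally show "\<nu> \<bullet> y \<le> \<nu> \<bullet> x" by (simp add: inner_diff_right)
  qed
  obtain z where z: "z \<in> sphere 0 1" "x = F z" using frontierE[OF frontier_iff[OF x(1) \<nu>(1) sup]] .
  have n: "normal z = \<nu>" using normal_unique[OF z(1) \<nu>(1)] sup z(2) by simp
  have pos: "second_fundamental_form K (F z) V V > 0" if V: "norm V = 1" "normal z \<bullet> V = 0" for V
  proof -
    obtain v where v: "z \<bullet> v = 0" "V = F' z v" using tangentE[OF z(1) V(2)] .
    obtain a where a: "(curve_velocity z v has_vector_derivative a) (at 0)"
      "normal z \<bullet> a = - second_fundamental_form K (F z) V V"
      using curve_acceleration[OF z(1) nd[OF z(1)] v(1)] v(2) by blast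
    let ?c = "curve z v" and ?c' = "curve_velocity z v"
    have c: "(?c has_derivative (\<lambda>h. h *\<^sub>R ?c' s)) (at s)" for s
      using curve_derivative[OF z(1) v(1), of s] by (simp add: has_vector_derivative_def)
    have c': "(?c' has_derivative (\<lambda>h. h *\<^sub>R a)) (at 0)" using a(1) by (simp add: has_vector_derivative_def)
    have "0 \<le> (1::real) \<bullet> (- 2 * (V \<bullet> V + (x - y0) \<bullet> a))"
    proof (rule second_order_nonneg)
      show "((\<lambda>s. R\<^sup>2 - (?c s - y0) \<bullet> (?c s - y0)) has_vector_derivative
          - 2 * ((?c s - y0) \<bullet> ?c' s)) (at s)" for s
        unfolding has_vector_derivative_def
        by (auto intro!: derivative_eq_intros c simp: inner_commute algebra_simps)
      show "((\<lambda>s. - 2 * ((?c s - y0) \<bullet> ?c' s)) has_vector_derivative (- 2 * (V \<bullet> V + (x - y0) \<bullet> a))) (at 0)"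
        unfolding has_vector_derivative_def
        by (auto intro!: derivative_eq_intros c c' simp: inner_commute algebra_simps v(2) z(2))
      show "((\<lambda>s. 1::real) \<longlongrightarrow> 1) (at 0)" by simp
      show "R\<^sup>2 - (?c 0 - y0) \<bullet> (?c 0 - y0) = 0" by (simp add: R_def z(2) power2_norm_eq_inner)
      show "- 2 * ((?c 0 - y0) \<bullet> ?c' 0) = 0"
        using \<nu>(2) V(2) n by (simp flip: z(2) v(2))
      have "norm (?c s - y0) \<le> R" for s
        unfolding R_def using curve_frontier[OF z(1) v(1), of s] frontier_subset by (intro x(2)) auto
      then have "(norm (?c s - y0))\<^sup>2 \<le> R\<^sup>2" for s by (intro power_mono) auto
      then show "0 \<le> 1 \<bullet> (R\<^sup>2 - (?c s - y0) \<bullet> (?c s - y0))" for s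
        by (simp add: power2_norm_eq_inner)
    qed
    then have "1 + R * (normal z \<bullet> a) \<le> 0" using V(1) \<nu>(2) n by (simp add: norm_eq_1)
    then have "R * second_fundamental_form K (F z) V V \<ge> 1" using a(2) by simp
    then show ?thesis using R by (smt (verit) mult_nonneg_nonpos)
  qed
  have "mean_curvature K (F z) > 0"
    unfolding mean_curvature_eq[OF z(1)]
    by (rule sum_pos) (auto intro!: pos tangent_basis tangent_basis_nonempty dim)
  with z(1) show thesis by (rule that)
qed

end

subsection \<open>The flow\<close>

text \<open>\<open>g\<close> is a C^2 extension of \<open>X\<close> to a set \<open>U\<close>
  containing the parameter domain. Its derivatives are ambient ones, so the initial time needs no
  one-sided calculus.\<close>

locale convex_flow =
  fixes \<Omega> :: "real \<Rightarrow> 'a::euclidean_space set" and X :: "'a \<Rightarrow> real \<Rightarrow> 'a" and t0 T :: real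
    and g :: "'a \<times> real \<Rightarrow> 'a" and U :: "('a \<times> real) set"
  assumes dim: "2 \<le> DIM('a)" and less: "t0 < T"
    and sub_U: "sphere 0 1 \<times> {t0..<T} \<subseteq> U"
    and C2: "Ck_on (Suc (Suc 0)) U g"
    and g_eq: "\<And>z t. z \<in> sphere 0 1 \<Longrightarrow> t \<in> {t0..<T} \<Longrightarrow> g (z, t) = X z t"
    and flow: "convex_mean_curvature_flow {t0..<T} \<Omega> X"
begin

definition dg :: "'a \<times> real \<Rightarrow> 'a \<times> real \<Rightarrow> 'a" where
  "dg p w = frechet_derivative g (at p) w"

definition n :: "'a \<Rightarrow> real \<Rightarrow> 'a" where "n z t = outward_normal (\<Omega> t) (g (z, t))"

definition H :: "'a \<Rightarrow> real \<Rightarrow> real" where "H z t = mean_curvature (\<Omega> t) (g (z, t))"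

abbreviation A :: "'a \<Rightarrow> real \<Rightarrow> 'a \<Rightarrow> real" where
  "A z t V \<equiv> second_fundamental_form (\<Omega> t) (g (z, t)) V V"

lemma in_U: "z \<in> sphere 0 1 \<Longrightarrow> t \<in> {t0..<T} \<Longrightarrow> (z, t) \<in> U"
  using sub_U by blast

lemma g_deriv: "p \<in> U \<Longrightarrow> (g has_derivative dg p) (at p)"
  using C2 unfolding dg_def[abs_def] by (simp add: frechet_derivative_works)

lemma dg_differentiable: "p \<in> U \<Longrightarrow> (\<lambda>p. dg p w) differentiable (at p)"
  using C2 unfolding dg_def[abs_def] Ck_on.simps by blast

lemma linear_dg: "p \<in> U \<Longrightarrow> linear (dg p)"
  using g_deriv has_derivative_linear by blast

lemma linear_dg_space: "p \<in> U \<Longrightarrow> linear (\<lambda>w. dg p (w, 0))"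
proof (rule linearI)
  assume p: "p \<in> U"
  show "dg p (v + w, 0) = dg p (v, 0) + dg p (w, 0)" for v w
    using linear_add[OF linear_dg[OF p], of "(v, 0)" "(w, 0)"] by simp
  show "dg p (c *\<^sub>R v, 0) = c *\<^sub>R dg p (v, 0)" for c v
    using linear_cmul[OF linear_dg[OF p], of c "(v, 0)"] by simp
qed

lemma g_slice: "(z, t) \<in> U \<Longrightarrow> ((\<lambda>z. g (z, t)) has_derivative (\<lambda>v. dg (z, t) (v, 0))) (at z)"
  by (rule has_derivative_compose[where f = "\<lambda>z. (z, t)", OF _ g_deriv])
    (auto intro!: derivative_eq_intros)

lemma g_time: "(z, t) \<in> U \<Longrightarrow> ((\<lambda>t. g (z, t)) has_vector_derivative dg (z, t) (0, 1)) (at t)"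
proof -
  assume U: "(z, t) \<in> U"
  have "((\<lambda>t. g (z, t)) has_derivative (\<lambda>h. dg (z, t) (0, h))) (at t)"
    by (rule has_derivative_compose[where f = "\<lambda>t. (z, t)", OF _ g_deriv[OF U]])
      (auto intro!: derivative_eq_intros)
  moreover have "dg (z, t) (0, h) = h *\<^sub>R dg (z, t) (0, 1)" for h
    using linear_cmul[OF linear_dg[OF U], of h "(0, 1)"] by simp
  then have "(\<lambda>h. dg (z, t) (0, h)) = (\<lambda>h. h *\<^sub>R dg (z, t) (0, 1))" by (rule ext)
  ultimately show ?thesis unfolding has_vector_derivative_def by (simp only:)
qed

lemma body:
  assumes t: "t \<in> {t0..<T}"
  shows "parametrized_body (\<Omega> t) (\<lambda>z. g (z, t)) (\<lambda>z v. dg (z, t) (v, 0))"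
proof
  have par: "smooth_parametrization {t0..<T} \<Omega> X" and "convex_body (\<Omega> t)"
    using flow t by (auto simp: convex_mean_curvature_flow_def)
  then show "convex_body (\<Omega> t)" by simp
  have "bij_betw (\<lambda>z. X z t) (sphere 0 1) (frontier (\<Omega> t))"
    using par t by (simp add: smooth_parametrization_def)
  then show "bij_betw (\<lambda>z. g (z, t)) (sphere 0 1) (frontier (\<Omega> t))"
    using g_eq[OF _ t] by (subst bij_betw_cong) auto
  fix z v :: 'a assume z: "z \<in> sphere 0 1"
  show der: "((\<lambda>z. g (z, t)) has_derivative (\<lambda>v. dg (z, t) (v, 0))) (at z)"
    by (rule g_slice[OF in_U[OF z t]])
  have "((\<lambda>p. dg p (v, 0)) \<circ> (\<lambda>z. (z, t))) differentiable (at z)"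
    by (intro differentiable_chain_at dg_differentiable in_U z t differentiable_Pair1)
  then show "(\<lambda>z. dg (z, t) (v, 0)) differentiable (at z)" by (simp add: o_def)
  assume v: "z \<bullet> v = 0" "dg (z, t) (v, 0) = 0"
  have "((\<lambda>z. X z t) has_derivative (\<lambda>v. dg (z, t) (v, 0))) (at z within sphere 0 1)"
    using has_derivative_at_withinI[OF der]
    by (rule has_derivative_transform[OF z, rotated]) (simp add: g_eq[OF _ t])
  from deriv_along_eq[OF this tangent_space_sphere[OF z v(1)]] v(2)
  have "deriv_along (sphere 0 1) (\<lambda>z. X z t) z v = 0" by simp
  then show "v = 0"
    using par t z tangent_space_sphere[OF z v(1)] by (auto simp: smooth_parametrization_def)
qed (rule dim)

lemma normal_eq: "parametrized_body.normal (\<Omega> t) (\<lambda>z. g (z, t)) z = n z t" if "t \<in> {t0..<T}"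
  unfolding parametrized_body.normal_def[OF body[OF that]] n_def ..

context
  fixes z :: 'a and t :: real assumes zt: "z \<in> sphere 0 1" "t \<in> {t0..<T}"
begin

interpretation B: parametrized_body "\<Omega> t" "\<lambda>z. g (z, t)" "\<lambda>z v. dg (z, t) (v, 0)"
  by (rule body[OF zt(2)])

lemma norm_n [simp]: "norm (n z t) = 1" and n_support: "y \<in> \<Omega> t \<Longrightarrow> n z t \<bullet> y \<le> n z t \<bullet> g (z, t)"
  using B.normal[OF zt(1)] by (auto simp: normal_eq[OF zt(2)])

lemma n_n [simp]: "n z t \<bullet> n z t = 1" using norm_n by (simp only: norm_eq_1)

lemma n_unique: "norm \<nu> = 1 \<Longrightarrow> \<forall>y\<in>\<Omega> t. \<nu> \<bullet> y \<le> \<nu> \<bullet> g (z, t) \<Longrightarrow> n z t = \<nu>"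
  using B.normal_unique[OF zt(1)] by (simp add: normal_eq[OF zt(2)])

lemma n_perp: "z \<bullet> v = 0 \<Longrightarrow> n z t \<bullet> dg (z, t) (v, 0) = 0"
  using B.normal_perp[OF zt(1)] by (simp add: normal_eq[OF zt(2)])

lemma n_perpE:
  assumes "n z t \<bullet> V = 0" obtains v where "z \<bullet> v = 0" "V = dg (z, t) (v, 0)"
  using B.tangentE[OF zt(1)] assms by (auto simp: normal_eq[OF zt(2)])

lemma g_in: "g (z, t) \<in> \<Omega> t" and g_frontier: "g (z, t) \<in> frontier (\<Omega> t)"
  using B.F_frontier[OF zt(1)] B.frontier_subset by auto

text \<open>The half-open interval has no isolated points, so the one-sided flow equation determines
  the ambient time derivative of \<open>g\<close>, at \<open>t0\<close> as well. Read backwards, it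
  expresses \<open>H\<close> through the normal and a first derivative of \<open>g\<close>.\<close>

lemma speed: "dg (z, t) (0, 1) = - H z t *\<^sub>R n z t"
proof (rule vector_derivative_unique_within)
  show "at t within {t0..<T} \<noteq> bot"
    unfolding trivial_limit_within
    using islimpt_subset[OF islimpt_greaterThanLessThan1[of t T], of "{t0..<T}"] zt by auto
  show "((\<lambda>t. g (z, t)) has_vector_derivative dg (z, t) (0, 1)) (at t within {t0..<T})"
    using g_time[OF in_U[OF zt]] by (rule has_vector_derivative_at_within)
  have "((\<lambda>s. X z s) has_vector_derivative
           - mean_curvature (\<Omega> t) (X z t) *\<^sub>R outward_normal (\<Omega> t) (X z t)) (at t within {t0..<T})"
    using flow zt by (auto simp: convex_mean_curvature_flow_def)
  then have "((\<lambda>s. X z s) has_vector_derivative - H z t *\<^sub>R n z t) (at t within {t0..<T})"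
    by (simp add: H_def n_def g_eq[OF zt])
  then show "((\<lambda>t. g (z, t)) has_vector_derivative - H z t *\<^sub>R n z t) (at t within {t0..<T})"
    by (rule has_vector_derivative_transform[OF zt(2), rotated]) (simp add: g_eq[OF zt(1)])
qed

end

section \<open>Regularity of the normal and of the mean curvature in space and time\<close>

lemma mem_\<Omega>_iff: "t \<in> {t0..<T} \<Longrightarrow> x \<in> \<Omega> t \<longleftrightarrow> (\<forall>z\<in>sphere 0 1. n z t \<bullet> x \<le> n z t \<bullet> g (z, t))"
  using parametrized_body.mem_K_iff[OF body] by (simp add: normal_eq)

lemma support_point:
  assumes "t \<in> {t0..<T}"
  obtains z where "z \<in> sphere 0 1" "\<forall>y\<in>\<Omega> t. \<nu> \<bullet> y \<le> \<nu> \<bullet> g (z, t)"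
  using parametrized_body.support_point[OF body[OF assms]] by metis

lemma n_eqI:
  assumes "z \<in> sphere 0 1" "t \<in> {t0..<T}" "norm \<nu> = 1"
    and le: "\<And>w. w \<in> sphere 0 1 \<Longrightarrow> \<nu> \<bullet> g (w, t) \<le> \<nu> \<bullet> g (z, t)"
  shows "n z t = \<nu>"
proof -
  obtain w where "w \<in> sphere 0 1" "\<forall>y\<in>\<Omega> t. \<nu> \<bullet> y \<le> \<nu> \<bullet> g (w, t)" using support_point[OF assms(2)] .
  with le[of w] show ?thesis by (intro n_unique assms) force
qed

lemma continuous_g: "continuous_on (sphere 0 1 \<times> {t0..<T}) g"
  using g_deriv sub_U
  by (meson continuous_at_imp_continuous_on has_derivative_continuous subsetD)

text \<open>A closed graph argument with values in the compact unit sphere: by uniqueness of support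
  directions the graph of the normal is cut out by the closed conditions
  \<open>\<nu> \<bullet> g (z', t) \<le> \<nu> \<bullet> g (z, t)\<close>. Stopping at
  \<open>b < T\<close> keeps the parameter domain closed.\<close>

lemma continuous_n_compact:
  assumes "b < T"
  shows "continuous_on (sphere 0 1 \<times> {t0..b}) (\<lambda>(z, t). n z t)"
proof (rule continuous_from_closed_graph)
  let ?S = "sphere 0 1 \<times> {t0..b}" and ?C = "(sphere (0::'a) 1 \<times> {t0..b}) \<times> (sphere 0 1 :: 'a set)"
  show "compact (sphere (0::'a) 1)" by simp
  show "(\<lambda>(z, t). n z t) \<in> ?S \<rightarrow> sphere 0 1" using assms norm_n by auto
  have "(\<lambda>x. (x, case x of (z, t) \<Rightarrow> n z t)) ` ?S =
      (\<Inter>z'\<in>sphere 0 1. {x \<in> ?C. snd x \<bullet> g (z', snd (fst x)) \<le> snd x \<bullet> g (fst x)})" (is "?L = ?R")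
  proof (intro subset_antisym subsetI)
    fix x assume "x \<in> ?L"
    then obtain z t where x: "x = ((z, t), n z t)" "z \<in> sphere 0 1" "t \<in> {t0..b}" by auto
    then have t: "t \<in> {t0..<T}" using assms by auto
    show "x \<in> ?R" using x n_support[OF x(2) t g_in[OF _ t]] norm_n[OF x(2) t] by auto
  next
    fix x assume x: "x \<in> ?R"
    obtain e :: 'a where "norm e = 1" using vector_choose_size[of 1] by auto
    then have "e \<in> sphere 0 1" by simp
    with x have "x \<in> ?C" by blast
    then obtain z t \<nu> where x': "x = ((z, t), \<nu>)" "z \<in> sphere 0 1" "t \<in> {t0..b}" "norm \<nu> = 1" by auto
    then have t: "t \<in> {t0..<T}" using assms by auto
    have "n z t = \<nu>" using x x'(1) by (intro n_eqI x'(2,4) t) auto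
    then show "x \<in> ?L" using x' by force
  qed
  moreover have "closed {x \<in> ?C. snd x \<bullet> g (z', snd (fst x)) \<le> snd x \<bullet> g (fst x)}"
    if "z' \<in> sphere 0 1" for z'
  proof (rule continuous_on_closed_Collect_le)
    show "closed ?C" by (intro closed_Times closed_sphere) auto
    show "continuous_on ?C (\<lambda>x. snd x \<bullet> g (z', snd (fst x)))"
      by (intro continuous_intros continuous_on_compose2[OF continuous_g]) (use that assms in auto)
    show "continuous_on ?C (\<lambda>x. snd x \<bullet> g (fst x))"
      by (intro continuous_intros continuous_on_compose2[OF continuous_g]) (use assms in auto)
  qed
  ultimately show "closed ((\<lambda>x. (x, case x of (z, t) \<Rightarrow> n z t)) ` ?S)" by auto
qed

lemma continuous_n: "continuous_on (sphere 0 1 \<times> {t0..<T}) (\<lambda>(z, t). n z t)"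
  unfolding continuous_on_eq_continuous_within
proof
  fix x assume x: "x \<in> sphere (0::'a) 1 \<times> {t0..<T}"
  then obtain b where b: "snd x < b" "b < T" using dense[of "snd x" T] by auto
  have "continuous (at x within sphere 0 1 \<times> {t0..b}) (\<lambda>(z, t). n z t)"
    using continuous_n_compact[OF b(2)] x b by (auto simp: continuous_on_eq_continuous_within)
  moreover have "at x within sphere 0 1 \<times> {t0..b} = at x within sphere 0 1 \<times> {t0..<T}"
    by (rule at_within_nhd[of _ "UNIV \<times> {..<b}"]) (use b x in \<open>auto intro: open_Times\<close>)
  ultimately show "continuous (at x within sphere 0 1 \<times> {t0..<T}) (\<lambda>(z, t). n z t)" by simp
qed

lemma dg_expand: "p \<in> U \<Longrightarrow> dg p (w, 0) = (\<Sum>b\<in>Basis. (w \<bullet> b) *\<^sub>R dg p (b, 0))"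
proof -
  assume p: "p \<in> U"
  note lin = linear_dg_space[OF p]
  from linear_sum[OF lin, of "\<lambda>b. (w \<bullet> b) *\<^sub>R b" Basis] linear_cmul[OF lin]
  show ?thesis by (simp add: euclidean_representation)
qed

context
  fixes z :: 'a and t :: real assumes zt: "z \<in> sphere 0 1" "t \<in> {t0..<T}"
begin

lemma n_derivative:
  obtains n' where "((\<lambda>(z, t). n z t) has_derivative n') (at (z, t) within sphere 0 1 \<times> {t0..<T})"
    and "\<And>h. n z t \<bullet> n' h = 0"
proof -
  let ?S = "sphere 0 1 \<times> {t0..<T}"
  \<comment> \<open>Coordinate vectors projected to the tangent space of the sphere and pushed
    forward: a redundant frame, but defined on the whole sphere and spanning every tangent
    plane.\<close>
  define q where "q b p = dg p (b - (fst p \<bullet> b) *\<^sub>R fst p, 0)" for b p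
  let ?n = "\<lambda>p. case p of (z, t) \<Rightarrow> n z t"
  have memS: "(z, t) \<in> ?S" using zt by auto
  have cont: "continuous (at (z, t) within ?S) ?n"
    using continuous_n memS by (simp add: continuous_on_eq_continuous_within)
  have q: "q b differentiable (at (z, t) within ?S)" for b
  proof -
    have "(\<lambda>p. \<Sum>c\<in>Basis. ((b - (fst p \<bullet> b) *\<^sub>R fst p) \<bullet> c) *\<^sub>R dg p (c, 0)) differentiable (at (z, t) within ?S)"
    proof (rule differentiable_at_withinI, intro differentiable_sum finite_Basis ballI differentiable_scaleR
        dg_differentiable in_U zt)
      fix c :: 'a
      have "(fst :: 'a \<times> real \<Rightarrow> 'a) differentiable (at (z, t))"
        by (rule bounded_linear_imp_differentiable[OF bounded_linear_fst])
      then show "(\<lambda>p. (b - (fst p \<bullet> b) *\<^sub>R fst p) \<bullet> c) differentiable (at (z, t))"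
        by (intro differentiable_inner differentiable_diff differentiable_scaleR differentiable_const)
    qed
    moreover have "(\<Sum>c\<in>Basis. ((b - (fst p \<bullet> b) *\<^sub>R fst p) \<bullet> c) *\<^sub>R dg p (c, 0)) = q b p" if "p \<in> ?S" for p
      unfolding q_def by (rule dg_expand[symmetric]) (use that sub_U in auto)
    ultimately show ?thesis by (rule differentiable_transform[OF _ memS])
  qed
  have unit: "norm (?n p) = 1" if "p \<in> ?S" for p using that norm_n by auto
  have perp: "?n p \<bullet> q b p = 0" if "p \<in> ?S" for p b
  proof -
    obtain y s where p: "p = (y, s)" "y \<in> sphere 0 1" "s \<in> {t0..<T}" using \<open>p \<in> ?S\<close> by (metis mem_Sigma_iff prod.exhaust)
    then have "y \<bullet> y = 1" by (simp add: norm_eq_1)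
    then have "y \<bullet> (b - (y \<bullet> b) *\<^sub>R y) = 0" by (simp add: inner_diff_right)
    from n_perp[OF p(2,3) this] show ?thesis by (simp add: q_def p(1))
  qed
  have span: "\<exists>c. w = (\<Sum>b\<in>Basis. c b *\<^sub>R q b (z, t))" if w: "?n (z, t) \<bullet> w = 0" for w
  proof -
    obtain v where v: "z \<bullet> v = 0" "w = dg (z, t) (v, 0)" using n_perpE[OF zt] w by auto
    note lin = linear_sum[OF linear_dg_space[OF in_U[OF zt]]] linear_cmul[OF linear_dg_space[OF in_U[OF zt]]]
    have "(\<Sum>b\<in>Basis. (v \<bullet> b) *\<^sub>R q b (z, t)) = dg (z, t) ((\<Sum>b\<in>Basis. (v \<bullet> b) *\<^sub>R (b - (z \<bullet> b) *\<^sub>R z)), 0)"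
      by (simp add: q_def lin)
    also have "(\<Sum>b\<in>Basis. (v \<bullet> b) *\<^sub>R (b - (z \<bullet> b) *\<^sub>R z)) = v - (\<Sum>b\<in>Basis. (v \<bullet> b) * (z \<bullet> b)) *\<^sub>R z"
      by (simp add: scaleR_diff_right sum_subtractf euclidean_representation flip: scaleR_sum_left)
    also have "(\<Sum>b\<in>Basis. (v \<bullet> b) * (z \<bullet> b)) = 0" using v(1) by (simp add: euclidean_inner[of z v] mult.commute)
    finally show ?thesis using v(2) by (intro exI[of _ "\<lambda>b. v \<bullet> b"]) simp
  qed
  show thesis
    using unit_normal_differentiable[OF cont memS unit finite_Basis q perp span] that by auto
qed

text \<open>By \<open>speed\<close>, \<open>H\<close> is minus the product of the normal with the
  time derivative of \<open>g\<close>, both of which are differentiable; its definition through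
  chosen bases shows no such regularity.\<close>

lemma H_differentiable: "(\<lambda>(z, t). H z t) differentiable (at (z, t) within sphere 0 1 \<times> {t0..<T})"
proof -
  let ?S = "sphere 0 1 \<times> {t0..<T}"
  obtain n' where n': "((\<lambda>(z, t). n z t) has_derivative n') (at (z, t) within ?S)" using n_derivative .
  have d: "(\<lambda>p. - ((case p of (z, t) \<Rightarrow> n z t) \<bullet> dg p (0, 1))) differentiable (at (z, t) within ?S)"
    by (intro differentiable_minus differentiable_inner differentiable_at_withinI[OF dg_differentiable[OF in_U[OF zt]]])
      (use n' in \<open>auto simp: differentiable_def\<close>)
  have e: "- ((case p of (z, t) \<Rightarrow> n z t) \<bullet> dg p (0, 1)) = (\<lambda>(z, t). H z t) p" if "p \<in> ?S" for p
    using that by (auto simp: speed)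
  show ?thesis by (rule differentiable_transform[OF d _ e]) (use zt in auto)
qed

lemma slice_differentiable:
  fixes f :: "'a \<Rightarrow> real \<Rightarrow> 'b::real_normed_vector"
  assumes "(\<lambda>(z, t). f z t) differentiable (at (z, t) within sphere 0 1 \<times> {t0..<T})"
  shows "(\<lambda>z. f z t) differentiable (at z within sphere 0 1)"
proof -
  have "(\<lambda>(z, t). f z t) differentiable (at (z, t) within (\<lambda>z. (z, t)) ` sphere 0 1)"
    using assms by (rule differentiable_within_subset) (use zt in auto)
  moreover have "(\<lambda>z. (z, t)) differentiable (at z within sphere 0 1)"
    by (rule differentiable_at_withinI[OF differentiable_Pair1])
  ultimately have "((\<lambda>(z, t). f z t) \<circ> (\<lambda>z. (z, t))) differentiable (at z within sphere 0 1)"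
    by (intro differentiable_chain_within)
  then show ?thesis by (simp add: o_def)
qed

lemma normal_differentiable:
  "parametrized_body.normal (\<Omega> t) (\<lambda>z. g (z, t)) differentiable (at z within sphere 0 1)"
proof -
  obtain n' where "((\<lambda>(z, t). n z t) has_derivative n') (at (z, t) within sphere 0 1 \<times> {t0..<T})"
    using n_derivative .
  then have "(\<lambda>z. n z t) differentiable (at z within sphere 0 1)"
    by (intro slice_differentiable) (auto simp: differentiable_def)
  moreover have "parametrized_body.normal (\<Omega> t) (\<lambda>z. g (z, t)) = (\<lambda>z. n z t)"
    using normal_eq[OF zt(2)] by (rule ext)
  ultimately show ?thesis by simp
qed

lemma H_nonneg: "H z t \<ge> 0"
  unfolding H_def by (rule parametrized_body.mean_curvature_nonneg[OF body[OF zt(2)] zt(1) normal_differentiable])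

end

text \<open>A maximum principle in one fixed direction \<nu>. If the later body crossed a supporting
  hyperplane of the earlier one, the height in that direction, lowered at a small rate \<kappa>,
  would be maximal at some time after \<open>s\<close>. There \<nu> is the normal, so the lowered
  height decreases at rate \<open>H + \<kappa> > 0\<close> and was larger just before.\<close>

lemma mono:
  assumes "t0 \<le> s" "s \<le> t" "t < T"
  shows "\<Omega> t \<subseteq> \<Omega> s"
proof (rule ccontr)
  assume "\<not> \<Omega> t \<subseteq> \<Omega> s"
  then obtain x where x: "x \<in> \<Omega> t" "x \<notin> \<Omega> s" by blast
  have s: "s \<in> {t0..<T}" and t: "t \<in> {t0..<T}" using assms by auto
  obtain z where z: "z \<in> sphere 0 1" "n z s \<bullet> x > n z s \<bullet> g (z, s)"
    using x(2) mem_\<Omega>_iff[OF s] by force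
  define \<nu> where "\<nu> = n z s"
  define \<delta> where "\<delta> = \<nu> \<bullet> x - \<nu> \<bullet> g (z, s)"
  have "\<delta> > 0" using z(2) by (simp add: \<delta>_def \<nu>_def)
  have "s \<noteq> t" using x by auto
  then have "s < t" using assms by simp
  \<comment> \<open>Half of the average rate at which the height would have grown, so that the
    lowered height still grows from \<open>s\<close> to \<open>t\<close>.\<close>
  define \<kappa> where "\<kappa> = \<delta> / (2 * (t - s))"
  have \<kappa>: "\<kappa> > 0" "\<kappa> * (t - s) < \<delta>" using \<open>\<delta> > 0\<close> \<open>s < t\<close> by (simp_all add: \<kappa>_def field_simps)
  define f where "f p = \<nu> \<bullet> g p - \<kappa> * (snd p - s)" for p
  let ?C = "sphere (0::'a) 1 \<times> {s..t}"
  have "continuous_on ?C f"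
    unfolding f_def by (intro continuous_intros continuous_on_subset[OF continuous_g]) (use assms in auto)
  moreover have "compact ?C" by (intro compact_Times) auto
  moreover have "?C \<noteq> {}" using z(1) \<open>s < t\<close> by auto
  ultimately obtain p where p: "p \<in> ?C" "\<And>p'. p' \<in> ?C \<Longrightarrow> f p' \<le> f p"
    using continuous_attains_sup by metis
  obtain y \<sigma> where y: "p = (y, \<sigma>)" "y \<in> sphere 0 1" "s \<le> \<sigma>" "\<sigma> \<le> t" using p(1) by auto
  have \<sigma>: "\<sigma> \<in> {t0..<T}" using y assms by auto
  have "\<sigma> \<noteq> s"
  proof
    assume "\<sigma> = s"
    then have "f p \<le> \<nu> \<bullet> g (z, s)"
      using n_support[OF z(1) s g_in[OF y(2) s]] by (simp add: f_def y(1) \<nu>_def)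
    obtain z' where z': "z' \<in> sphere 0 1" "\<forall>y\<in>\<Omega> t. \<nu> \<bullet> y \<le> \<nu> \<bullet> g (z', t)" using support_point[OF t] .
    have "\<nu> \<bullet> g (z, s) < \<nu> \<bullet> x - \<kappa> * (t - s)" using \<kappa>(2) by (simp add: \<delta>_def)
    also have "\<dots> \<le> f (z', t)" using z'(2) x(1) by (simp add: f_def)
    also have "\<dots> \<le> f p" using z'(1) \<open>s < t\<close> by (intro p(2)) auto
    finally show False using \<open>f p \<le> \<nu> \<bullet> g (z, s)\<close> by simp
  qed
  have "n y \<sigma> = \<nu>"
  proof (rule n_eqI[OF y(2) \<sigma>])
    show "norm \<nu> = 1" unfolding \<nu>_def by (rule norm_n[OF z(1) s])
    show "\<nu> \<bullet> g (w, \<sigma>) \<le> \<nu> \<bullet> g (y, \<sigma>)" if "w \<in> sphere 0 1" for w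
      using p(2)[of "(w, \<sigma>)"] that y by (simp add: f_def)
  qed
  then have "((\<lambda>r. f (y, r)) has_vector_derivative (\<nu> \<bullet> (- H y \<sigma> *\<^sub>R \<nu>) - \<kappa>)) (at \<sigma>)"
    unfolding f_def has_vector_derivative_def
    by (auto intro!: derivative_eq_intros g_time[OF in_U[OF y(2) \<sigma>], unfolded has_vector_derivative_def]
        simp: speed[OF y(2) \<sigma>] algebra_simps)
  then have "((\<lambda>r. f (y, r)) has_real_derivative (- H y \<sigma> - \<kappa>)) (at \<sigma>)"
    using norm_n[OF z(1) s] by (simp add: has_real_derivative_iff_has_vector_derivative norm_eq_1 \<nu>_def)
  moreover have "- H y \<sigma> - \<kappa> < 0" using H_nonneg[OF y(2) \<sigma>] \<kappa>(1) by simp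
  ultimately obtain d where d: "d > 0" "\<And>h. 0 < h \<Longrightarrow> h < d \<Longrightarrow> f (y, \<sigma>) < f (y, \<sigma> - h)"
    using DERIV_neg_dec_left by blast
  define h where "h = min (d / 2) (\<sigma> - s)"
  have "f (y, \<sigma>) < f (y, \<sigma> - h)" using d \<open>\<sigma> \<noteq> s\<close> y(3) by (intro d(2)) (auto simp: h_def)
  moreover have "(y, \<sigma> - h) \<in> ?C" using d(1) y(2-4) by (auto simp: h_def)
  from p(2)[OF this] have "f (y, \<sigma> - h) \<le> f (y, \<sigma>)" by (simp only: y(1))
  ultimately show False by linarith
qed

subsection \<open>Concavity of the family of bodies\<close>

lemma mean_curvature_sum:
  assumes "z \<in> sphere 0 1" "t \<in> {t0..<T}"
  shows "H z t = (\<Sum>e\<in>tangent_basis (n z t). A z t e)"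
  unfolding H_def parametrized_body.mean_curvature_eq[OF body[OF assms(2)] assms(1)] normal_eq[OF assms(2)] ..

lemma A_scale:
  assumes "z \<in> sphere 0 1" "t \<in> {t0..<T}"
  shows "A z t (c *\<^sub>R V) = c\<^sup>2 * A z t V"
  by (rule parametrized_body.sff_scale[OF body[OF assms(2)] assms(1) normal_differentiable[OF assms]])

lemma curve_in_frontier:
  assumes zt: "z \<in> sphere 0 1" "t \<in> {t0..<T}" and V: "n z t \<bullet> V = 0"
  obtains v c' a where "z \<bullet> v = 0" "V = dg (z, t) (v, 0)"
    and "\<And>s. ((\<lambda>s. g (great_circle z v s, t)) has_vector_derivative c' s) (at s)"
    and "c' 0 = V" and "(c' has_vector_derivative a) (at 0)" and "n z t \<bullet> a = - A z t V"
proof -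
  interpret B: parametrized_body "\<Omega> t" "\<lambda>z. g (z, t)" "\<lambda>z v. dg (z, t) (v, 0)"
    by (rule body[OF zt(2)])
  obtain v where v: "z \<bullet> v = 0" "V = dg (z, t) (v, 0)" using n_perpE[OF zt V] .
  obtain a where a: "(B.curve_velocity z v has_vector_derivative a) (at 0)" "B.normal z \<bullet> a = - A z t V"
    using B.curve_acceleration[OF zt(1) normal_differentiable[OF zt] v(1)] v(2) by auto
  show thesis
  proof (rule that[OF v _ _ a(1)])
    show "((\<lambda>s. g (great_circle z v s, t)) has_vector_derivative B.curve_velocity z v s) (at s)" for s
      using B.curve_derivative[OF zt(1) v(1)] by (simp add: B.curve_def[abs_def])
    show "B.curve_velocity z v 0 = V" using v(2) by simp
    show "n z t \<bullet> a = - A z t V" using a(2) by (simp only: normal_eq[OF zt(2)])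
  qed
qed

lemma continuous_n_compose:
  assumes "continuous_on S f" "continuous_on S h" "\<And>s. s \<in> S \<Longrightarrow> f s \<in> sphere 0 1" "\<And>s. s \<in> S \<Longrightarrow> h s \<in> {t0..<T}"
  shows "continuous_on S (\<lambda>s. n (f s) (h s))"
proof -
  have "(\<lambda>s. (f s, h s)) ` S \<subseteq> sphere 0 1 \<times> {t0..<T}" using assms(3,4) by blast
  from continuous_on_compose2[OF continuous_n continuous_on_Pair[OF assms(1,2)] this] show ?thesis by simp
qed

lemma continuous_g_compose:
  assumes "continuous_on S f" "continuous_on S h" "\<And>s. s \<in> S \<Longrightarrow> f s \<in> sphere 0 1" "\<And>s. s \<in> S \<Longrightarrow> h s \<in> {t0..<T}"
  shows "continuous_on S (\<lambda>s. g (f s, h s))"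
proof -
  have "(\<lambda>s. (f s, h s)) ` S \<subseteq> sphere 0 1 \<times> {t0..<T}" using assms(3,4) by blast
  from continuous_on_compose2[OF continuous_g continuous_on_Pair[OF assms(1,2)] this] show ?thesis by simp
qed

lemma n_along_great_circle:
  assumes zt: "z \<in> sphere 0 1" "t \<in> {t0..<T}" and v: "z \<bullet> v = 0"
  shows "((\<lambda>s. n (great_circle z v s) t) \<longlongrightarrow> n z t) (at 0)"
proof -
  have "continuous_on UNIV (great_circle z v)"
    by (intro continuous_at_imp_continuous_on ballI has_vector_derivative_continuous[OF has_vector_derivative_great_circle])
  then have "continuous_on UNIV (\<lambda>s. n (great_circle z v s) t)"
    by (rule continuous_n_compose) (use great_circle_in_sphere[OF zt(1) v] zt in auto)
  then have "isCont (\<lambda>s. n (great_circle z v s) t) 0" by (simp add: continuous_on_eq_continuous_at)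
  then show ?thesis by (simp add: isCont_def)
qed

text \<open>The second-order condition for three hypersurfaces touching at parallel tangent planes. The velocities
  \<open>a e\<close>, \<open>b e\<close> and \<open>(r a + (1 - r) b) e / l\<close> are chosen to keep the difference vector stationary,
  so that only the position, and not the derivative, of the normal enters.\<close>

lemma touching_second_order:
  assumes 0: "z0 \<in> sphere 0 1" "s0 \<in> {t0..<T}" and 1: "z1 \<in> sphere 0 1" "s1 \<in> {t0..<T}"
    and 2: "z2 \<in> sphere 0 1" "s2 \<in> {t0..<T}" and "l > 0"
    and eq: "n z1 s1 = n z0 s0" "n z2 s2 = n z0 s0"
    and touch: "l *\<^sub>R (g (z0, s0) - c) - r *\<^sub>R (g (z1, s1) - c) - (1 - r) *\<^sub>R (g (z2, s2) - c) = 0"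
    and pos: "\<And>y0 y1 y2. y0 \<in> sphere 0 1 \<Longrightarrow> y1 \<in> sphere 0 1 \<Longrightarrow> y2 \<in> sphere 0 1 \<Longrightarrow>
      0 \<le> n y0 s0 \<bullet> (l *\<^sub>R (g (y0, s0) - c) - r *\<^sub>R (g (y1, s1) - c) - (1 - r) *\<^sub>R (g (y2, s2) - c))"
  shows "(r * a + (1 - r) * b)\<^sup>2 / l * H z0 s0 \<le> r * a\<^sup>2 * H z1 s1 + (1 - r) * b\<^sup>2 * H z2 s2"
proof -
  let ?p = "r * a + (1 - r) * b"
  have "?p\<^sup>2 / l * A z0 s0 e \<le> r * a\<^sup>2 * A z1 s1 e + (1 - r) * b\<^sup>2 * A z2 s2 e"
    if e: "n z0 s0 \<bullet> e = 0" for e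
  proof -
    obtain v0 c0' a0 where c0: "z0 \<bullet> v0 = 0" "(?p / l) *\<^sub>R e = dg (z0, s0) (v0, 0)"
      "\<And>s. ((\<lambda>s. g (great_circle z0 v0 s, s0)) has_vector_derivative c0' s) (at s)"
      "c0' 0 = (?p / l) *\<^sub>R e" "(c0' has_vector_derivative a0) (at 0)" "n z0 s0 \<bullet> a0 = - A z0 s0 ((?p / l) *\<^sub>R e)"
      using curve_in_frontier[OF 0, of "(?p / l) *\<^sub>R e"] e by auto
    obtain v1 c1' a1 where c1: "z1 \<bullet> v1 = 0" "a *\<^sub>R e = dg (z1, s1) (v1, 0)"
      "\<And>s. ((\<lambda>s. g (great_circle z1 v1 s, s1)) has_vector_derivative c1' s) (at s)"
      "c1' 0 = a *\<^sub>R e" "(c1' has_vector_derivative a1) (at 0)" "n z1 s1 \<bullet> a1 = - A z1 s1 (a *\<^sub>R e)"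
      using curve_in_frontier[OF 1, of "a *\<^sub>R e"] e eq by auto
    obtain v2 c2' a2 where c2: "z2 \<bullet> v2 = 0" "b *\<^sub>R e = dg (z2, s2) (v2, 0)"
      "\<And>s. ((\<lambda>s. g (great_circle z2 v2 s, s2)) has_vector_derivative c2' s) (at s)"
      "c2' 0 = b *\<^sub>R e" "(c2' has_vector_derivative a2) (at 0)" "n z2 s2 \<bullet> a2 = - A z2 s2 (b *\<^sub>R e)"
      using curve_in_frontier[OF 2, of "b *\<^sub>R e"] e eq by auto
    have "0 \<le> n z0 s0 \<bullet> (l *\<^sub>R a0 - r *\<^sub>R a1 - (1 - r) *\<^sub>R a2)"
    proof (rule second_order_nonneg)
      let ?E = "\<lambda>s. l *\<^sub>R (g (great_circle z0 v0 s, s0) - c) - r *\<^sub>R (g (great_circle z1 v1 s, s1) - c)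
        - (1 - r) *\<^sub>R (g (great_circle z2 v2 s, s2) - c)"
      show "(?E has_vector_derivative (l *\<^sub>R c0' s - r *\<^sub>R c1' s - (1 - r) *\<^sub>R c2' s)) (at s)" for s
        by (auto intro!: derivative_eq_intros c0(3) c1(3) c2(3))
      show "((\<lambda>s. l *\<^sub>R c0' s - r *\<^sub>R c1' s - (1 - r) *\<^sub>R c2' s) has_vector_derivative
          (l *\<^sub>R a0 - r *\<^sub>R a1 - (1 - r) *\<^sub>R a2)) (at 0)"
        by (auto intro!: derivative_eq_intros c0(5) c1(5) c2(5))
      show "?E 0 = 0" using touch by simp
      show "l *\<^sub>R c0' 0 - r *\<^sub>R c1' 0 - (1 - r) *\<^sub>R c2' 0 = 0"
        using \<open>l > 0\<close> by (simp add: c0(4) c1(4) c2(4) scaleR_left_distrib)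
      show "((\<lambda>s. n (great_circle z0 v0 s) s0) \<longlongrightarrow> n z0 s0) (at 0)"
        by (rule n_along_great_circle[OF 0 c0(1)])
      show "0 \<le> n (great_circle z0 v0 s) s0 \<bullet> ?E s" for s
        by (intro pos great_circle_in_sphere 0 1 2 c0(1) c1(1) c2(1))
    qed
    then have "0 \<le> l * (n z0 s0 \<bullet> a0) - r * (n z1 s1 \<bullet> a1) - (1 - r) * (n z2 s2 \<bullet> a2)"
      by (simp add: inner_diff_right eq)
    then have "0 \<le> - (l * ((?p / l)\<^sup>2 * A z0 s0 e)) + r * (a\<^sup>2 * A z1 s1 e) + (1 - r) * (b\<^sup>2 * A z2 s2 e)"
      unfolding c0(6) c1(6) c2(6) A_scale[OF 0] A_scale[OF 1] A_scale[OF 2] by simp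
    moreover have "l * (?p / l)\<^sup>2 = ?p\<^sup>2 / l" using \<open>l > 0\<close> by (simp add: power2_eq_square)
    ultimately show ?thesis by (simp add: mult.assoc[symmetric])
  qed
  \<comment> \<open>The three normals coincide, so one basis serves all three points and summation
    turns second fundamental forms into mean curvatures.\<close>
  then have "(\<Sum>e\<in>tangent_basis (n z0 s0). ?p\<^sup>2 / l * A z0 s0 e) \<le>
      (\<Sum>e\<in>tangent_basis (n z0 s0). r * a\<^sup>2 * A z1 s1 e + (1 - r) * b\<^sup>2 * A z2 s2 e)"
    by (intro sum_mono) (auto intro: tangent_basis(6))
  then show ?thesis
    unfolding mean_curvature_sum[OF 0] mean_curvature_sum[OF 1] mean_curvature_sum[OF 2] eq
    by (simp add: sum_distrib_left sum.distrib)
qed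

text \<open>Inverse of the substitution \<open>\<tau> = sqrt (2 * (t - t0))\<close>; as a polynomial
  it is differentiable at 0, where the root is not.\<close>

definition tm :: "real \<Rightarrow> real" where "tm \<tau> = t0 + \<tau>\<^sup>2 / 2"

lemma tm_mono: "0 \<le> \<sigma> \<Longrightarrow> \<sigma> \<le> \<tau> \<Longrightarrow> tm \<sigma> \<le> tm \<tau>"
  by (simp add: tm_def power_mono)

lemma tm_in: "0 \<le> \<sigma> \<Longrightarrow> \<sigma> \<le> \<tau> \<Longrightarrow> tm \<tau> < T \<Longrightarrow> tm \<sigma> \<in> {t0..<T}"
proof -
  assume *: "0 \<le> \<sigma>" "\<sigma> \<le> \<tau>" "tm \<tau> < T"
  have "t0 \<le> tm \<sigma>" by (simp add: tm_def)
  with tm_mono[OF *(1,2)] *(3) show ?thesis by simp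
qed

lemma g_tm:
  assumes "z \<in> sphere 0 1" "tm \<tau> \<in> {t0..<T}"
  shows "((\<lambda>\<tau>. g (z, tm \<tau>)) has_vector_derivative - (\<tau> * H z (tm \<tau>)) *\<^sub>R n z (tm \<tau>)) (at \<tau>)"
proof -
  have "(tm has_vector_derivative \<tau>) (at \<tau>)"
    unfolding tm_def[abs_def] by (auto intro!: derivative_eq_intros simp flip: has_real_derivative_iff_has_vector_derivative)
  from vector_diff_chain_at[OF this g_time[OF in_U[OF assms]]] show ?thesis
    by (simp add: o_def speed[OF assms])
qed

text \<open>The first-order condition: only a decrease of the time parameter of the inner hypersurface is used, which
  is why no information at the final time is needed.\<close>

lemma touching_first_order:
  assumes z0: "z0 \<in> sphere 0 1" and z1: "z1 \<in> sphere 0 1" and \<tau>: "\<tau>0 > 0" "tm \<tau>0 < T" "\<tau>1 \<ge> 0" "tm \<tau>1 < T"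
    and "\<rho> > 0" and eq: "n z1 (tm \<tau>1) = n z0 (tm \<tau>0)"
    and touch: "l *\<^sub>R (g (z0, tm \<tau>0) - c) - \<rho> *\<^sub>R (g (z1, tm \<tau>1) - c) - w = 0"
    and pos: "\<And>h. 0 < h \<Longrightarrow> \<rho> * h \<le> \<tau>0 \<Longrightarrow> h \<le> \<tau>1 \<Longrightarrow>
      0 \<le> n z0 (tm (\<tau>0 - \<rho> * h)) \<bullet> ((l - \<epsilon> * \<rho> * h) *\<^sub>R (g (z0, tm (\<tau>0 - \<rho> * h)) - c)
        - \<rho> *\<^sub>R (g (z1, tm (\<tau>1 - h)) - c) - w)"
  shows "\<tau>1 * (\<tau>1 * H z1 (tm \<tau>1)) \<le>
    \<tau>1 * (l * \<tau>0 * H z0 (tm \<tau>0) - \<epsilon> * (n z0 (tm \<tau>0) \<bullet> (g (z0, tm \<tau>0) - c)))"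
proof (cases "\<tau>1 = 0")
  \<comment> \<open>For \<open>\<tau>1 = 0\<close> the time cannot be decreased; the factor
    \<open>\<tau>1\<close> in the claim makes that case trivial.\<close>
  case False
  let ?\<nu> = "n z0 (tm \<tau>0)" and ?H0 = "H z0 (tm \<tau>0)" and ?H1 = "H z1 (tm \<tau>1)"
  let ?E = "\<lambda>h. (l - \<epsilon> * \<rho> * h) *\<^sub>R (g (z0, tm (\<tau>0 - \<rho> * h)) - c) - \<rho> *\<^sub>R (g (z1, tm (\<tau>1 - h)) - c) - w"
  \<comment> \<open>The derivative of the gap when \<open>\<tau>0\<close> is lowered by
    \<open>\<rho> * h\<close> and \<open>\<tau>1\<close> by \<open>h\<close>, which leaves the
    weighted difference \<open>\<rho> * \<tau>1 - \<tau>0\<close> unchanged. The first term comes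
    from the dilation factor.\<close>
  define E' where "E' = - (\<epsilon> * \<rho>) *\<^sub>R (g (z0, tm \<tau>0) - c) + (l * \<rho> * (\<tau>0 * ?H0)) *\<^sub>R ?\<nu> - (\<rho> * (\<tau>1 * ?H1)) *\<^sub>R ?\<nu>"
  have I: "tm \<tau>0 \<in> {t0..<T}" "tm \<tau>1 \<in> {t0..<T}" using \<tau> by (auto simp: tm_def)
  have d0: "((\<lambda>h. g (z0, tm (\<tau>0 - \<rho> * h))) has_vector_derivative (- \<rho>) *\<^sub>R (- (\<tau>0 * ?H0) *\<^sub>R ?\<nu>)) (at 0)"
  proof -
    have "((\<lambda>h. \<tau>0 - \<rho> * h) has_vector_derivative - \<rho>) (at 0)"
      by (auto intro!: derivative_eq_intros)
    from vector_diff_chain_at[OF this, of "\<lambda>\<tau>. g (z0, tm \<tau>)" "- (\<tau>0 * ?H0) *\<^sub>R ?\<nu>"] g_tm[OF z0 I(1)] show ?thesis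
      by (simp add: o_def)
  qed
  have d1: "((\<lambda>h. g (z1, tm (\<tau>1 - h))) has_vector_derivative (- 1) *\<^sub>R (- (\<tau>1 * ?H1) *\<^sub>R ?\<nu>)) (at 0)"
  proof -
    have "((\<lambda>h. \<tau>1 - h) has_vector_derivative - 1) (at 0)"
      by (auto intro!: derivative_eq_intros)
    from vector_diff_chain_at[OF this, of "\<lambda>\<tau>. g (z1, tm \<tau>)" "- (\<tau>1 * ?H1) *\<^sub>R ?\<nu>"] g_tm[OF z1 I(2)] show ?thesis
      by (simp add: o_def eq)
  qed
  have "((\<lambda>h. l - \<epsilon> * \<rho> * h) has_real_derivative - (\<epsilon> * \<rho>)) (at 0)"
    by (auto intro!: derivative_eq_intros)
  from has_vector_derivative_scaleR[OF this has_vector_derivative_diff[OF d0 has_vector_derivative_const[of c]]]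
  have d: "((\<lambda>h. (l - \<epsilon> * \<rho> * h) *\<^sub>R (g (z0, tm (\<tau>0 - \<rho> * h)) - c)) has_vector_derivative
      l *\<^sub>R ((- \<rho>) *\<^sub>R (- (\<tau>0 * ?H0) *\<^sub>R ?\<nu>)) + - (\<epsilon> * \<rho>) *\<^sub>R (g (z0, tm \<tau>0) - c)) (at 0)"
    by simp
  have "((\<lambda>h. \<rho> *\<^sub>R (g (z1, tm (\<tau>1 - h)) - c)) has_vector_derivative
      \<rho> *\<^sub>R ((- 1) *\<^sub>R (- (\<tau>1 * ?H1) *\<^sub>R ?\<nu>))) (at 0)"
    by (auto intro!: derivative_eq_intros d1)
  from has_vector_derivative_diff[OF has_vector_derivative_diff[OF d this] has_vector_derivative_const[of w]]
  have "(?E has_vector_derivative E') (at 0)"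
    unfolding E'_def by (simp add: algebra_simps)
  then have "((\<lambda>h. (?E h - ?E 0) /\<^sub>R h) \<longlongrightarrow> E') (at_right 0)"
    by (rule has_vector_derivative_right_quotient)
  moreover have "?E 0 = 0" using touch by simp
  ultimately have lim: "((\<lambda>h. ?E h /\<^sub>R h) \<longlongrightarrow> E') (at_right 0)" by simp
  \<comment> \<open>For \<open>h\<close> up to \<delta> both time parameters stay
    nonnegative.\<close>
  define \<delta> where "\<delta> = min (\<tau>0 / \<rho>) \<tau>1"
  have \<delta>: "\<delta> > 0" using \<tau> False \<open>\<rho> > 0\<close> by (simp add: \<delta>_def)
  have small: "\<rho> * h \<le> \<tau>0" "h \<le> \<tau>1" if "h \<le> \<delta>" for h
    using that \<open>\<rho> > 0\<close> by (simp_all add: \<delta>_def field_simps)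
  have "continuous_on {0..\<delta>} (\<lambda>h. n z0 (tm (\<tau>0 - \<rho> * h)))"
  proof (rule continuous_n_compose)
    show "continuous_on {0..\<delta>} (\<lambda>h. tm (\<tau>0 - \<rho> * h))" unfolding tm_def by (intro continuous_intros) auto
    show "tm (\<tau>0 - \<rho> * h) \<in> {t0..<T}" if "h \<in> {0..\<delta>}" for h
      using small[of h] that \<open>\<rho> > 0\<close> \<tau> by (intro tm_in[of _ \<tau>0]) auto
  qed (use z0 in auto)
  then have "((\<lambda>h. n z0 (tm (\<tau>0 - \<rho> * h))) \<longlongrightarrow> n z0 (tm (\<tau>0 - \<rho> * 0))) (at 0 within {0..\<delta>})"
    using \<delta> unfolding continuous_on_def by (metis atLeastAtMost_iff less_imp_le order_refl)
  then have "((\<lambda>h. n z0 (tm (\<tau>0 - \<rho> * h))) \<longlongrightarrow> ?\<nu>) (at_right 0)"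
    using \<delta> by (simp add: at_within_Icc_at_right)
  from tendsto_inner[OF this lim]
  have "0 \<le> ?\<nu> \<bullet> E'"
  proof (rule tendsto_lowerbound)
    have "0 \<le> n z0 (tm (\<tau>0 - \<rho> * h)) \<bullet> (?E h /\<^sub>R h)" if "0 < h" "h < \<delta>" for h
      using pos[of h] small[of h] that by simp
    then show "\<forall>\<^sub>F h in at_right 0. 0 \<le> n z0 (tm (\<tau>0 - \<rho> * h)) \<bullet> (?E h /\<^sub>R h)"
      using \<delta> by (auto simp: eventually_at_right_field)
  qed simp
  also have "?\<nu> \<bullet> E' = \<rho> * (l * \<tau>0 * ?H0 - \<epsilon> * (?\<nu> \<bullet> (g (z0, tm \<tau>0) - c)) - \<tau>1 * ?H1)"
    using n_n[OF z0 I(1)] by (simp add: E'_def inner_add_right inner_diff_right algebra_simps)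
  finally show ?thesis using \<open>\<rho> > 0\<close> \<tau>(3) by (intro mult_left_mono) (simp_all add: zero_le_mult_iff)
qed simp

text \<open>The concavity maximum principle. Suppose the inclusion fails. Let \<open>l = 1 + \<epsilon> (r \<tau>1 + (1 - r) \<tau>2)\<close> and, among all
  parameters for which \<open>r \<Omega>1 + (1 - r) \<Omega>2\<close> is not interior to \<open>l \<Omega>0\<close>, maximise the violation
  \<open>r \<tau>1 + (1 - r) \<tau>2 - \<tau>0\<close>. At the maximum the three boundaries touch; the first-order conditions compare the
  \<open>\<tau>i Hi\<close> (the speeds with respect to \<open>\<tau>\<close>), and these are incompatible with the second-order condition
  for the velocities \<open>\<tau>1 e\<close> and \<open>\<tau>2 e\<close>. The dilation factor \<open>l\<close> makes
  the argument work although the mean curvatures may vanish.\<close>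

theorem minkowski_concave:
  assumes \<tau>: "0 \<le> \<tau>1" "0 \<le> \<tau>2" "tm \<tau>1 < T" "tm \<tau>2 < T" and r: "0 < r" "r < 1"
    and x: "x1 \<in> \<Omega> (tm \<tau>1)" "x2 \<in> \<Omega> (tm \<tau>2)"
  shows "r *\<^sub>R x1 + (1 - r) *\<^sub>R x2 \<in> \<Omega> (tm (r * \<tau>1 + (1 - r) * \<tau>2))"
proof (rule ccontr)
  define P where "P = r *\<^sub>R x1 + (1 - r) *\<^sub>R x2"
  define p where "p = r * \<tau>1 + (1 - r) * \<tau>2"
  assume "r *\<^sub>R x1 + (1 - r) *\<^sub>R x2 \<notin> \<Omega> (tm (r * \<tau>1 + (1 - r) * \<tau>2))"
  then have neg: "P \<notin> \<Omega> (tm p)" by (simp add: P_def p_def)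
  define b where "b = max \<tau>1 \<tau>2"
  have b: "\<tau>1 \<le> b" "\<tau>2 \<le> b" "0 \<le> b" "tm b < T" using \<tau> by (auto simp: b_def max_def)
  note I = tm_in[OF _ _ b(4)]
  have avg_le: "r * u + (1 - r) * v \<le> b" if "u \<le> b" "v \<le> b" for u v
    using convex_bound_le[OF that, of r "1 - r"] r by simp
  have p: "0 \<le> p" "p \<le> b" using \<tau> r avg_le[OF b(1,2)] by (auto simp: p_def)
  \<comment> \<open>For \<open>p = 0\<close> the claim is convexity of the initial body.\<close>
  have "p \<noteq> 0"
  proof
    assume "p = 0"
    then have "\<tau>1 = 0" "\<tau>2 = 0" using \<tau> r by (auto simp: p_def add_nonneg_eq_0_iff)
    moreover have "convex (\<Omega> (tm 0))"
      using parametrized_body.convex_K[OF body[OF I[of 0]]] b by simp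
    ultimately show False using neg x r \<open>p = 0\<close> by (auto simp: P_def convex_def)
  qed
  then have "p > 0" using p by simp
  \<comment> \<open>A ball in the smallest body considered lies in all of them, so dilating about
    its centre moves every supporting plane outward by an amount bounded below.\<close>
  obtain c \<rho> where c: "\<rho> > 0" "cball c \<rho> \<subseteq> \<Omega> (tm b)"
    using parametrized_body.interior_K[OF body[OF I[OF b(3) order_refl]]] mem_interior_cball by blast
  have height: "\<rho> \<le> n z (tm s) \<bullet> (g (z, tm s) - c)" if "z \<in> sphere 0 1" "0 \<le> s" "s \<le> b" for z s
  proof -
    note i = I[OF that(2,3)]
    have "c + \<rho> *\<^sub>R n z (tm s) \<in> cball c \<rho>" using c(1) norm_n[OF that(1) i] by (simp add: dist_norm)
    also have "\<dots> \<subseteq> \<Omega> (tm s)" using mono[of "tm s" "tm b"] tm_mono[OF that(2,3)] i b(4) c(2) by auto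
    finally have "n z (tm s) \<bullet> (c + \<rho> *\<^sub>R n z (tm s)) \<le> n z (tm s) \<bullet> g (z, tm s)"
      by (rule n_support[OF that(1) i])
    then show ?thesis by (simp add: inner_add_right inner_diff_right n_n[OF that(1) i])
  qed
  obtain y0 where y0: "y0 \<in> sphere 0 1" "n y0 (tm p) \<bullet> g (y0, tm p) < n y0 (tm p) \<bullet> P"
    using neg mem_\<Omega>_iff[OF I[OF p]] by force
  \<comment> \<open>Failure is an open condition in the time of the target body: it persists at a
    slightly smaller parameter \<open>p - m\<close>, so the maximal violation will be at least
    \<open>m > 0\<close>.\<close>
  define \<phi> where "\<phi> s = n y0 (tm s) \<bullet> (g (y0, tm s) - P)" for s
  have tm_cont: "continuous_on S tm" for S
    unfolding tm_def[abs_def] by (intro continuous_intros) auto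
  have "continuous_on {0..b} \<phi>"
    unfolding \<phi>_def using y0(1) I
    by (intro continuous_intros continuous_n_compose continuous_g_compose tm_cont) auto
  then have "(\<phi> \<longlongrightarrow> \<phi> p) (at p within {0..b})" using p by (auto simp: continuous_on_def)
  moreover have "\<phi> p < 0" using y0(2) by (simp add: \<phi>_def inner_diff_right)
  ultimately have "\<forall>\<^sub>F s in at p within {0..b}. \<phi> s < 0" by (rule order_tendstoD(2))
  then obtain d where d: "d > 0" "\<And>s. s \<in> {0..b} \<Longrightarrow> s \<noteq> p \<Longrightarrow> dist s p < d \<Longrightarrow> \<phi> s < 0"
    unfolding eventually_at by blast
  define m where "m = min (d / 2) p"
  have m: "m > 0" "m \<le> p" using d(1) \<open>p > 0\<close> by (auto simp: m_def)
  have \<phi>m: "\<phi> (p - m) < 0" using m p d(1) by (intro d(2)) (auto simp: m_def dist_real_def)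
  \<comment> \<open>\<open>\<epsilon> * b \<le> 1\<close> gives \<open>l \<le> 2\<close>; the third
    condition makes the dilation cost less than the violation \<open>m\<close>; the last keeps the
    failure at \<open>p - m\<close> in spite of the dilation.\<close>
  obtain \<epsilon> where \<epsilon>: "\<epsilon> > 0" "\<epsilon> * b \<le> 1" "3 * \<epsilon> * b * b < m"
    "\<phi> (p - m) + \<epsilon> * p * (n y0 (tm (p - m)) \<bullet> (g (y0, tm (p - m)) - c)) < 0"
  proof -
    let ?k = "p * (n y0 (tm (p - m)) \<bullet> (g (y0, tm (p - m)) - c))"
    have "\<forall>\<^sub>F \<epsilon> in at_right (0::real). 0 < \<epsilon>" by (simp add: eventually_at_right_less)
    moreover have "\<forall>\<^sub>F \<epsilon> in at_right 0. \<epsilon> * b < 1"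
      by (rule order_tendstoD(2)[where y = 0]) (auto intro!: tendsto_eq_intros)
    moreover have "\<forall>\<^sub>F \<epsilon> in at_right 0. 3 * \<epsilon> * b * b < m"
      using m(1) by (intro order_tendstoD(2)[where y = 0]) (auto intro!: tendsto_eq_intros)
    moreover have "\<forall>\<^sub>F \<epsilon> in at_right 0. \<phi> (p - m) + \<epsilon> * ?k < 0"
      using \<phi>m by (intro order_tendstoD(2)[where y = "\<phi> (p - m)"]) (auto intro!: tendsto_eq_intros)
    ultimately have "\<forall>\<^sub>F \<epsilon> in at_right 0. 0 < \<epsilon> \<and> \<epsilon> * b < 1 \<and> 3 * \<epsilon> * b * b < m \<and> \<phi> (p - m) + \<epsilon> * ?k < 0"
      by eventually_elim blast
    then obtain \<epsilon> where "0 < \<epsilon> \<and> \<epsilon> * b < 1 \<and> 3 * \<epsilon> * b * b < m \<and> \<phi> (p - m) + \<epsilon> * ?k < 0"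
      using eventually_happens'[OF trivial_limit_at_right_real] by blast
    then show thesis by (intro that[of \<epsilon>]) (auto simp: mult.assoc)
  qed
  \<comment> \<open>The gap between the dilated body at \<open>s0\<close> and the combination of the
    other two, tested in the normal direction at \<open>z0\<close> by the points \<open>z1\<close>
    and \<open>z2\<close>. It is continuous on a compact set of parameters, so a maximal violation
    exists.\<close>
  define \<Phi> where "\<Phi> s0 s1 s2 z0 z1 z2 = n z0 (tm s0) \<bullet> ((1 + \<epsilon> * (r * s1 + (1 - r) * s2)) *\<^sub>R (g (z0, tm s0) - c)
      - r *\<^sub>R (g (z1, tm s1) - c) - (1 - r) *\<^sub>R (g (z2, tm s2) - c))" for s0 s1 s2 z0 z1 z2
  let ?S = "sphere 0 1 :: 'a set"
  let ?C = "({0..b} \<times> {0..b} \<times> {0..b}) \<times> (?S \<times> ?S \<times> ?S)"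
  let ?F = "\<lambda>((s0, s1, s2), (z0, z1, z2)). \<Phi> s0 s1 s2 z0 z1 z2"
  define K where "K = {x \<in> ?C. ?F x \<le> 0}"
  have "continuous_on ?C ?F"
    unfolding case_prod_beta \<Phi>_def
    by (intro continuous_intros continuous_n_compose continuous_g_compose continuous_on_compose2[OF tm_cont[of UNIV]])
      (use I in auto)
  then have "closed K"
    unfolding K_def by (intro continuous_on_closed_Collect_le continuous_intros closed_Times closed_sphere closed_atLeastAtMost)
  have "compact K"
  proof (rule compact_Int_closed[of ?C K, THEN subst[of "?C \<inter> K" K compact, rotated]])
    show "compact ?C" by (intro compact_Times compact_sphere compact_Icc)
    show "?C \<inter> K = K" unfolding K_def by blast
  qed fact
  obtain y1 where y1: "y1 \<in> ?S" "\<forall>y\<in>\<Omega> (tm \<tau>1). n y0 (tm (p - m)) \<bullet> y \<le> n y0 (tm (p - m)) \<bullet> g (y1, tm \<tau>1)"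
    using support_point[OF I[OF \<tau>(1) b(1)]] .
  obtain y2 where y2: "y2 \<in> ?S" "\<forall>y\<in>\<Omega> (tm \<tau>2). n y0 (tm (p - m)) \<bullet> y \<le> n y0 (tm (p - m)) \<bullet> g (y2, tm \<tau>2)"
    using support_point[OF I[OF \<tau>(2) b(2)]] .
  have start: "((p - m, \<tau>1, \<tau>2), (y0, y1, y2)) \<in> K"
  proof -
    let ?\<nu> = "n y0 (tm (p - m))"
    have "?\<nu> \<bullet> P \<le> r * (?\<nu> \<bullet> g (y1, tm \<tau>1)) + (1 - r) * (?\<nu> \<bullet> g (y2, tm \<tau>2))"
      unfolding P_def inner_add_right inner_scaleR_right
      using y1(2) y2(2) x r by (intro add_mono mult_left_mono) auto
    moreover have "\<Phi> (p - m) \<tau>1 \<tau>2 y0 y1 y2 = \<phi> (p - m) + \<epsilon> * p * (?\<nu> \<bullet> (g (y0, tm (p - m)) - c))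
        + ?\<nu> \<bullet> P - (r * (?\<nu> \<bullet> g (y1, tm \<tau>1)) + (1 - r) * (?\<nu> \<bullet> g (y2, tm \<tau>2)))"
      unfolding \<Phi>_def p_def[symmetric] by (simp add: \<phi>_def inner_diff_right algebra_simps)
    ultimately have "\<Phi> (p - m) \<tau>1 \<tau>2 y0 y1 y2 \<le> 0" using \<epsilon>(4) by linarith
    then show ?thesis using m p \<tau> b y0 y1 y2 by (auto simp: K_def)
  qed
  let ?J = "\<lambda>((s0, s1, s2), (z0::'a, z1::'a, z2::'a)). r * s1 + (1 - r) * s2 - s0"
  have "continuous_on K ?J" unfolding case_prod_beta by (intro continuous_intros)
  then obtain k where k: "k \<in> K" "\<And>k'. k' \<in> K \<Longrightarrow> ?J k' \<le> ?J k"
    using continuous_attains_sup[OF \<open>compact K\<close>, of ?J] start by blast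
  obtain s0 s1 s2 z0 z1 z2 where k_eq: "k = ((s0, s1, s2), (z0, z1, z2))" by (metis prod.exhaust)
  define \<mu> where "\<mu> = r * s1 + (1 - r) * s2 - s0"
  have s: "0 \<le> s0" "s0 \<le> b" "0 \<le> s1" "s1 \<le> b" "0 \<le> s2" "s2 \<le> b"
    and z: "z0 \<in> ?S" "z1 \<in> ?S" "z2 \<in> ?S" and \<Phi>k: "\<Phi> s0 s1 s2 z0 z1 z2 \<le> 0"
    using k(1) by (auto simp: k_eq K_def)
  have "\<mu> \<ge> m" using k(2)[OF start] by (simp add: k_eq \<mu>_def p_def)
  have max: "\<Phi> u0 u1 u2 w0 w1 w2 > 0"
    if "0 \<le> u0" "u0 \<le> b" "0 \<le> u1" "u1 \<le> b" "0 \<le> u2" "u2 \<le> b" "w0 \<in> ?S" "w1 \<in> ?S" "w2 \<in> ?S"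
      "r * u1 + (1 - r) * u2 - u0 > \<mu>" for u0 u1 u2 w0 w1 w2
  proof (rule ccontr)
    assume "\<not> ?thesis"
    then have "((u0, u1, u2), (w0, w1, w2)) \<in> K" using that by (auto simp: K_def)
    from k(2)[OF this] that(10) show False by (simp add: k_eq \<mu>_def)
  qed
  \<comment> \<open>All bodies lie in the initial one, so at time parameter 0 the dilation makes the
    gap strict.\<close>
  have zero: "\<Phi> 0 u1 u2 w0 w1 w2 > 0"
    if "0 \<le> u1" "u1 \<le> b" "0 \<le> u2" "u2 \<le> b" "w0 \<in> ?S" "w1 \<in> ?S" "w2 \<in> ?S"
      "r * u1 + (1 - r) * u2 > 0" for u1 u2 w0 w1 w2
  proof -
    let ?\<nu> = "n w0 (tm 0)"
    note i = I[OF order_refl b(3)]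
    have le: "?\<nu> \<bullet> g (w, tm u) \<le> ?\<nu> \<bullet> g (w0, tm 0)" if "w \<in> ?S" "0 \<le> u" "u \<le> b" for w u
      using n_support[OF \<open>w0 \<in> ?S\<close> i] g_in[OF that(1) I[OF that(2,3)]] mono[of "tm 0" "tm u"]
        tm_mono[OF _ that(2)] I[OF that(2,3)] i by auto
    have "r * (?\<nu> \<bullet> (g (w1, tm u1) - c)) + (1 - r) * (?\<nu> \<bullet> (g (w2, tm u2) - c)) \<le> ?\<nu> \<bullet> (g (w0, tm 0) - c)"
      using le[of w1 u1] le[of w2 u2] that r
      by (intro convex_bound_le) (auto simp: inner_diff_right)
    moreover have "\<epsilon> * (r * u1 + (1 - r) * u2) * (?\<nu> \<bullet> (g (w0, tm 0) - c)) > 0"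
      using height[OF that(5) order_refl b(3)] c(1) \<epsilon>(1) that(8) by (intro mult_pos_pos) auto
    moreover have "\<Phi> 0 u1 u2 w0 w1 w2 = ?\<nu> \<bullet> (g (w0, tm 0) - c) + \<epsilon> * (r * u1 + (1 - r) * u2) * (?\<nu> \<bullet> (g (w0, tm 0) - c))
        - (r * (?\<nu> \<bullet> (g (w1, tm u1) - c)) + (1 - r) * (?\<nu> \<bullet> (g (w2, tm u2) - c)))"
    proof -
      have "?\<nu> \<bullet> (k0 *\<^sub>R v0 - k1 *\<^sub>R v1 - k2 *\<^sub>R v2) = k0 * (?\<nu> \<bullet> v0) - k1 * (?\<nu> \<bullet> v1) - k2 * (?\<nu> \<bullet> v2)"
        for k0 k1 k2 v0 v1 v2 by (simp add: inner_diff_right)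
      then show ?thesis unfolding \<Phi>_def by (simp only: distrib_right mult_1 diff_diff_eq)
    qed
    ultimately show ?thesis by linarith
  qed
  \<comment> \<open>Lowering \<open>u0\<close> raises the violation above its maximum, so the gap is
    positive there; continuity in \<open>u0\<close> gives the limiting case.\<close>
  have nonneg: "\<Phi> u0 u1 u2 w0 w1 w2 \<ge> 0"
    if u: "0 \<le> u0" "u0 \<le> b" "0 \<le> u1" "u1 \<le> b" "0 \<le> u2" "u2 \<le> b" and w: "w0 \<in> ?S" "w1 \<in> ?S" "w2 \<in> ?S"
      and J: "r * u1 + (1 - r) * u2 - u0 = \<mu>" for u0 u1 u2 w0 w1 w2
  proof (cases "u0 = 0")
    case True
    then show ?thesis using zero[of u1 u2 w0 w1 w2] u w J \<open>\<mu> \<ge> m\<close> m(1) by force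
  next
    case False
    have "continuous_on {0..u0} (\<lambda>s. \<Phi> s u1 u2 w0 w1 w2)"
      unfolding \<Phi>_def
      by (intro continuous_intros continuous_n_compose continuous_g_compose tm_cont) (use w u I in auto)
    then have "((\<lambda>s. \<Phi> s u1 u2 w0 w1 w2) \<longlongrightarrow> \<Phi> u0 u1 u2 w0 w1 w2) (at u0 within {0..u0})"
      using u(1) by (auto simp: continuous_on_def)
    then have "((\<lambda>s. \<Phi> s u1 u2 w0 w1 w2) \<longlongrightarrow> \<Phi> u0 u1 u2 w0 w1 w2) (at_left u0)"
      using u(1) False by (simp add: at_within_Icc_at_left)
    then show ?thesis
    proof (rule tendsto_lowerbound)
      have "0 \<le> \<Phi> s u1 u2 w0 w1 w2" if "0 < s" "s < u0" for s
        using max[of s u1 u2 w0 w1 w2] that u w J by force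
      then show "\<forall>\<^sub>F s in at_left u0. 0 \<le> \<Phi> s u1 u2 w0 w1 w2"
        using u(1) False by (auto simp: eventually_at_left_field intro!: exI[of _ 0])
    qed simp
  qed
  have "s0 > 0"
  proof (rule ccontr)
    assume "\<not> s0 > 0"
    then have "s0 = 0" using s(1) by simp
    then show False using zero[of s1 s2 z0 z1 z2] s z \<open>\<mu> \<ge> m\<close> m(1) \<Phi>k by (auto simp: \<mu>_def)
  qed
  define q where "q = r * s1 + (1 - r) * s2"
  define l where "l = 1 + \<epsilon> * q"
  have q: "q = s0 + \<mu>" "q > 0" "q \<le> b"
    using \<open>s0 > 0\<close> \<open>\<mu> \<ge> m\<close> m(1) avg_le[OF s(4,6)] by (auto simp: q_def \<mu>_def)
  have l: "l > 1" using \<epsilon>(1) q(2) by (simp add: l_def)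
  note i0 = I[OF s(1,2)] and i1 = I[OF s(3,4)] and i2 = I[OF s(5,6)]
  have J: "r * s1 + (1 - r) * s2 - s0 = \<mu>" by (simp add: \<mu>_def)
  have \<Phi>0: "\<Phi> s0 s1 s2 z0 z1 z2 = 0" using nonneg[OF s z J] \<Phi>k by simp
  define G0 G1 G2 where "G0 w = g (w, tm s0) - c" and "G1 w = g (w, tm s1) - c" and "G2 w = g (w, tm s2) - c" for w
  have \<Phi>_eq: "\<Phi> s0 s1 s2 w0 w1 w2 = n w0 (tm s0) \<bullet> (l *\<^sub>R G0 w0 - r *\<^sub>R G1 w1 - (1 - r) *\<^sub>R G2 w2)" for w0 w1 w2
    by (simp add: \<Phi>_def G0_def G1_def G2_def l_def q_def)
  \<comment> \<open>The combination of the two points at \<open>z1\<close> and \<open>z2\<close>,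
    scaled back by \<open>l\<close>. It satisfies all support inequalities of the body at
    \<open>s0\<close>, with equality in the direction at \<open>z0\<close>, so it is a boundary
    point. As a supporting plane may touch along a face, it can differ from
    \<open>g (z0, tm s0)\<close>, and \<open>z0'\<close> replaces \<open>z0\<close>.\<close>
  define Q where "Q = c + (r *\<^sub>R G1 z1 + (1 - r) *\<^sub>R G2 z2) /\<^sub>R l"
  have Q_eq: "n w (tm s0) \<bullet> Q = n w (tm s0) \<bullet> g (w, tm s0) - \<Phi> s0 s1 s2 w z1 z2 / l" for w
    using l by (simp add: Q_def \<Phi>_eq G0_def inner_add_right inner_diff_right field_simps)
  have Q_in: "Q \<in> \<Omega> (tm s0)"
    unfolding mem_\<Omega>_iff[OF i0] using nonneg[OF s _ z(2,3) J] l by (simp add: Q_eq)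
  have sup: "\<forall>y\<in>\<Omega> (tm s0). n z0 (tm s0) \<bullet> y \<le> n z0 (tm s0) \<bullet> Q"
    using n_support[OF z(1) i0] by (simp add: Q_eq \<Phi>0)
  interpret B: parametrized_body "\<Omega> (tm s0)" "\<lambda>z. g (z, tm s0)" "\<lambda>z v. dg (z, tm s0) (v, 0)"
    by (rule body[OF i0])
  obtain z0' where z0': "z0' \<in> ?S" "Q = g (z0', tm s0)"
    using B.frontierE[OF B.frontier_iff[OF Q_in norm_n[OF z(1) i0] sup]] by blast
  define \<nu> where "\<nu> = n z0 (tm s0)"
  have n0: "n z0' (tm s0) = \<nu>"
    unfolding \<nu>_def using sup z0'(2) by (intro n_unique[OF z0'(1) i0] norm_n[OF z(1) i0]) simp
  have touch: "l *\<^sub>R G0 z0' - r *\<^sub>R G1 z1 - (1 - r) *\<^sub>R G2 z2 = 0"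
  proof -
    have "G0 z0' = (r *\<^sub>R G1 z1 + (1 - r) *\<^sub>R G2 z2) /\<^sub>R l"
      by (simp only: G0_def z0'(2)[symmetric] Q_def add_diff_cancel_left')
    then have "l *\<^sub>R G0 z0' = r *\<^sub>R G1 z1 + (1 - r) *\<^sub>R G2 z2"
      using l by (simp only: scaleR_scaleR) simp
    then show ?thesis by simp
  qed
  \<comment> \<open>Moving the second point alone keeps the gap nonnegative, so \<open>z1\<close>
    has maximal height in direction \<nu> on its body.\<close>
  have n1: "n z1 (tm s1) = n z0' (tm s0)"
    unfolding n0
  proof (rule n_eqI[OF z(2) i1])
    fix w assume w: "w \<in> ?S"
    have "0 \<le> \<nu> \<bullet> (l *\<^sub>R G0 z0' - r *\<^sub>R G1 w - (1 - r) *\<^sub>R G2 z2)"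
      using nonneg[OF s z0'(1) w z(3) J] by (simp add: \<Phi>_eq n0)
    also have "l *\<^sub>R G0 z0' - r *\<^sub>R G1 w - (1 - r) *\<^sub>R G2 z2 = r *\<^sub>R (G1 z1 - G1 w)"
      using touch by (simp add: algebra_simps)
    finally show "\<nu> \<bullet> g (w, tm s1) \<le> \<nu> \<bullet> g (z1, tm s1)"
      using r(1) by (simp add: G1_def inner_diff_right zero_le_mult_iff)
  qed (simp add: \<nu>_def norm_n[OF z(1) i0])
  have n2: "n z2 (tm s2) = n z0' (tm s0)"
    unfolding n0
  proof (rule n_eqI[OF z(3) i2])
    fix w assume w: "w \<in> ?S"
    have "0 \<le> \<nu> \<bullet> (l *\<^sub>R G0 z0' - r *\<^sub>R G1 z1 - (1 - r) *\<^sub>R G2 w)"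
      using nonneg[OF s z0'(1) z(2) w J] by (simp add: \<Phi>_eq n0)
    also have "l *\<^sub>R G0 z0' - r *\<^sub>R G1 z1 - (1 - r) *\<^sub>R G2 w = (1 - r) *\<^sub>R (G2 z2 - G2 w)"
      using touch by (simp add: algebra_simps)
    finally show "\<nu> \<bullet> g (w, tm s2) \<le> \<nu> \<bullet> g (z2, tm s2)"
      using r(2) by (simp add: G2_def inner_diff_right zero_le_mult_iff)
  qed (simp add: \<nu>_def norm_n[OF z(1) i0])
  let ?H0 = "H z0' (tm s0)" and ?H1 = "H z1 (tm s1)" and ?H2 = "H z2 (tm s2)"
  \<comment> \<open>A common bound for the two speeds; the \<epsilon>-term makes it strictly smaller
    than \<open>l * s0 * ?H0\<close>.\<close>
  define D where "D = l * s0 * ?H0 - \<epsilon> * (n z0' (tm s0) \<bullet> (g (z0', tm s0) - c))"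
  have 1: "s1 * (s1 * ?H1) \<le> s1 * D"
    unfolding D_def
  proof (rule touching_first_order[OF z0'(1) z(2) \<open>s0 > 0\<close> _ _ _ r(1) n1])
    show "l *\<^sub>R (g (z0', tm s0) - c) - r *\<^sub>R (g (z1, tm s1) - c) - (1 - r) *\<^sub>R G2 z2 = 0"
      using touch by (simp add: G0_def G1_def)
    fix h assume h: "0 < h" "r * h \<le> s0" "h \<le> s1"
    have "0 \<le> \<Phi> (s0 - r * h) (s1 - h) s2 z0' z1 z2"
    proof (rule nonneg[OF _ _ _ _ s(5,6) z0'(1) z(2,3)])
      show "0 \<le> s0 - r * h" "s0 - r * h \<le> b" "0 \<le> s1 - h" "s1 - h \<le> b"
        using h s mult_pos_pos[OF r(1) h(1)] by linarith+
      show "r * (s1 - h) + (1 - r) * s2 - (s0 - r * h) = \<mu>" using J by (simp add: algebra_simps)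
    qed
    moreover have "1 + \<epsilon> * (r * (s1 - h) + (1 - r) * s2) = l - \<epsilon> * r * h"
      by (simp add: l_def q_def algebra_simps)
    ultimately show "0 \<le> n z0' (tm (s0 - r * h)) \<bullet> ((l - \<epsilon> * r * h) *\<^sub>R (g (z0', tm (s0 - r * h)) - c)
        - r *\<^sub>R (g (z1, tm (s1 - h)) - c) - (1 - r) *\<^sub>R G2 z2)"
      by (simp only: \<Phi>_def G2_def)
  qed (use s i0 i1 in auto)
  have 2: "s2 * (s2 * ?H2) \<le> s2 * D"
    unfolding D_def
  proof (rule touching_first_order[OF z0'(1) z(3) \<open>s0 > 0\<close> _ _ _ _ n2])
    show "l *\<^sub>R (g (z0', tm s0) - c) - (1 - r) *\<^sub>R (g (z2, tm s2) - c) - r *\<^sub>R G1 z1 = 0"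
      using touch by (simp add: G0_def G2_def algebra_simps)
    fix h assume h: "0 < h" "(1 - r) * h \<le> s0" "h \<le> s2"
    have r1: "0 < 1 - r" using r by simp
    have "0 \<le> \<Phi> (s0 - (1 - r) * h) s1 (s2 - h) z0' z1 z2"
    proof (rule nonneg[OF _ _ s(3,4) _ _ z0'(1) z(2,3)])
      show "0 \<le> s0 - (1 - r) * h" "s0 - (1 - r) * h \<le> b" "0 \<le> s2 - h" "s2 - h \<le> b"
        using h s mult_pos_pos[OF r1 h(1)] by linarith+
      show "r * s1 + (1 - r) * (s2 - h) - (s0 - (1 - r) * h) = \<mu>" using J by (simp add: algebra_simps)
    qed
    moreover have "1 + \<epsilon> * (r * s1 + (1 - r) * (s2 - h)) = l - \<epsilon> * (1 - r) * h"
      by (simp add: l_def q_def algebra_simps)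
    ultimately have "0 \<le> n z0' (tm (s0 - (1 - r) * h)) \<bullet> ((l - \<epsilon> * (1 - r) * h) *\<^sub>R (g (z0', tm (s0 - (1 - r) * h)) - c)
        - r *\<^sub>R G1 z1 - (1 - r) *\<^sub>R (g (z2, tm (s2 - h)) - c))"
      by (simp only: \<Phi>_def G1_def)
    then show "0 \<le> n z0' (tm (s0 - (1 - r) * h)) \<bullet> ((l - \<epsilon> * (1 - r) * h) *\<^sub>R (g (z0', tm (s0 - (1 - r) * h)) - c)
        - (1 - r) *\<^sub>R (g (z2, tm (s2 - h)) - c) - r *\<^sub>R G1 z1)"
      by (simp only: diff_diff_eq add.commute)
  qed (use s i0 i2 r in auto)
  have "q\<^sup>2 / l * ?H0 \<le> r * s1\<^sup>2 * ?H1 + (1 - r) * s2\<^sup>2 * ?H2"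
    unfolding q_def
  proof (rule touching_second_order[OF z0'(1) i0 z(2) i1 z(3) i2 _ n1 n2])
    show "0 < l" using l by simp
    show "l *\<^sub>R (g (z0', tm s0) - c) - r *\<^sub>R (g (z1, tm s1) - c) - (1 - r) *\<^sub>R (g (z2, tm s2) - c) = 0"
      using touch by (simp add: G0_def G1_def G2_def)
    show "0 \<le> n w0 (tm s0) \<bullet> (l *\<^sub>R (g (w0, tm s0) - c) - r *\<^sub>R (g (w1, tm s1) - c) - (1 - r) *\<^sub>R (g (w2, tm s2) - c))"
      if "w0 \<in> ?S" "w1 \<in> ?S" "w2 \<in> ?S" for w0 w1 w2
      using nonneg[OF s that J] by (simp add: \<Phi>_eq G0_def G1_def G2_def)
  qed
  also have "\<dots> = r * (s1 * (s1 * ?H1)) + (1 - r) * (s2 * (s2 * ?H2))" by (simp add: power2_eq_square mult.assoc)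
  also have "\<dots> \<le> r * (s1 * D) + (1 - r) * (s2 * D)"
    using r by (intro add_mono mult_left_mono[OF 1] mult_left_mono[OF 2]) auto
  also have "\<dots> = q * D" by (simp add: q_def algebra_simps)
  finally have "q * (q * ?H0 / l) \<le> q * D" by (simp add: power2_eq_square)
  then have "q * ?H0 / l \<le> D" by (rule mult_left_le_imp_le) (rule q(2))
  moreover have "\<epsilon> * (n z0' (tm s0) \<bullet> (g (z0', tm s0) - c)) > 0"
    using \<epsilon>(1) c(1) height[OF z0'(1) s(1,2)] by (intro mult_pos_pos) auto
  ultimately have "q * ?H0 / l < l * s0 * ?H0" by (simp add: D_def)
  \<comment> \<open>The inequality is strict and its common factor \<open>?H0\<close> is
    nonnegative, so it can be cancelled without prior knowledge of positivity.\<close>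
  then have "q * ?H0 < l * l * s0 * ?H0" using l by (simp add: field_simps)
  then have "q < l * l * s0" by (rule mult_right_less_imp_less) (rule H_nonneg[OF z0'(1) i0])
  \<comment> \<open>\<open>l * l\<close> is at most \<open>1 + 3 * (\<epsilon> * b)\<close>, so the
    dilation raises \<open>s0\<close> by less than \<open>m\<close>, hence by less than the
    violation \<open>q - s0\<close>.\<close>
  moreover have "l * l * s0 \<le> q"
  proof -
    have e1: "0 \<le> \<epsilon> * q" using \<epsilon>(1) q(2) by (intro mult_nonneg_nonneg) auto
    have e2: "\<epsilon> * q \<le> \<epsilon> * b" using \<epsilon>(1) by (intro mult_left_mono q(3)) auto
    note e = e1 e2 order_trans[OF e2 \<epsilon>(2)]
    have "l * l = 1 + (2 + \<epsilon> * q) * (\<epsilon> * q)" by (simp add: l_def algebra_simps)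
    also have "\<dots> \<le> 1 + 3 * (\<epsilon> * b)" using e by (intro add_left_mono mult_mono[OF _ e2]) auto
    finally have "l * l * s0 \<le> (1 + 3 * (\<epsilon> * b)) * s0" using s(1) by (rule mult_right_mono)
    also have "\<dots> \<le> s0 + 3 * \<epsilon> * b * b"
      using mult_left_mono[OF s(2), of "3 * \<epsilon> * b"] \<epsilon>(1) b(3) by (simp add: distrib_right mult.assoc)
    also have "\<dots> \<le> q" using \<epsilon>(3) \<open>\<mu> \<ge> m\<close> q(1) by simp
    finally show ?thesis .
  qed
  ultimately show False by simp
qed

subsection \<open>The Harnack inequality\<close>

text \<open>A chain rule for functions differentiable only within the parameter domain; on the open
  set \<open>J\<close> the path stays in it, so the result is a two-sided derivative.\<close>

lemma derivative_along_path:
  fixes F :: "'a \<times> real \<Rightarrow> 'b::real_normed_vector"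
  assumes F: "(F has_derivative D) (at (\<zeta> s, \<theta> s) within sphere 0 1 \<times> {t0..<T})"
    and "(\<zeta> has_vector_derivative \<zeta>') (at s)" "(\<theta> has_vector_derivative \<theta>') (at s)"
    and J: "open J" "s \<in> J" "\<And>r. r \<in> J \<Longrightarrow> \<zeta> r \<in> sphere 0 1" "\<And>r. r \<in> J \<Longrightarrow> \<theta> r \<in> {t0..<T}"
  shows "((\<lambda>s. F (\<zeta> s, \<theta> s)) has_vector_derivative D (\<zeta>', \<theta>')) (at s)"
proof -
  have "((\<lambda>s. (\<zeta> s, \<theta> s)) has_derivative (\<lambda>h. (h *\<^sub>R \<zeta>', h *\<^sub>R \<theta>'))) (at s within J)"
    using has_derivative_Pair[OF assms(2,3)[unfolded has_vector_derivative_def]]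
    by (rule has_derivative_at_withinI)
  moreover have "(F has_derivative D) (at (\<zeta> s, \<theta> s) within (\<lambda>s. (\<zeta> s, \<theta> s)) ` J)"
    by (rule has_derivative_subset[OF F]) (use J(3,4) in blast)
  ultimately have chain: "(F \<circ> (\<lambda>s. (\<zeta> s, \<theta> s)) has_derivative D \<circ> (\<lambda>h. (h *\<^sub>R \<zeta>', h *\<^sub>R \<theta>'))) (at s within J)"
    by (rule diff_chain_within)
  have eq: "D \<circ> (\<lambda>h. (h *\<^sub>R \<zeta>', h *\<^sub>R \<theta>')) = (\<lambda>h. h *\<^sub>R D (\<zeta>', \<theta>'))"
  proof
    fix h
    have "D (h *\<^sub>R (\<zeta>', \<theta>')) = h *\<^sub>R D (\<zeta>', \<theta>')"
      by (rule linear_cmul[OF has_derivative_linear[OF F]])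
    then show "(D \<circ> (\<lambda>h. (h *\<^sub>R \<zeta>', h *\<^sub>R \<theta>'))) h = h *\<^sub>R D (\<zeta>', \<theta>')" by simp
  qed
  show ?thesis
    using chain unfolding eq has_vector_derivative_def at_within_open[OF J(2,1)] by (simp only: o_def)
qed

text \<open>The height in the normal direction has no first-order part, and its second derivative at
  0 is the normal acceleration.\<close>

lemma curve_second_order:
  assumes zt: "z \<in> sphere 0 1" "t \<in> {t0..<T}" and v: "z \<bullet> v = 0"
  shows "((\<lambda>s. (n z t \<bullet> g (great_circle z v s, t) - n z t \<bullet> g (z, t)) / s\<^sup>2) \<longlongrightarrow>
    - A z t (dg (z, t) (v, 0)) / 2) (at 0)"
proof -
  interpret B: parametrized_body "\<Omega> t" "\<lambda>z. g (z, t)" "\<lambda>z v. dg (z, t) (v, 0)"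
    by (rule body[OF zt(2)])
  let ?\<nu> = "n z t"
  obtain a where a: "(B.curve_velocity z v has_vector_derivative a) (at 0)"
    "B.normal z \<bullet> a = - A z t (dg (z, t) (v, 0))"
    using B.curve_acceleration[OF zt(1) normal_differentiable[OF zt] v] by auto
  have c: "(B.curve z v has_derivative (\<lambda>h. h *\<^sub>R B.curve_velocity z v s)) (at s)" for s
    using B.curve_derivative[OF zt(1) v, of s] by (simp add: has_vector_derivative_def)
  have c': "(B.curve_velocity z v has_derivative (\<lambda>h. h *\<^sub>R a)) (at 0)"
    using a(1) by (simp add: has_vector_derivative_def)
  have "((\<lambda>s. (?\<nu> \<bullet> B.curve z v s - ?\<nu> \<bullet> g (z, t)) /\<^sub>R s\<^sup>2) \<longlongrightarrow> (?\<nu> \<bullet> a) /\<^sub>R 2) (at 0)"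
  proof (rule second_order_expansion)
    show "((\<lambda>s. ?\<nu> \<bullet> B.curve z v s - ?\<nu> \<bullet> g (z, t)) has_vector_derivative ?\<nu> \<bullet> B.curve_velocity z v s) (at s)" for s
      unfolding has_vector_derivative_def by (auto intro!: derivative_eq_intros c)
    show "((\<lambda>s. ?\<nu> \<bullet> B.curve_velocity z v s) has_vector_derivative ?\<nu> \<bullet> a) (at 0)"
      unfolding has_vector_derivative_def by (auto intro!: derivative_eq_intros c')
    show "?\<nu> \<bullet> B.curve_velocity z v 0 = 0" using n_perp[OF zt v] by simp
  qed simp
  moreover have "?\<nu> \<bullet> a = - A z t (dg (z, t) (v, 0))" using a(2) by (simp only: normal_eq[OF zt(2)])
  moreover have "x /\<^sub>R y = x / y" for x y :: real by (simp add: divide_inverse)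
  ultimately show ?thesis by (simp only: B.curve_def)
qed

lemma H_derivativeE:
  assumes "z \<in> sphere 0 1" "t \<in> {t0..<T}"
  obtains D where "((\<lambda>(z, t). H z t) has_derivative D) (at (z, t) within sphere 0 1 \<times> {t0..<T})"
  using H_differentiable[OF assms] unfolding differentiable_def by blast

text \<open>One derivative \<open>D\<close> within the parameter domain yields both terms: the time
  derivative is taken at fixed \<open>z\<close>, the tangential one along the image of a great
  circle.\<close>

lemma harnack_quantity_eq:
  assumes z: "z \<in> sphere 0 1" and t: "t \<in> {t0<..<T}" and v: "z \<bullet> v = 0"
    and D: "((\<lambda>(z, t). H z t) has_derivative D) (at (z, t) within sphere 0 1 \<times> {t0..<T})"
  shows "harnack_quantity \<Omega> X z t (dg (z, t) (v, 0)) = D (0, 1) + 2 * D (v, 0) + A z t (dg (z, t) (v, 0))"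
proof -
  have t': "t \<in> {t0..<T}" using t by auto
  interpret B: parametrized_body "\<Omega> t" "\<lambda>z. g (z, t)" "\<lambda>z v. dg (z, t) (v, 0)"
    by (rule body[OF t'])
  have "((\<lambda>s. (\<lambda>(z, t). H z t) (z, s)) has_vector_derivative D (0, 1)) (at t)"
    by (rule derivative_along_path[where \<zeta> = "\<lambda>_. z" and \<theta> = "\<lambda>s. s" and J = "{t0<..<T}"]) (use D z t in auto)
  then have "((\<lambda>s. H z s) has_real_derivative D (0, 1)) (at t)"
    by (simp add: has_real_derivative_iff_has_vector_derivative)
  then have "((\<lambda>s. mean_curvature (\<Omega> s) (X z s)) has_real_derivative D (0, 1)) (at t)"
    by (rule has_field_derivative_transform_within_open[OF _ open_greaterThanLessThan t])
      (use g_eq[OF z] in \<open>auto simp: H_def\<close>)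
  then have 1: "deriv (\<lambda>s. mean_curvature (\<Omega> s) (X z s)) t = D (0, 1)" by (rule DERIV_imp_deriv)
  have "((\<lambda>s. (\<lambda>(z, t). H z t) (great_circle z v s, t)) has_vector_derivative D (v, 0)) (at 0)"
    by (rule derivative_along_path[where \<zeta> = "great_circle z v" and \<theta> = "\<lambda>_. t" and J = UNIV])
      (use D great_circle_in_sphere[OF z v] t' has_vector_derivative_great_circle[of z v 0] in auto)
  then have "((\<lambda>s. mean_curvature (\<Omega> t) (B.curve z v s)) has_vector_derivative D (v, 0)) (at 0)"
    by (simp add: H_def B.curve_def)
  moreover have "mean_curvature (\<Omega> t) differentiable (at (g (z, t)) within frontier (\<Omega> t))"
    by (rule B.differentiable_along_frontier[OF z])
      (use slice_differentiable[OF z t' H_differentiable[OF z t']] in \<open>simp add: H_def\<close>)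
  ultimately have "deriv_along (frontier (\<Omega> t)) (mean_curvature (\<Omega> t)) (g (z, t)) (dg (z, t) (v, 0)) = D (v, 0)"
    using B.deriv_along_curve[OF z v] vector_derivative_unique_at by blast
  with 1 show ?thesis by (simp add: harnack_quantity_def g_eq[OF z t'])
qed

text \<open>The midpoint of \<open>X (\<zeta> s) (tm (\<tau> + s))\<close> and \<open>X (\<zeta> (-s)) (tm (\<tau> - s))\<close> lies in the body at time \<open>tm \<tau>\<close>;
  its height over the tangent plane, expanded to second order in \<open>s\<close>, is the Harnack quantity.\<close>

theorem harnack:
  assumes z: "z \<in> sphere 0 1" and t: "t \<in> {t0<..<T}" and v: "z \<bullet> v = 0"
  shows "0 \<le> harnack_quantity \<Omega> X z t (dg (z, t) (v, 0)) + H z t / (2 * (t - t0))"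
proof -
  have t': "t \<in> {t0..<T}" using t by auto
  obtain D where D: "((\<lambda>(z, t). H z t) has_derivative D) (at (z, t) within sphere 0 1 \<times> {t0..<T})"
    using H_derivativeE[OF z t'] .
  obtain n' where n': "((\<lambda>(z, t). n z t) has_derivative n') (at (z, t) within sphere 0 1 \<times> {t0..<T})"
    and nn': "\<And>h. n z t \<bullet> n' h = 0"
    by (rule n_derivative[OF z t'], rule that)
  have linD: "linear D" using D by (rule has_derivative_linear)
  define \<tau> where "\<tau> = sqrt (2 * (t - t0))"
  have \<tau>: "\<tau> > 0" "\<tau>\<^sup>2 = 2 * (t - t0)" "tm \<tau> = t" using t by (simp_all add: \<tau>_def tm_def diff_divide_distrib)
  \<comment> \<open>Space velocity \<open>\<tau> *\<^sub>R v\<close> for unit velocity in \<tau>: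
    the terms of the Harnack quantity then share the factor \<tau>^2, by which the inequality is
    divided at the end.\<close>
  define w where "w = \<tau> *\<^sub>R v"
  have w: "z \<bullet> w = 0" using v by (simp add: w_def)
  let ?\<zeta> = "great_circle z w" and ?\<nu> = "n z t"
  have \<zeta>: "?\<zeta> s \<in> sphere 0 1" for s by (rule great_circle_in_sphere[OF z w])
  have "isCont tm \<tau>" unfolding tm_def[abs_def] by (intro continuous_intros) auto
  then have "\<forall>\<^sub>F s in at \<tau>. tm s < T"
    using \<tau>(3) t by (auto simp: isCont_def intro!: order_tendstoD(2))
  then obtain d0 where d0: "d0 > 0" "\<And>s. s \<noteq> \<tau> \<Longrightarrow> dist s \<tau> < d0 \<Longrightarrow> tm s < T"
    unfolding eventually_at by blast
  define d where "d = min d0 \<tau>"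
  have "d > 0" using d0(1) \<tau>(1) by (simp add: d_def)
  have tmI: "tm (\<tau> + s) \<in> {t0..<T}" "0 \<le> \<tau> + s" if "\<bar>s\<bar> < d" for s
  proof -
    show "tm (\<tau> + s) \<in> {t0..<T}"
    proof (cases "s = 0")
      case False
      then have "tm (\<tau> + s) < T" using that by (intro d0(2)) (auto simp: d_def dist_real_def)
      then show ?thesis by (simp add: tm_def)
    qed (use \<tau>(3) t' in simp)
    show "0 \<le> \<tau> + s" using that by (simp add: d_def abs_if split: if_splits)
  qed
  \<comment> \<open>The height in the fixed direction \<open>?\<nu>\<close> with independent
    parameters for space and time; the path of interest is the diagonal.\<close>
  define j where "j s \<theta> = ?\<nu> \<bullet> g (?\<zeta> s, tm (\<tau> + \<theta>))" for s \<theta>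
  define \<eta> where "\<eta> p = (\<tau> + snd p) * (?\<nu> \<bullet> dg (?\<zeta> (fst p), tm (\<tau> + snd p)) (0, 1))" for p
  have \<eta>_eq: "\<eta> (s, \<theta>) = - ((\<tau> + \<theta>) * (H (?\<zeta> s) (tm (\<tau> + \<theta>)) * (?\<nu> \<bullet> n (?\<zeta> s) (tm (\<tau> + \<theta>)))))"
    if "\<bar>\<theta>\<bar> < d" for s \<theta>
    using speed[OF \<zeta> tmI(1)[OF that]] by (simp add: \<eta>_def)
  have j: "(j s has_vector_derivative \<eta> (s, \<theta>)) (at \<theta>)" if "\<bar>\<theta>\<bar> < d" for s \<theta>
  proof -
    have "((\<lambda>\<theta>. \<tau> + \<theta>) has_vector_derivative 1) (at \<theta>)" by (auto intro!: derivative_eq_intros)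
    from vector_diff_chain_at[OF this, of "\<lambda>\<tau>. g (?\<zeta> s, tm \<tau>)"] g_tm[OF \<zeta> tmI(1)[OF that]]
    have "((\<lambda>\<theta>. g (?\<zeta> s, tm (\<tau> + \<theta>))) has_vector_derivative
        - ((\<tau> + \<theta>) * H (?\<zeta> s) (tm (\<tau> + \<theta>))) *\<^sub>R n (?\<zeta> s) (tm (\<tau> + \<theta>))) (at \<theta>)"
      by (simp add: o_def)
    from has_derivative_inner_right[OF this[unfolded has_vector_derivative_def], of ?\<nu>] show ?thesis
      unfolding \<eta>_eq[OF that] has_vector_derivative_def j_def[abs_def] by (simp add: algebra_simps)
  qed
  have "\<eta> differentiable (at (0, 0))"
  proof -
    have 1: "(\<lambda>p::real \<times> real. ?\<zeta> (fst p)) differentiable (at (0, 0))"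
      using differentiable_chain_at[of fst "(0, 0)" ?\<zeta>] has_vector_derivative_great_circle[of z w 0]
        bounded_linear_imp_differentiable[OF bounded_linear_fst]
      by (auto simp: o_def dest: differentiableI_vector)
    have sn: "(snd :: real \<times> real \<Rightarrow> real) differentiable (at (0, 0))"
      by (rule bounded_linear_imp_differentiable[OF bounded_linear_snd])
    have 2: "(\<lambda>p::real \<times> real. tm (\<tau> + snd p)) differentiable (at (0, 0))"
      unfolding tm_def divide_inverse power2_eq_square
      by (intro differentiable_add differentiable_mult differentiable_const sn)
    have "(\<lambda>p::real \<times> real. (?\<zeta> (fst p), tm (\<tau> + snd p))) differentiable (at (0, 0))"
    proof -
      from 1 obtain D1 where "((\<lambda>p::real \<times> real. ?\<zeta> (fst p)) has_derivative D1) (at (0, 0))"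
        unfolding differentiable_def by blast
      moreover from 2 obtain D2 where "((\<lambda>p::real \<times> real. tm (\<tau> + snd p)) has_derivative D2) (at (0, 0))"
        unfolding differentiable_def by blast
      ultimately show ?thesis using has_derivative_Pair unfolding differentiable_def by blast
    qed
    from differentiable_chain_at[OF this, of "\<lambda>p. dg p (0, 1)"] dg_differentiable[OF in_U[OF z t'], of "(0, 1)"]
    have "(\<lambda>p::real \<times> real. dg (?\<zeta> (fst p), tm (\<tau> + snd p)) (0, 1)) differentiable (at (0, 0))"
      by (simp add: o_def \<tau>(3))
    then show ?thesis
      unfolding \<eta>_def
      by (intro differentiable_mult differentiable_add differentiable_inner differentiable_const sn)
  qed
  then obtain \<eta>' where \<eta>': "(\<eta> has_derivative \<eta>') (at (0, 0))" unfolding differentiable_def by blast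
  have lin\<eta>: "linear \<eta>'" using \<eta>' by (rule has_derivative_linear)
  have path: "((\<lambda>s. \<eta> (a * s, b * s)) has_vector_derivative \<eta>' (a, b)) (at 0)" for a b
  proof -
    have "((\<lambda>s. (a * s, b * s)) has_derivative (\<lambda>h. (a * h, b * h))) (at 0)"
      by (auto intro!: derivative_eq_intros)
    from diff_chain_at[OF this, of \<eta> \<eta>'] \<eta>'
    have "((\<lambda>s. \<eta> (a * s, b * s)) has_derivative (\<lambda>h. \<eta>' (a * h, b * h))) (at 0)"
      by (simp add: o_def)
    moreover have "\<eta>' (a * h, b * h) = h *\<^sub>R \<eta>' (a, b)" for h
      using linear_cmul[OF lin\<eta>, of h "(a, b)"] by (simp add: mult.commute)
    ultimately show ?thesis by (simp add: has_vector_derivative_def)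
  qed
  \<comment> \<open>The derivative of the normal is perpendicular to \<open>?\<nu>\<close>, so the
    factor \<open>?\<nu> \<bullet> n\<close> contributes nothing and only \<open>H\<close> is
    differentiated.\<close>
  have \<eta>1: "\<eta>' (1, 0) = - (\<tau> * D (w, 0))"
  proof -
    have gc: "(?\<zeta> has_vector_derivative w) (at 0)" using has_vector_derivative_great_circle[of z w 0] by simp
    have "((\<lambda>s. (\<lambda>(z, t). H z t) (?\<zeta> s, t)) has_vector_derivative D (w, 0)) (at 0)"
      by (rule derivative_along_path[where \<zeta> = ?\<zeta> and \<theta> = "\<lambda>_. t" and J = UNIV, OF _ gc]) (use D \<zeta> t' in auto)
    moreover have "((\<lambda>s. (\<lambda>(z, t). n z t) (?\<zeta> s, t)) has_vector_derivative n' (w, 0)) (at 0)"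
      by (rule derivative_along_path[where \<zeta> = ?\<zeta> and \<theta> = "\<lambda>_. t" and J = UNIV, OF _ gc]) (use n' \<zeta> t' in auto)
    ultimately have "((\<lambda>s. - (\<tau> * (H (?\<zeta> s) t * (?\<nu> \<bullet> n (?\<zeta> s) t)))) has_vector_derivative - (\<tau> * D (w, 0))) (at 0)"
      unfolding has_vector_derivative_def
      by (auto intro!: derivative_eq_intros simp: n_n[OF z t'] nn')
    moreover have "(\<lambda>s. - (\<tau> * (H (?\<zeta> s) t * (?\<nu> \<bullet> n (?\<zeta> s) t)))) = (\<lambda>s. \<eta> (1 * s, 0 * s))"
      using \<eta>_eq[of 0] \<open>d > 0\<close> \<tau>(3) by auto
    ultimately show ?thesis using path[of 1 0] vector_derivative_unique_at by metis
  qed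
  have \<eta>2: "\<eta>' (0, 1) = - (H z t + \<tau>\<^sup>2 * D (0, 1))"
  proof -
    let ?J = "{-d<..<d}"
    have J: "open ?J" "0 \<in> ?J" using \<open>d > 0\<close> by auto
    have I: "tm (\<tau> + r) \<in> {t0..<T}" if "r \<in> ?J" for r using tmI(1)[of r] that by (auto simp: abs_less_iff)
    have tm': "((\<lambda>\<theta>. tm (\<tau> + \<theta>)) has_vector_derivative \<tau>) (at 0)"
      unfolding tm_def by (auto intro!: derivative_eq_intros simp flip: has_real_derivative_iff_has_vector_derivative)
    have "((\<lambda>\<theta>. (\<lambda>(z, t). H z t) (z, tm (\<tau> + \<theta>))) has_vector_derivative D (0, \<tau>)) (at 0)"
      by (rule derivative_along_path[where \<zeta> = "\<lambda>_. z" and \<theta> = "\<lambda>\<theta>. tm (\<tau> + \<theta>)", OF _ _ tm' J]) (use D z I \<tau>(3) in auto)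
    moreover have "((\<lambda>\<theta>. (\<lambda>(z, t). n z t) (z, tm (\<tau> + \<theta>))) has_vector_derivative n' (0, \<tau>)) (at 0)"
      by (rule derivative_along_path[where \<zeta> = "\<lambda>_. z" and \<theta> = "\<lambda>\<theta>. tm (\<tau> + \<theta>)", OF _ _ tm' J]) (use n' z I \<tau>(3) in auto)
    moreover have "D (0, \<tau>) = \<tau> * D (0, 1)" using linear_cmul[OF linD, of \<tau> "(0, 1)"] by simp
    ultimately have "((\<lambda>\<theta>. - ((\<tau> + \<theta>) * (H z (tm (\<tau> + \<theta>)) * (?\<nu> \<bullet> n z (tm (\<tau> + \<theta>)))))) has_vector_derivative
        - (H z t + \<tau>\<^sup>2 * D (0, 1))) (at 0)"
      unfolding has_vector_derivative_def
      by (auto intro!: derivative_eq_intros simp: n_n[OF z t'] nn' \<tau>(3) power2_eq_square algebra_simps)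
    then have "((\<lambda>\<theta>. \<eta> (0 * \<theta>, 1 * \<theta>)) has_vector_derivative - (H z t + \<tau>\<^sup>2 * D (0, 1))) (at 0)"
      by (rule has_vector_derivative_transform_within_open[OF _ J]) (auto simp: \<eta>_eq abs_less_iff)
    then show ?thesis using path[of 0 1] vector_derivative_unique_at by blast
  qed
  define k where "k s = j s s" for s
  define \<kappa> where "\<kappa> = - (\<tau> * D (w, 0)) - (H z t + \<tau>\<^sup>2 * D (0, 1)) / 2 - A z t (dg (z, t) (w, 0)) / 2"
  have "((\<lambda>s. (j s s - j s 0 - s * \<eta> (0, 0)) / s\<^sup>2) \<longlongrightarrow> \<eta>' (1, 0) + \<eta>' (0, 1) / 2) (at 0)"
    by (rule diagonal_expansion[OF \<open>d > 0\<close> _ \<eta>']) (rule j)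
  moreover have "((\<lambda>s. (j s 0 - j 0 0) / s\<^sup>2) \<longlongrightarrow> - A z t (dg (z, t) (w, 0)) / 2) (at 0)"
    using curve_second_order[OF z t' w] by (simp add: j_def \<tau>(3))
  ultimately have "((\<lambda>s. (j s s - j s 0 - s * \<eta> (0, 0)) / s\<^sup>2 + (j s 0 - j 0 0) / s\<^sup>2) \<longlongrightarrow>
      \<eta>' (1, 0) + \<eta>' (0, 1) / 2 + - A z t (dg (z, t) (w, 0)) / 2) (at 0)"
    by (rule tendsto_add)
  moreover have "(j s s - j s 0 - s * \<eta> (0, 0)) / s\<^sup>2 + (j s 0 - j 0 0) / s\<^sup>2 = (k s - k 0 - s * \<eta> (0, 0)) / s\<^sup>2" for s
    by (simp add: k_def add_divide_distrib[symmetric])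
  moreover have "\<eta>' (1, 0) + \<eta>' (0, 1) / 2 + - A z t (dg (z, t) (w, 0)) / 2 = \<kappa>"
    by (simp add: \<kappa>_def \<eta>1 \<eta>2 field_simps)
  ultimately have lim: "((\<lambda>s. (k s - k 0 - s * \<eta> (0, 0)) / s\<^sup>2) \<longlongrightarrow> \<kappa>) (at 0)"
    by (simp only:)
  \<comment> \<open>Substituting \<open>- s\<close> flips the linear term, which cancels in the sum
    of the two limits.\<close>
  then have "((\<lambda>s. (k s - k 0 - s * \<eta> (0, 0)) / s\<^sup>2) \<longlongrightarrow> \<kappa>) (filtermap uminus (at 0))"
    by (simp add: filtermap_at_minus)
  then have lim': "((\<lambda>s. (k (- s) - k 0 + s * \<eta> (0, 0)) / s\<^sup>2) \<longlongrightarrow> \<kappa>) (at 0)"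
    by (simp add: filterlim_filtermap)
  have "\<kappa> + \<kappa> \<le> 0"
  proof (rule tendsto_upperbound[OF tendsto_add[OF lim lim']])
    have "k s + k (- s) \<le> 2 * k 0" if s: "\<bar>s\<bar> < d" for s
    proof -
      have ms: "\<bar>- s\<bar> < d" using s by simp
      have "(1 / 2) *\<^sub>R g (?\<zeta> s, tm (\<tau> + s)) + (1 - 1 / 2) *\<^sub>R g (?\<zeta> (- s), tm (\<tau> + - s))
          \<in> \<Omega> (tm (1 / 2 * (\<tau> + s) + (1 - 1 / 2) * (\<tau> + - s)))"
        by (rule minkowski_concave) (use tmI[OF s] tmI[OF ms] g_in[OF \<zeta>] in auto)
      also have "1 / 2 * (\<tau> + s) + (1 - 1 / 2) * (\<tau> + - s) = \<tau>" by (simp add: field_simps)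
      finally have "?\<nu> \<bullet> ((1 / 2) *\<^sub>R g (?\<zeta> s, tm (\<tau> + s)) + (1 - 1 / 2) *\<^sub>R g (?\<zeta> (- s), tm (\<tau> + - s))) \<le> ?\<nu> \<bullet> g (z, t)"
        using n_support[OF z t'] \<tau>(3) by simp
      then show ?thesis by (simp add: k_def j_def \<tau>(3) inner_add_right)
    qed
    then have "(k s - k 0 - s * \<eta> (0, 0)) / s\<^sup>2 + (k (- s) - k 0 + s * \<eta> (0, 0)) / s\<^sup>2 \<le> 0" if "\<bar>s\<bar> < d" for s
      using that by (fastforce simp: add_divide_distrib[symmetric] intro!: divide_nonpos_nonneg)
    then show "\<forall>\<^sub>F s in at 0. (k s - k 0 - s * \<eta> (0, 0)) / s\<^sup>2 + (k (- s) - k 0 + s * \<eta> (0, 0)) / s\<^sup>2 \<le> 0"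
      using \<open>d > 0\<close> by (auto simp: eventually_at dist_real_def)
  qed simp
  moreover have "D (w, 0) = \<tau> * D (v, 0)" using linear_cmul[OF linD, of \<tau> "(v, 0)"] by (simp add: w_def)
  moreover have "dg (z, t) (w, 0) = \<tau> *\<^sub>R dg (z, t) (v, 0)"
    unfolding w_def by (rule linear_cmul[OF linear_dg_space[OF in_U[OF z t']]])
  ultimately have "0 \<le> \<tau>\<^sup>2 * (D (0, 1) + 2 * D (v, 0) + A z t (dg (z, t) (v, 0))) + H z t"
    by (simp add: \<kappa>_def A_scale[OF z t'] power2_eq_square algebra_simps)
  then have "0 \<le> (\<tau>\<^sup>2 * (D (0, 1) + 2 * D (v, 0) + A z t (dg (z, t) (v, 0))) + H z t) / \<tau>\<^sup>2"
    by simp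
  also have "\<dots> = D (0, 1) + 2 * D (v, 0) + A z t (dg (z, t) (v, 0)) + H z t / \<tau>\<^sup>2"
    using \<tau>(1) by (simp add: add_divide_distrib)
  finally show ?thesis unfolding harnack_quantity_eq[OF z t v D] \<tau>(2) .
qed

lemma A_le:
  assumes "z \<in> sphere 0 1" "t \<in> {t0..<T}" "n z t \<bullet> V = 0"
  shows "A z t V \<le> 2 ^ DIM('a) * (norm V)\<^sup>2 * H z t"
  unfolding H_def
  by (rule parametrized_body.sff_le_mean_curvature[OF body[OF assms(2)] assms(1) normal_differentiable[OF assms(1,2)]])
    (simp only: normal_eq[OF assms(2)] assms(3))

text \<open>The strong maximum principle, as the usual consequence of a Harnack inequality: along a path with
  spatial velocity \<open>2 V\<close> one has \<open>d/ds H \<ge> - A(V, V) - H / (2 (t - t0)) \<ge> - k H\<close>.\<close>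

theorem H_pos:
  assumes z: "z \<in> sphere 0 1" and t: "t \<in> {t0<..<T}"
  shows "H z t > 0"
proof -
  \<comment> \<open>Starting strictly after \<open>t0\<close> keeps \<open>H / (2 (t - t0))\<close>
    below a fixed multiple of \<open>H\<close> along the path.\<close>
  define t1 where "t1 = (t0 + t) / 2"
  define \<delta> where "\<delta> = t - t1"
  have t1: "t0 < t1" "t1 < T" "\<delta> > 0" using t by (auto simp: t1_def \<delta>_def field_simps)
  have "t1 \<in> {t0..<T}" using t1 by simp
  note pos = parametrized_body.exists_positive_mean_curvature[OF body[OF this] normal_differentiable[OF _ this]]
  obtain z1 where z1: "z1 \<in> sphere 0 1" "H z1 t1 > 0"
    using pos unfolding H_def by metis
  obtain v where v: "z1 \<bullet> v = 0" "great_circle z1 v 1 = z" using great_circle_reaches[OF dim z1(1) z] .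
  let ?\<zeta> = "great_circle z1 v" and ?\<zeta>' = "great_circle_velocity z1 v"
  define \<theta> where "\<theta> s = t1 + s * \<delta>" for s
  have \<zeta>: "?\<zeta> s \<in> sphere 0 1" for s by (rule great_circle_in_sphere[OF z1(1) v(1)])
  have \<theta>: "\<theta> s \<in> {t0<..<T}" "t1 \<le> \<theta> s" if "s \<in> {0..1}" for s
  proof -
    have "0 \<le> s * \<delta>" "s * \<delta> \<le> 1 * \<delta>" using that t1(3) by (intro mult_nonneg_nonneg mult_right_mono; simp)+
    moreover have "t1 + \<delta> = t" by (simp add: \<delta>_def)
    ultimately have "t1 \<le> \<theta> s" "\<theta> s \<le> t" unfolding \<theta>_def by linarith+
    then show "\<theta> s \<in> {t0<..<T}" "t1 \<le> \<theta> s" using t t1 by auto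
  qed
  define W where "W s = dg (?\<zeta> s, \<theta> s) (?\<zeta>' s, 0)" for s
  have "continuous_on {0..1} W"
  proof -
    have c: "continuous_on {0..1} ?\<zeta>"
      by (intro continuous_at_imp_continuous_on ballI has_vector_derivative_continuous[OF has_vector_derivative_great_circle])
    have c': "continuous_on {0..1} ?\<zeta>'"
      by (intro continuous_at_imp_continuous_on ballI differentiable_imp_continuous_within differentiable_great_circle_velocity)
    have p: "continuous_on {0..1} (\<lambda>s. (?\<zeta> s, \<theta> s))"
      unfolding \<theta>_def by (intro continuous_intros c)
    have dgc: "continuous_on U (\<lambda>p. dg p w)" for w
      using dg_differentiable by (intro continuous_at_imp_continuous_on ballI differentiable_imp_continuous_within)
    have sub: "(\<lambda>s. (?\<zeta> s, \<theta> s)) ` {0..1} \<subseteq> U" using in_U[OF \<zeta>] \<theta>(1) by fastforce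
    have "continuous_on {0..1} (\<lambda>s. \<Sum>b\<in>Basis. (?\<zeta>' s \<bullet> b) *\<^sub>R dg (?\<zeta> s, \<theta> s) (b, 0))"
      by (intro continuous_intros c' continuous_on_compose2[OF dgc p sub])
    then show ?thesis
    proof (rule continuous_on_eq)
      fix s assume "s \<in> {0..1::real}"
      then have "(?\<zeta> s, \<theta> s) \<in> U" using sub by blast
      from dg_expand[OF this, of "?\<zeta>' s"]
      show "(\<Sum>b\<in>Basis. (?\<zeta>' s \<bullet> b) *\<^sub>R dg (?\<zeta> s, \<theta> s) (b, 0)) = W s" by (simp only: W_def)
    qed
  qed
  then have "continuous_on {0..1} (\<lambda>s. norm (W s))" by (rule continuous_on_norm)
  then have "\<exists>s0\<in>{0..1}. \<forall>s\<in>{0..1}. norm (W s) \<le> norm (W s0)"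
    by (intro continuous_attains_sup) auto
  then obtain s0 where s0: "\<And>s. s \<in> {0..1} \<Longrightarrow> norm (W s) \<le> norm (W s0)" by blast
  \<comment> \<open>The first summand bounds \<delta> times \<open>A\<close> at velocity
    \<open>W / (2 \<delta>)\<close>, whence the 4; the second bounds the term with
    \<open>t - t0\<close> from \<open>t1\<close> on.\<close>
  define k where "k = 2 ^ DIM('a) * (norm (W s0))\<^sup>2 / (4 * \<delta>) + \<delta> / (2 * (t1 - t0))"
  have step: "\<exists>y'. ((\<lambda>s. H (?\<zeta> s) (\<theta> s) * exp (k * s)) has_real_derivative y') (at s) \<and> 0 \<le> y'"
    if s: "s \<in> {0..1}" for s
  proof -
    note I = \<theta>(1)[OF s]
    have I': "\<theta> s \<in> {t0..<T}" using I by auto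
    obtain D where D: "((\<lambda>(z, t). H z t) has_derivative D) (at (?\<zeta> s, \<theta> s) within sphere 0 1 \<times> {t0..<T})"
      using H_derivativeE[OF \<zeta> I'] .
    have linD: "linear D" using D by (rule has_derivative_linear)
    \<comment> \<open>The path has velocity \<open>(?\<zeta>' s, \<delta>)\<close>, which is
      \<delta> times \<open>(2 ?v, 1)\<close>: the combination of derivatives in the Harnack
      inequality.\<close>
    let ?h = "H (?\<zeta> s) (\<theta> s)" and ?v = "(1 / (2 * \<delta>)) *\<^sub>R ?\<zeta>' s"
    have perp: "?\<zeta> s \<bullet> ?\<zeta>' s = 0" by (rule great_circle_velocity_perp[OF z1(1) v(1)])
    define J where "J = \<theta> -` {t0<..<T}"
    have "open J" unfolding J_def \<theta>_def by (intro open_vimage open_greaterThanLessThan continuous_intros)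
    have "((\<lambda>s. (\<lambda>(z, t). H z t) (?\<zeta> s, \<theta> s)) has_vector_derivative D (?\<zeta>' s, \<delta>)) (at s)"
    proof (rule derivative_along_path[where \<zeta> = ?\<zeta> and \<theta> = \<theta> and J = J])
      show "(\<theta> has_vector_derivative \<delta>) (at s)" unfolding \<theta>_def[abs_def] by (auto intro!: derivative_eq_intros)
    qed (use I \<zeta> D \<open>open J\<close> has_vector_derivative_great_circle in \<open>auto simp: J_def\<close>)
    then have dH: "((\<lambda>s. H (?\<zeta> s) (\<theta> s)) has_real_derivative D (?\<zeta>' s, \<delta>)) (at s)"
      by (simp add: has_real_derivative_iff_has_vector_derivative)
    have "?\<zeta> s \<bullet> ?v = 0" using perp by simp
    from harnack[OF \<zeta> I this] harnack_quantity_eq[OF \<zeta> I this D]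
    have har: "0 \<le> D (0, 1) + 2 * D (?v, 0) + A (?\<zeta> s) (\<theta> s) (dg (?\<zeta> s, \<theta> s) (?v, 0)) + ?h / (2 * (\<theta> s - t0))"
      by simp
    have Dv: "D (?v, 0) = 1 / (2 * \<delta>) * D (?\<zeta>' s, 0)"
      using linear_cmul[OF linD, of "1 / (2 * \<delta>)" "(?\<zeta>' s, 0)"] by simp
    have W: "dg (?\<zeta> s, \<theta> s) (?v, 0) = (1 / (2 * \<delta>)) *\<^sub>R W s"
      unfolding W_def by (rule linear_cmul[OF linear_dg_space[OF in_U[OF \<zeta> I']]])
    have split: "D (?\<zeta>' s, \<delta>) = D (?\<zeta>' s, 0) + \<delta> * D (0, 1)"
      using linear_add[OF linD, of "(?\<zeta>' s, 0)" "(0, \<delta>)"] linear_cmul[OF linD, of \<delta> "(0, 1)"] by simp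
    have h0: "0 \<le> ?h" by (rule H_nonneg[OF \<zeta> I'])
    have "A (?\<zeta> s) (\<theta> s) (dg (?\<zeta> s, \<theta> s) (?v, 0)) = (1 / (2 * \<delta>))\<^sup>2 * A (?\<zeta> s) (\<theta> s) (W s)"
      unfolding W by (rule A_scale[OF \<zeta> I'])
    also have "\<dots> \<le> (1 / (2 * \<delta>))\<^sup>2 * (2 ^ DIM('a) * (norm (W s0))\<^sup>2 * ?h)"
    proof (rule mult_left_mono)
      have "A (?\<zeta> s) (\<theta> s) (W s) \<le> 2 ^ DIM('a) * (norm (W s))\<^sup>2 * ?h"
        by (rule A_le[OF \<zeta> I']) (simp add: W_def n_perp[OF \<zeta> I' perp])
      also have "\<dots> \<le> 2 ^ DIM('a) * (norm (W s0))\<^sup>2 * ?h"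
        by (intro mult_right_mono mult_left_mono power_mono s0 s h0) auto
      finally show "A (?\<zeta> s) (\<theta> s) (W s) \<le> 2 ^ DIM('a) * (norm (W s0))\<^sup>2 * ?h" .
    qed simp
    finally have Ale: "\<delta> * A (?\<zeta> s) (\<theta> s) (dg (?\<zeta> s, \<theta> s) (?v, 0)) \<le> 2 ^ DIM('a) * (norm (W s0))\<^sup>2 / (4 * \<delta>) * ?h"
      using t1(3) by (simp add: field_simps power2_eq_square)
    have "?h / (2 * (\<theta> s - t0)) \<le> ?h / (2 * (t1 - t0))"
      using h0 \<theta>(2)[OF s] t1(1) by (intro divide_left_mono mult_pos_pos) auto
    then have "\<delta> * (?h / (2 * (\<theta> s - t0))) \<le> \<delta> * (?h / (2 * (t1 - t0)))"
      using t1(3) by (intro mult_left_mono) auto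
    moreover have "0 \<le> \<delta> * (D (0, 1) + 2 * D (?v, 0) + A (?\<zeta> s) (\<theta> s) (dg (?\<zeta> s, \<theta> s) (?v, 0)) + ?h / (2 * (\<theta> s - t0)))"
      using har t1(3) by (intro mult_nonneg_nonneg) auto
    moreover have "\<delta> * (2 * D (?v, 0)) = D (?\<zeta>' s, 0)" using t1(3) by (simp add: Dv)
    ultimately have "0 \<le> D (?\<zeta>' s, \<delta>) + k * ?h"
      using Ale unfolding split k_def by (simp add: distrib_left distrib_right)
    then have "0 \<le> (D (?\<zeta>' s, \<delta>) + k * ?h) * exp (k * s)" by simp
    moreover have "((\<lambda>s. H (?\<zeta> s) (\<theta> s) * exp (k * s)) has_real_derivative (D (?\<zeta>' s, \<delta>) + k * ?h) * exp (k * s)) (at s)"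
      by (auto intro!: derivative_eq_intros dH simp: algebra_simps)
    ultimately show ?thesis by blast
  qed
  have "H (?\<zeta> 0) (\<theta> 0) * exp (k * 0) \<le> H (?\<zeta> 1) (\<theta> 1) * exp (k * 1)"
    by (rule DERIV_nonneg_imp_nondecreasing) (use step in auto)
  then have "0 < H z t * exp k" using z1(2) v(2) by (simp add: \<theta>_def \<delta>_def)
  then show ?thesis by (simp add: zero_less_mult_iff)
qed

subsection \<open>The arrival time\<close>

text \<open>If \<open>p\<close> stayed, it would still be on the hyperplane supporting the body at
  time \<open>s\<close>, hence be a boundary point with the same normal at a later time \<sigma>.
  There \<open>H > 0\<close>, so the parametrized point arriving at \<open>p\<close> was strictly
  beyond that hyperplane just before, although it belonged to the body at time
  \<open>s\<close>.\<close>

lemma frontier_leaves: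
  assumes s: "s \<in> {t0..<T}" and p: "p \<in> frontier (\<Omega> s)" and t: "s < t" "t < T"
  shows "p \<notin> \<Omega> t"
proof
  assume pt: "p \<in> \<Omega> t"
  obtain y where y: "y \<in> sphere 0 1" "p = g (y, s)" using parametrized_body.frontierE[OF body[OF s] p] .
  let ?\<nu> = "n y s"
  define \<sigma> where "\<sigma> = (s + t) / 2"
  have \<sigma>: "s < \<sigma>" "\<sigma> < t" "\<sigma> \<in> {t0..<T}" "\<sigma> \<in> {t0<..<T}" using s t by (auto simp: \<sigma>_def)
  have p\<sigma>: "p \<in> \<Omega> \<sigma>" using mono[of \<sigma> t] \<sigma> t pt by auto
  have sup: "\<forall>x\<in>\<Omega> \<sigma>. ?\<nu> \<bullet> x \<le> ?\<nu> \<bullet> p" using n_support[OF y(1) s] mono[of s \<sigma>] \<sigma> s y(2) by auto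
  obtain z where z: "z \<in> sphere 0 1" "p = g (z, \<sigma>)"
    using parametrized_body.frontierE[OF body[OF \<sigma>(3)]]
      parametrized_body.frontier_iff[OF body[OF \<sigma>(3)] p\<sigma> norm_n[OF y(1) s] sup] by metis
  have n: "n z \<sigma> = ?\<nu>" using sup z(2) by (intro n_unique[OF z(1) \<sigma>(3)] norm_n[OF y(1) s]) simp
  have "((\<lambda>r. ?\<nu> \<bullet> g (z, r)) has_vector_derivative ?\<nu> \<bullet> (- H z \<sigma> *\<^sub>R ?\<nu>)) (at \<sigma>)"
    using has_derivative_inner_right[OF g_time[OF in_U[OF z(1) \<sigma>(3)], unfolded has_vector_derivative_def], of ?\<nu>]
    by (simp add: has_vector_derivative_def speed[OF z(1) \<sigma>(3)] n mult.assoc)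
  then have "((\<lambda>r. ?\<nu> \<bullet> g (z, r)) has_real_derivative - H z \<sigma>) (at \<sigma>)"
    by (simp add: has_real_derivative_iff_has_vector_derivative n_n[OF y(1) s])
  from DERIV_neg_dec_left[OF this] H_pos[OF z(1) \<sigma>(4)]
  obtain d where d: "d > 0" "\<And>h. 0 < h \<Longrightarrow> h < d \<Longrightarrow> ?\<nu> \<bullet> g (z, \<sigma>) < ?\<nu> \<bullet> g (z, \<sigma> - h)" by auto
  define h where "h = min (d / 2) (\<sigma> - s)"
  have h: "0 < h" "h < d" "s \<le> \<sigma> - h" "\<sigma> - h \<le> \<sigma>" using d(1) \<sigma>(1) by (auto simp: h_def)
  have "\<sigma> - h \<in> {t0..<T}" using h \<sigma> s by auto
  then have "g (z, \<sigma> - h) \<in> \<Omega> s" using g_in[OF z(1)] mono[of s "\<sigma> - h"] h s by auto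
  then have "?\<nu> \<bullet> g (z, \<sigma> - h) \<le> ?\<nu> \<bullet> g (z, \<sigma>)" using n_support[OF y(1) s] y(2) z(2) by metis
  with d(2)[OF h(1,2)] show False by simp
qed

text \<open>The supremum of the times at which \<open>p\<close> is inside works: support
  inequalities pass to the limit from the left, and an interior point would remain inside for a
  moment longer.\<close>

lemma exits_through_frontier:
  assumes p: "p \<in> \<Omega> t0" and t': "t' \<in> {t0..<T}" "p \<notin> \<Omega> t'"
  obtains t where "t \<in> {t0..<T}" "p \<in> frontier (\<Omega> t)"
proof -
  define S where "S = {t \<in> {t0..t'}. p \<in> \<Omega> t}"
  define s where "s = Sup S"
  have S: "t0 \<in> S" "\<And>t. t \<in> S \<Longrightarrow> t \<le> t'" using p t' by (auto simp: S_def)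
  have bdd: "bdd_above S" using S(2) by (auto simp: bdd_above_def)
  have le: "\<And>t. t \<in> S \<Longrightarrow> t \<le> s" unfolding s_def using bdd by (rule cSup_upper[rotated])
  have s: "t0 \<le> s" "s \<le> t'" using le[OF S(1)] S by (auto simp: s_def intro: cSup_least)
  have sI: "s \<in> {t0..<T}" using s t' by auto
  have before: "p \<in> \<Omega> t" if "t0 \<le> t" "t < s" for t
  proof -
    have "S \<noteq> {}" using S(1) by blast
    obtain r where "r \<in> S" "t < r" using less_cSupD[OF \<open>S \<noteq> {}\<close>, of t] \<open>t < s\<close> unfolding s_def by blast
    then show ?thesis using mono[of t r] that t' by (auto simp: S_def)
  qed
  have ps: "p \<in> \<Omega> s"
  proof (cases "s = t0")
    case False
    then have "t0 < s" using s by simp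
    have "n z s \<bullet> p \<le> n z s \<bullet> g (z, s)" if z: "z \<in> sphere 0 1" for z
    proof -
      have "continuous_on {t0..s} (\<lambda>t. n z t \<bullet> (p - g (z, t)))"
        using z sI by (intro continuous_intros continuous_n_compose continuous_g_compose) auto
      then have "((\<lambda>t. n z t \<bullet> (p - g (z, t))) \<longlongrightarrow> n z s \<bullet> (p - g (z, s))) (at s within {t0..s})"
        using s(1) by (auto simp: continuous_on_def)
      then have "((\<lambda>t. n z t \<bullet> (p - g (z, t))) \<longlongrightarrow> n z s \<bullet> (p - g (z, s))) (at_left s)"
        using \<open>t0 < s\<close> by (simp add: at_within_Icc_at_left)
      then have "n z s \<bullet> (p - g (z, s)) \<le> 0"
      proof (rule tendsto_upperbound)
        have "n z t \<bullet> (p - g (z, t)) \<le> 0" if "t0 < t" "t < s" for t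
          using n_support[OF z, of t p] before[of t] that sI by (simp add: inner_diff_right)
        then show "\<forall>\<^sub>F t in at_left s. n z t \<bullet> (p - g (z, t)) \<le> 0"
          using \<open>t0 < s\<close> by (auto simp: eventually_at_left_field)
      qed simp
      then show ?thesis by (simp add: inner_diff_right)
    qed
    then show ?thesis using mem_\<Omega>_iff[OF sI] by blast
  qed (use p in simp)
  have "s < t'" using ps t'(2) s(2) by (metis order_le_less)
  have "p \<notin> interior (\<Omega> s)"
  proof
    assume "p \<in> interior (\<Omega> s)"
    then obtain e where e: "e > 0" "cball p e \<subseteq> \<Omega> s" using mem_interior_cball by blast
    let ?C = "sphere (0::'a) 1 \<times> {t0..t'}"
    \<comment> \<open>Support functions move by less than \<open>e\<close> within a time
      \<open>d\<close>, while a ball of radius \<open>e\<close> around \<open>p\<close> fits into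
      the body at time \<open>s\<close>.\<close>
    have "uniformly_continuous_on ?C g"
    proof (rule compact_uniformly_continuous)
      show "continuous_on ?C g" by (rule continuous_on_subset[OF continuous_g]) (use t' in auto)
      show "compact ?C" by (intro compact_Times) auto
    qed
    then obtain d where d: "d > 0" "\<And>x y. x \<in> ?C \<Longrightarrow> y \<in> ?C \<Longrightarrow> dist y x < d \<Longrightarrow> dist (g y) (g x) < e"
      using e(1) unfolding uniformly_continuous_on_def by metis
    define t where "t = min (s + d / 2) t'"
    have t: "s < t" "t \<le> t'" "t - s < d" "t \<in> {t0..<T}" using d(1) \<open>s < t'\<close> s t' by (auto simp: t_def min_def)
    have "p \<in> \<Omega> t"
    proof (rule ccontr)
      assume "p \<notin> \<Omega> t"
      then obtain z where z: "z \<in> sphere 0 1" "n z t \<bullet> g (z, t) < n z t \<bullet> p"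
        using mem_\<Omega>_iff[OF t(4)] by force
      let ?\<nu> = "n z t"
      obtain y where y: "y \<in> sphere 0 1" "\<forall>x\<in>\<Omega> s. ?\<nu> \<bullet> x \<le> ?\<nu> \<bullet> g (y, s)" using support_point[OF sI] .
      have "p + e *\<^sub>R ?\<nu> \<in> \<Omega> s" using e norm_n[OF z(1) t(4)] by (intro subsetD[OF e(2)]) (simp add: dist_norm)
      then have "?\<nu> \<bullet> p + e \<le> ?\<nu> \<bullet> g (y, s)" using y(2) n_n[OF z(1) t(4)] by (fastforce simp: inner_add_right)
      moreover have "?\<nu> \<bullet> g (y, t) \<le> ?\<nu> \<bullet> g (z, t)" by (rule n_support[OF z(1) t(4) g_in[OF y(1) t(4)]])
      ultimately have "e < ?\<nu> \<bullet> (g (y, s) - g (y, t))" using z(2) by (simp add: inner_diff_right)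
      also have "\<dots> \<le> norm (g (y, s) - g (y, t))"
        using norm_cauchy_schwarz[of ?\<nu>] norm_n[OF z(1) t(4)] by simp
      also have "\<dots> < e"
        using d(2)[of "(y, t)" "(y, s)"] y(1) t s \<open>s < t'\<close> by (simp add: dist_Pair_Pair dist_norm)
      finally show False .
    qed
    then have "t \<in> S" using t s by (auto simp: S_def)
    with le[of t] t(1) show False by simp
  qed
  then have "p \<in> frontier (\<Omega> s)" using ps closure_subset by (auto simp: frontier_def)
  with sI show thesis by (rule that)
qed

text \<open>Late boundaries lie in the body at time \<open>t\<close> and come arbitrarily close to
  \<open>q\<close>; the body is closed.\<close>

lemma center_mem:
  assumes "contracts_to_point \<Omega> T q" "t \<in> {t0..<T}"
  shows "q \<in> \<Omega> t"
proof (rule ccontr)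
  assume "q \<notin> \<Omega> t"
  moreover have "closed (\<Omega> t)"
    using parametrized_body.compact_K[OF body[OF assms(2)]] by (rule compact_imp_closed)
  ultimately obtain e where e: "e > 0" "ball q e \<subseteq> - \<Omega> t" using open_contains_ball[of "- \<Omega> t"] by auto
  have "\<forall>\<^sub>F s in at_left T. frontier (\<Omega> s) \<subseteq> ball q e" using assms(1) e(1) by (simp add: contracts_to_point_def)
  moreover have "\<forall>\<^sub>F s in at_left T. t < s" using assms(2) by (auto simp: eventually_at_left_field)
  moreover have "\<forall>\<^sub>F s in at_left T. s < T" by (simp add: eventually_at_filter)
  ultimately have "\<forall>\<^sub>F s in at_left T. frontier (\<Omega> s) \<subseteq> ball q e \<and> t < s \<and> s < T" by eventually_elim blast
  then obtain s where s: "frontier (\<Omega> s) \<subseteq> ball q e" "t < s" "s < T"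
    using eventually_happens'[OF trivial_limit_at_left_real] by blast
  obtain z :: 'a where "norm z = 1" using vector_choose_size[of 1] by auto
  then have z: "z \<in> sphere 0 1" "s \<in> {t0..<T}" using s assms(2) by auto
  have "g (z, s) \<in> \<Omega> t" using g_in[OF z] mono[of t s] s assms(2) by auto
  moreover have "g (z, s) \<in> ball q e" using g_frontier[OF z] s(1) by blast
  ultimately show False using e(2) by blast
qed

lemma leaves_eventually:
  assumes "contracts_to_point \<Omega> T q" "p \<noteq> q"
  obtains t where "t \<in> {t0..<T}" "p \<notin> \<Omega> t"
proof -
  have "\<forall>\<^sub>F s in at_left T. frontier (\<Omega> s) \<subseteq> ball q (dist q p)"
    using assms by (simp add: contracts_to_point_def)
  moreover have "\<forall>\<^sub>F s in at_left T. t0 < s" using less by (auto simp: eventually_at_left_field)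
  moreover have "\<forall>\<^sub>F s in at_left T. s < T" by (simp add: eventually_at_filter)
  ultimately have "\<forall>\<^sub>F s in at_left T. frontier (\<Omega> s) \<subseteq> ball q (dist q p) \<and> t0 < s \<and> s < T" by eventually_elim blast
  then obtain s where s: "frontier (\<Omega> s) \<subseteq> ball q (dist q p)" "t0 < s" "s < T"
    using eventually_happens'[OF trivial_limit_at_left_real] by blast
  then have sI: "s \<in> {t0..<T}" by auto
  interpret B: parametrized_body "\<Omega> s" "\<lambda>z. g (z, s)" "\<lambda>z v. dg (z, s) (v, 0)"
    by (rule body[OF sI])
  \<comment> \<open>A compact convex set is the hull of its frontier, so a frontier inside a small
    ball confines the whole body.\<close>
  have "\<Omega> s = convex hull (frontier (\<Omega> s))" by (rule Krein_Milman_frontier[OF B.convex_K B.compact_K])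
  also have "\<dots> \<subseteq> ball q (dist q p)" by (rule hull_minimal) (use s(1) in auto)
  finally have "p \<notin> \<Omega> s" by auto
  with sI show thesis by (rule that)
qed

lemma harnack_tangent:
  assumes "t \<in> {t0<..<T}" "z \<in> sphere 0 1" "V \<in> tangent_space (frontier (\<Omega> t)) (X z t)"
  shows "0 \<le> harnack_quantity \<Omega> X z t V + mean_curvature (\<Omega> t) (X z t) / (2 * (t - t0))"
proof -
  have t: "t \<in> {t0..<T}" using assms(1) by auto
  have "n z t \<bullet> V = 0"
    using assms(3) parametrized_body.tangent_space_normal[OF body[OF t] assms(2)]
    by (simp only: normal_eq[OF t] g_eq[OF assms(2) t] mem_Collect_eq)
  then obtain v where "z \<bullet> v = 0" "V = dg (z, t) (v, 0)" using n_perpE[OF assms(2) t] by blast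
  then show ?thesis using harnack[OF assms(2,1)] by (simp add: H_def g_eq[OF assms(2) t])
qed

end

section \<open>Restarting the flow at an arbitrary time\<close>

lemma convex_flow_exists:
  fixes \<Omega> :: "real \<Rightarrow> 'a::euclidean_space set"
  assumes "2 \<le> DIM('a)" "t0 < T" and flow: "convex_mean_curvature_flow {t0..<T} \<Omega> X"
  obtains g U where "convex_flow \<Omega> X t0 T g U"
proof -
  have "smooth_on (sphere 0 1 \<times> {t0..<T}) (\<lambda>(z, t). X z t)"
    using flow by (simp add: convex_mean_curvature_flow_def smooth_parametrization_def)
  then obtain U g where "sphere 0 1 \<times> {t0..<T} \<subseteq> U" and C: "\<And>k. Ck_on k U g"
    and "\<forall>x\<in>sphere 0 1 \<times> {t0..<T}. g x = (case x of (z, t) \<Rightarrow> X z t)"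
    by (auto simp: smooth_on_def)
  then have "convex_flow \<Omega> X t0 T g U"
    by (intro convex_flow.intro C assms) auto
  then show thesis by (rule that)
qed

text \<open>Lets any time of a flow, in particular of an ancient one, serve as initial time.\<close>

lemma convex_mean_curvature_flow_subset:
  assumes flow: "convex_mean_curvature_flow I \<Omega> X" and "J \<subseteq> I"
  shows "convex_mean_curvature_flow J \<Omega> X"
  unfolding convex_mean_curvature_flow_def smooth_parametrization_def
proof (intro conjI ballI)
  have "smooth_on (sphere 0 1 \<times> I) (\<lambda>(z, t). X z t)"
    using flow by (simp add: convex_mean_curvature_flow_def smooth_parametrization_def)
  then obtain U g where "open U" "sphere 0 1 \<times> I \<subseteq> U" "\<forall>k. Ck_on k U g"
    "\<forall>x\<in>sphere 0 1 \<times> I. g x = (case x of (z, t) \<Rightarrow> X z t)"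
    by (auto simp: smooth_on_def)
  moreover have "sphere (0::'a) 1 \<times> J \<subseteq> sphere 0 1 \<times> I" using \<open>J \<subseteq> I\<close> by blast
  ultimately show "smooth_on (sphere 0 1 \<times> J) (\<lambda>(z, t). X z t)"
    unfolding smooth_on_def by (intro exI[of _ U] exI[of _ g]) blast
  fix t z assume "t \<in> J" "z \<in> sphere (0::'a) 1"
  then have "((\<lambda>s. X z s) has_vector_derivative
      - mean_curvature (\<Omega> t) (X z t) *\<^sub>R outward_normal (\<Omega> t) (X z t)) (at t within I)"
    using flow \<open>J \<subseteq> I\<close> unfolding convex_mean_curvature_flow_def by blast
  then show "((\<lambda>s. X z s) has_vector_derivative
      - mean_curvature (\<Omega> t) (X z t) *\<^sub>R outward_normal (\<Omega> t) (X z t)) (at t within J)"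
    by (rule has_vector_derivative_within_subset) fact
qed (use flow \<open>J \<subseteq> I\<close> in \<open>auto simp: convex_mean_curvature_flow_def smooth_parametrization_def\<close>)

text \<open>\<open>I\<close> stands for \<open>{t0..<T}\<close> or \<open>{..<T}\<close>. Every time
  in \<open>I\<close> is the start of a \<open>convex_flow\<close>, so finite and ancient solutions
  share the treatment of the arrival time.\<close>

locale contracting_flow =
  fixes \<Omega> :: "real \<Rightarrow> 'a::euclidean_space set" and X :: "'a \<Rightarrow> real \<Rightarrow> 'a" and T :: real and q :: 'a
    and I :: "real set"
  assumes flows: "\<And>s. s \<in> I \<Longrightarrow> \<exists>g U. convex_flow \<Omega> X s T g U"
    and I: "\<And>s. s \<in> I \<Longrightarrow> {s..<T} \<subseteq> I" "I \<subseteq> {..<T}"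
    and contracts: "contracts_to_point \<Omega> T q"
begin

abbreviation u :: "'a \<Rightarrow> real" where "u \<equiv> arrival_time I \<Omega> T q"

lemma arrival_time_frontier:
  assumes s: "s \<in> I" and p: "p \<in> \<Omega> s" "p \<noteq> q"
  shows "u p \<in> I" and "p \<in> frontier (\<Omega> (u p))"
proof -
  obtain g U where "convex_flow \<Omega> X s T g U" using flows[OF s] by blast
  then interpret convex_flow \<Omega> X s T g U .
  obtain t' where "t' \<in> {s..<T}" "p \<notin> \<Omega> t'" using leaves_eventually[OF contracts p(2)] .
  then obtain t where t: "t \<in> {s..<T}" "p \<in> frontier (\<Omega> t)" using exits_through_frontier[OF p(1)] by blast
  have tI: "t \<in> I" using t(1) I(1)[OF s] by blast
  have neq: False if ab: "a \<in> I" "b \<in> I" "p \<in> frontier (\<Omega> a)" "p \<in> frontier (\<Omega> b)" "a < b" for a b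
  proof -
    obtain g' U' where F: "convex_flow \<Omega> X a T g' U'" using flows[OF ab(1)] by blast
    have "a < T" "b < T" using ab I(2) by auto
    then have "p \<notin> \<Omega> b" using convex_flow.frontier_leaves[OF F _ ab(3) ab(5)] by auto
    moreover have "b \<in> {a..<T}" using ab(5) \<open>b < T\<close> by simp
    then have "frontier (\<Omega> b) \<subseteq> \<Omega> b"
      using parametrized_body.frontier_subset[OF convex_flow.body[OF F]] by blast
    ultimately show False using ab(4) by blast
  qed
  have "(THE t. t \<in> I \<and> p \<in> frontier (\<Omega> t)) = t"
    by (rule the_equality) (use tI t neq in \<open>meson linorder_neqE_linordered_idom\<close>)+
  then have "u p = t" using p(2) by (simp add: arrival_time_def)
  with tI t show "u p \<in> I" "p \<in> frontier (\<Omega> (u p))" by auto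
qed

text \<open>Monotonicity and \<open>frontier_leaves\<close> make the bodies superlevel sets of
  \<open>u\<close>, which converts inclusions of bodies into inequalities for \<open>u\<close>. The
  point \<open>q\<close> lies in every body, in accordance with its value \<open>T\<close>.\<close>

lemma mem_iff_le_arrival_time:
  assumes s: "s \<in> I" and p: "p \<in> \<Omega> s" and t: "t \<in> I"
  shows "p \<in> \<Omega> t \<longleftrightarrow> t \<le> u p"
proof (cases "p = q")
  case True
  obtain g U where F: "convex_flow \<Omega> X t T g U" using flows[OF t] by blast
  have "t < T" using t I(2) by auto
  then show ?thesis using convex_flow.center_mem[OF F contracts, of t] True by (simp add: arrival_time_def)
next
  case False
  note u = arrival_time_frontier[OF s p False]
  have T: "t < T" "u p < T" using t u I(2) by auto
  show ?thesis
  proof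
    assume "p \<in> \<Omega> t"
    obtain g U where F: "convex_flow \<Omega> X (u p) T g U" using flows[OF u(1)] by blast
    have "u p \<in> {u p..<T}" using T by simp
    from convex_flow.frontier_leaves[OF F this u(2) _ T(1)] \<open>p \<in> \<Omega> t\<close> show "t \<le> u p" by force
  next
    assume "t \<le> u p"
    obtain g U where F: "convex_flow \<Omega> X t T g U" using flows[OF t] by blast
    have "u p \<in> {t..<T}" using T \<open>t \<le> u p\<close> by simp
    then have "frontier (\<Omega> (u p)) \<subseteq> \<Omega> (u p)"
      using parametrized_body.frontier_subset[OF convex_flow.body[OF F]] by blast
    then show "p \<in> \<Omega> t" using convex_flow.mono[OF F order_refl \<open>t \<le> u p\<close> T(2)] u(2) by blast
  qed
qed

lemma arrival_time_le:
  assumes "s \<in> I" "p \<in> \<Omega> s"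
  shows "u p \<le> T"
  using arrival_time_frontier(1)[OF assms] I(2) by (cases "p = q") (auto simp: arrival_time_def)

lemma sqrt_arrival_time:
  assumes s: "s \<in> I" and x: "x \<in> \<Omega> s" and y: "y \<in> \<Omega> s" and r: "0 < r" "r < 1"
  shows "r * sqrt (2 * (u x - s)) + (1 - r) * sqrt (2 * (u y - s))
    \<le> sqrt (2 * (u (r *\<^sub>R x + (1 - r) *\<^sub>R y) - s))"
proof -
  let ?z = "r *\<^sub>R x + (1 - r) *\<^sub>R y"
  obtain g U where "convex_flow \<Omega> X s T g U" using flows[OF s] by blast
  then interpret convex_flow \<Omega> X s T g U .
  have "?z \<in> \<Omega> s"
    using parametrized_body.convex_K[OF body[of s]] less x y r by (auto simp: convex_def)
  define w where "w p = sqrt (2 * (u p - s))" for p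
  have w0: "w p \<ge> 0" and w2: "(w p)\<^sup>2 = 2 * (u p - s)" if "p \<in> \<Omega> s" for p
    using mem_iff_le_arrival_time[OF s that s] that by (auto simp: w_def)
  \<comment> \<open>\<open>u p\<close> may equal \<open>T\<close>, where there is no body. The
    factor \<open>\<theta> < 1\<close> keeps all times below \<open>T\<close> and tends to 1 in the
    end.\<close>
  have mem: "p \<in> \<Omega> (tm (\<theta> * w p))" "tm (\<theta> * w p) < T" if p: "p \<in> \<Omega> s" and \<theta>: "0 < \<theta>" "\<theta> < 1" for p \<theta>
  proof -
    have "tm (\<theta> * w p) = s + \<theta>\<^sup>2 * (u p - s)"
      using w2[OF p] by (simp add: tm_def power_mult_distrib)
    moreover have up: "s \<le> u p" "u p \<le> T"
      using mem_iff_le_arrival_time[OF s p s] p arrival_time_le[OF s p] by auto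
    moreover have "\<theta>\<^sup>2 < 1" using \<theta> by (simp add: power_less_one_iff)
    ultimately have le: "tm (\<theta> * w p) \<le> u p"
      using mult_right_mono[of "\<theta>\<^sup>2" 1 "u p - s"] by simp
    show "tm (\<theta> * w p) < T"
    proof (cases "u p = s")
      case True
      then show ?thesis using \<open>tm (\<theta> * w p) = s + \<theta>\<^sup>2 * (u p - s)\<close> less by simp
    next
      case False
      then have "\<theta>\<^sup>2 * (u p - s) < 1 * (u p - s)"
        using \<open>\<theta>\<^sup>2 < 1\<close> up by (intro mult_strict_right_mono) auto
      then show ?thesis using \<open>tm (\<theta> * w p) = s + \<theta>\<^sup>2 * (u p - s)\<close> up by simp
    qed
    then have "tm (\<theta> * w p) \<in> I" using I(1)[OF s] by (auto simp: tm_def)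
    with le show "p \<in> \<Omega> (tm (\<theta> * w p))" using mem_iff_le_arrival_time[OF s p] by blast
  qed
  have "r * w x + (1 - r) * w y \<le> w ?z"
  proof (rule field_le_mult_one_interval)
    fix \<theta> :: real assume \<theta>: "0 < \<theta>" "\<theta> < 1"
    let ?a = "r * (\<theta> * w x) + (1 - r) * (\<theta> * w y)"
    have z: "?z \<in> \<Omega> (tm ?a)"
      using \<theta> r w0[OF x] w0[OF y] by (intro minkowski_concave mem x y) auto
    have a: "0 \<le> ?a" using \<theta> r w0[OF x] w0[OF y] by (intro add_nonneg_nonneg mult_nonneg_nonneg) auto
    have "?a \<le> max (\<theta> * w x) (\<theta> * w y)"
      using convex_bound_le[of "\<theta> * w x" "max (\<theta> * w x) (\<theta> * w y)" "\<theta> * w y" r "1 - r"] r by simp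
    moreover have "tm (max (\<theta> * w x) (\<theta> * w y)) < T" using mem(2)[OF x \<theta>] mem(2)[OF y \<theta>] by (simp add: max_def)
    ultimately have "tm ?a \<in> {s..<T}" using tm_in[OF a] by blast
    then have "tm ?a \<in> I" using I(1)[OF s] by blast
    then have "tm ?a \<le> u ?z" using mem_iff_le_arrival_time[OF s \<open>?z \<in> \<Omega> s\<close>] z by blast
    then have "?a\<^sup>2 \<le> 2 * (u ?z - s)" by (simp add: tm_def)
    then have "?a \<le> w ?z" using a unfolding w_def by (intro real_le_rsqrt)
    then show "\<theta> * (r * w x + (1 - r) * w y) \<le> w ?z" by (simp add: algebra_simps)
  qed
  then show ?thesis by (simp add: w_def)
qed

end

section \<open>Conclusion for finite and ancient solutions\<close>

lemma concave_onI_open_segment: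
  assumes "convex S"
    and "\<And>r x y. x \<in> S \<Longrightarrow> y \<in> S \<Longrightarrow> 0 < r \<Longrightarrow> r < 1 \<Longrightarrow> r * f x + (1 - r) * f y \<le> f (r *\<^sub>R x + (1 - r) *\<^sub>R y)"
  shows "concave_on S f"
  unfolding concave_on_iff
proof (intro conjI ballI allI impI)
  fix x y and a b :: real assume *: "x \<in> S" "y \<in> S" "0 \<le> a" "0 \<le> b" "a + b = 1"
  then have b: "b = 1 - a" by simp
  show "a * f x + b * f y \<le> f (a *\<^sub>R x + b *\<^sub>R y)"
  proof (cases "a = 0 \<or> a = 1")
    case False
    then show ?thesis using assms(2)[of x y a] * unfolding b by auto
  qed (use b in auto)
qed fact

theorem corollary2p2:
  fixes \<Omega> :: "real \<Rightarrow> 'a::euclidean_space set"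
    and X :: "'a \<Rightarrow> real \<Rightarrow> 'a"
    and T :: real and q :: 'a
  assumes "DIM('a) \<ge> 2"
    and "contracts_to_point \<Omega> T q"
  shows
    "(\<forall>t0<T. convex_mean_curvature_flow {t0..<T} \<Omega> X \<longrightarrow>
        concave_on (\<Omega> t0) (\<lambda>p. sqrt (2 * (arrival_time {t0..<T} \<Omega> T q p - t0))) \<and>
        (concave_on (\<Omega> t0) (\<lambda>p. sqrt (2 * (arrival_time {t0..<T} \<Omega> T q p - t0))) \<longleftrightarrow>
         (\<forall>t\<in>{t0<..<T}. \<forall>z\<in>sphere 0 1. \<forall>V\<in>tangent_space (frontier (\<Omega> t)) (X z t).
            harnack_quantity \<Omega> X z t V
              + mean_curvature (\<Omega> t) (X z t) / (2 * (t - t0)) \<ge> 0))) \<and>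
     (convex_mean_curvature_flow {..<T} \<Omega> X \<longrightarrow>
        concave_on (\<Union>t\<in>{..<T}. \<Omega> t) (arrival_time {..<T} \<Omega> T q) \<and>
        (concave_on (\<Union>t\<in>{..<T}. \<Omega> t) (arrival_time {..<T} \<Omega> T q) \<longleftrightarrow>
         (\<forall>t\<in>{..<T}. \<forall>z\<in>sphere 0 1. \<forall>V\<in>tangent_space (frontier (\<Omega> t)) (X z t).
            harnack_quantity \<Omega> X z t V \<ge> 0)))"
proof -
  have flow_ext: "\<exists>g U. convex_flow \<Omega> X s T g U"
    if "convex_mean_curvature_flow I \<Omega> X" "{s..<T} \<subseteq> I" "s < T" for s I
    using convex_flow_exists[OF assms(1) that(3) convex_mean_curvature_flow_subset[OF that(1,2)]] by metis
  have finite: "concave_on (\<Omega> t0) (\<lambda>p. sqrt (2 * (arrival_time {t0..<T} \<Omega> T q p - t0)))"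
    if t0: "t0 < T" and flow: "convex_mean_curvature_flow {t0..<T} \<Omega> X" for t0
  proof -
    interpret contracting_flow \<Omega> X T q "{t0..<T}"
      by unfold_locales (use flow_ext[OF flow] assms(2) in auto)
    obtain g U where F: "convex_flow \<Omega> X t0 T g U" using flow_ext[OF flow _ t0] by blast
    have t0I: "t0 \<in> {t0..<T}" using t0 by simp
    show ?thesis
      by (intro concave_onI_open_segment parametrized_body.convex_K[OF convex_flow.body[OF F t0I]]
          sqrt_arrival_time[OF t0I])
  qed
  have finite': "0 \<le> harnack_quantity \<Omega> X z t V + mean_curvature (\<Omega> t) (X z t) / (2 * (t - t0))"
    if H: "convex_mean_curvature_flow I \<Omega> X" "{t0..<T} \<subseteq> I" "t \<in> {t0<..<T}" "z \<in> sphere 0 1"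
      "V \<in> tangent_space (frontier (\<Omega> t)) (X z t)" for I t0 t z V
  proof -
    have "t0 < T" using H(3) by simp
    then obtain g U where "convex_flow \<Omega> X t0 T g U" using flow_ext[OF H(1,2)] by blast
    then show ?thesis using H(3-5) by (rule convex_flow.harnack_tangent)
  qed
  have ancient: "concave_on (\<Union>t\<in>{..<T}. \<Omega> t) (arrival_time {..<T} \<Omega> T q)"
    if flow: "convex_mean_curvature_flow {..<T} \<Omega> X"
  proof -
    have flow_from: "\<exists>g U. convex_flow \<Omega> X s T g U" if "s < T" for s
      by (rule flow_ext[OF flow _ that]) auto
    interpret contracting_flow \<Omega> X T q "{..<T}"
      by unfold_locales (use flow_from assms(2) in auto)
    have mono: "\<Omega> t \<subseteq> \<Omega> s" if "s \<le> t" "t < T" for s t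
    proof -
      have "s < T" using that by simp
      then obtain g U where F: "convex_flow \<Omega> X s T g U" using flow_from by blast
      show ?thesis by (rule convex_flow.mono[OF F order_refl that])
    qed
    have conv: "convex (\<Omega> t)" if "t < T" for t
      using flow that by (auto simp: convex_mean_curvature_flow_def convex_body_def)
    \<comment> \<open>The bodies grow backwards in time, so two points lie in a common one at
      arbitrarily early times; \<open>c\<close> prescribes how early.\<close>
    have common: "\<exists>s<c. s < T \<and> x \<in> \<Omega> s \<and> y \<in> \<Omega> s" if xy: "x \<in> (\<Union>t\<in>{..<T}. \<Omega> t)" "y \<in> (\<Union>t\<in>{..<T}. \<Omega> t)" for x y c
    proof -
      obtain a b where ab: "a < T" "x \<in> \<Omega> a" "b < T" "y \<in> \<Omega> b" using xy by auto
      define s where "s = min (min a b) (c - 1)"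
      have "s \<le> a" "s \<le> b" "s < c" "s < T" using ab by (auto simp: s_def)
      then show ?thesis using mono[of s a] mono[of s b] ab by blast
    qed
    show ?thesis
    proof (rule concave_onI_open_segment)
      show "convex (\<Union>t\<in>{..<T}. \<Omega> t)"
      proof (rule convexI)
        fix x y and a b :: real
        assume xy: "x \<in> (\<Union>t\<in>{..<T}. \<Omega> t)" "y \<in> (\<Union>t\<in>{..<T}. \<Omega> t)" and ab: "0 \<le> a" "0 \<le> b" "a + b = 1"
        obtain s where "s < T" "x \<in> \<Omega> s" "y \<in> \<Omega> s" using common[OF xy] by blast
        then show "a *\<^sub>R x + b *\<^sub>R y \<in> (\<Union>t\<in>{..<T}. \<Omega> t)"
          using convexD[OF conv[OF \<open>s < T\<close>] _ _ ab] by blast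
      qed
    next
      fix r x y
      assume xy: "x \<in> (\<Union>t\<in>{..<T}. \<Omega> t)" "y \<in> (\<Union>t\<in>{..<T}. \<Omega> t)" and r: "0 < r" "r < (1::real)"
      let ?z = "r *\<^sub>R x + (1 - r) *\<^sub>R y"
      define \<Delta> where "\<Delta> = u x - u y"
      show "r * u x + (1 - r) * u y \<le> u ?z"
      proof (rule field_le_epsilon)
        fix \<epsilon> :: real assume \<epsilon>: "0 < \<epsilon>"
        \<comment> \<open>Squaring the inequality for the roots loses
          \<open>r (1 - r) (sqrt a - sqrt b)^2\<close>. As \<open>a - b = \<Delta>\<close> does not
          depend on \<open>s\<close>, this is at most \<open>\<Delta>^2 / a\<close>, and an early
          start makes it at most \<epsilon>.\<close>
        obtain s where s: "s < u x - \<Delta>\<^sup>2 / \<epsilon> - 1" "s < T" "x \<in> \<Omega> s" "y \<in> \<Omega> s" using common[OF xy] by blast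
        then have sI: "s \<in> {..<T}" by simp
        define a b where "a = u x - s" and "b = u y - s"
        have ab: "a > 0" "b \<ge> 0" "\<Delta>\<^sup>2 / \<epsilon> < a"
          using s mem_iff_le_arrival_time[OF sI s(3) sI] mem_iff_le_arrival_time[OF sI s(4) sI]
            divide_nonneg_pos[OF zero_le_power2 \<epsilon>, of \<Delta>] by (auto simp: a_def b_def)
        have z: "?z \<in> \<Omega> s" using convexD[OF conv[OF s(2)] s(3,4), of r "1 - r"] r by simp
        have "r * sqrt (2 * a) + (1 - r) * sqrt (2 * b) \<le> sqrt (2 * (u ?z - s))"
          using sqrt_arrival_time[OF sI s(3,4) r] by (simp only: a_def b_def)
        then have "(r * sqrt (2 * a) + (1 - r) * sqrt (2 * b))\<^sup>2 \<le> (sqrt (2 * (u ?z - s)))\<^sup>2"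
          using r ab by (intro power_mono) auto
        also have "\<dots> = 2 * (u ?z - s)"
          using mem_iff_le_arrival_time[OF sI z sI] z by simp
        also have "(r * sqrt (2 * a) + (1 - r) * sqrt (2 * b))\<^sup>2 = 2 * (r * sqrt a + (1 - r) * sqrt b)\<^sup>2"
        proof -
          have "r * sqrt (2 * a) + (1 - r) * sqrt (2 * b) = sqrt 2 * (r * sqrt a + (1 - r) * sqrt b)"
            by (simp add: real_sqrt_mult algebra_simps)
          then show ?thesis by (simp add: power_mult_distrib)
        qed
        also have "(r * sqrt a + (1 - r) * sqrt b)\<^sup>2 = r * (sqrt a)\<^sup>2 + (1 - r) * (sqrt b)\<^sup>2 - r * (1 - r) * (sqrt a - sqrt b)\<^sup>2"
        proof -
          have "(r * v + (1 - r) * w)\<^sup>2 = r * v\<^sup>2 + (1 - r) * w\<^sup>2 - r * (1 - r) * (v - w)\<^sup>2" for v w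
            by (simp add: power2_eq_square algebra_simps)
          then show ?thesis .
        qed
        also have "\<dots> = r * u x + (1 - r) * u y - s - r * (1 - r) * (sqrt a - sqrt b)\<^sup>2"
          using ab by (simp add: a_def b_def algebra_simps)
        finally have main: "r * u x + (1 - r) * u y \<le> u ?z + r * (1 - r) * (sqrt a - sqrt b)\<^sup>2" by simp
        have "(sqrt a - sqrt b)\<^sup>2 * a \<le> (sqrt a - sqrt b)\<^sup>2 * (sqrt a + sqrt b)\<^sup>2"
        proof (rule mult_left_mono)
          have "(sqrt a)\<^sup>2 \<le> (sqrt a + sqrt b)\<^sup>2" using ab by (intro power_mono) auto
          then show "a \<le> (sqrt a + sqrt b)\<^sup>2" using ab by simp
        qed simp
        also have "\<dots> = ((sqrt a)\<^sup>2 - (sqrt b)\<^sup>2)\<^sup>2"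
        proof -
          have "(v - w)\<^sup>2 * (v + w)\<^sup>2 = (v\<^sup>2 - w\<^sup>2)\<^sup>2" for v w :: real
            by (simp add: power2_eq_square algebra_simps)
          then show ?thesis .
        qed
        also have "\<dots> = \<Delta>\<^sup>2" using ab by (simp add: a_def b_def \<Delta>_def)
        also have "\<dots> \<le> \<epsilon> * a" using ab(3) \<epsilon> by (simp add: field_simps)
        finally have "(sqrt a - sqrt b)\<^sup>2 \<le> \<epsilon>" using ab(1) by simp
        then have "r * (1 - r) * (sqrt a - sqrt b)\<^sup>2 \<le> 1 * \<epsilon>"
          using r \<epsilon> by (intro mult_mono mult_le_one) auto
        with main show "r * u x + (1 - r) * u y \<le> u ?z + \<epsilon>" by simp
      qed
    qed
  qed
  have ancient': "0 \<le> harnack_quantity \<Omega> X z t V"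
    if flow: "convex_mean_curvature_flow {..<T} \<Omega> X" and t: "t < T" and z: "z \<in> sphere 0 1"
      and V: "V \<in> tangent_space (frontier (\<Omega> t)) (X z t)" for t z V
  proof (rule field_le_epsilon)
    fix \<epsilon> :: real assume "0 < \<epsilon>"
    define h where "h = mean_curvature (\<Omega> t) (X z t)"
    \<comment> \<open>The elapsed time \<open>t - s\<close> is long enough for
      \<open>h / (2 (t - s)) \<le> \<epsilon>\<close>; adding 1 keeps it positive when
      \<open>h = 0\<close>.\<close>
    define s where "s = t - (\<bar>h\<bar> + 1) / (2 * \<epsilon>)"
    have st: "t - s > 0" using \<open>0 < \<epsilon>\<close> by (auto simp: s_def intro!: divide_pos_pos)
    have "0 \<le> harnack_quantity \<Omega> X z t V + h / (2 * (t - s))"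
      unfolding h_def by (rule finite'[OF flow _ _ z V]) (use st t in auto)
    moreover have "h / (2 * (t - s)) \<le> \<epsilon>"
    proof -
      have "h \<le> \<epsilon> * (2 * (t - s))" using \<open>0 < \<epsilon>\<close> by (simp add: s_def)
      then show ?thesis using st by (simp add: pos_divide_le_eq)
    qed
    ultimately show "0 \<le> harnack_quantity \<Omega> X z t V + \<epsilon>" by linarith
  qed
  \<comment> \<open>Each equivalence holds because both of its sides have been proved.\<close>
  show ?thesis
    by (intro conjI allI impI iffI ballI)
      (simp_all only: lessThan_iff finite finite'[OF _ order_refl] ancient ancient')
qed

end
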